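(* Let $M^3$ be an indefinite affine hypersphere of $\mathbb{R}^4$ with $H=1$ which admits a pointwise $S_3$-symmetry, and assume that the invariant functions satisfy $(\alpha_{22},\alpha_{23})\neq(\pm1,0)$ everywhere. Then $M^3$ admits coordinates $(t,v,w)$ and there are functions $\eta,k$ of $(v,w)$ such that $$\alpha_{22}=\frac{\sinh t\cosh t}{\cos^2\eta+\sinh^2t},\quad \alpha_{23}=-\frac{\sin\eta\cos\eta}{\cos^2\eta+\sinh^2t},\quad a_6=\frac{e^k}{\sqrt{\cos^2\eta+\sinh^2t}},$$ where $\eta,k$ satisfy $$\Big(\tfrac{\partial^2}{\partial v^2}+\tfrac{\partial^2}{\partial w^2}\Big)\eta=-e^{-\frac23k}\sin(2\eta),\qquad \Big(\tfrac{\partial^2}{\partial v^2}+\tfrac{\partial^2}{\partial w^2}\Big)k=3e^{-\frac23k}\big(2e^{2k}+\cos(2\eta)\big).$$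
   Context: Setting: $\varphi:M^3\to\mathbb{R}^4$ nondegenerate hypersurface with Blaschke normal $\xi$, $D_X\varphi_*Y=\varphi_*(\nabla_XY)+h(X,Y)\xi$, $D_X\xi=-\varphi_*(SX)$; $h$ affine metric (Lorentzian), $K=\nabla-\hat\nabla$ the difference tensor, $\hat\nabla$ the Levi-Civita connection of $h$. Affine hypersphere: $S=H\,\mathrm{Id}$, $H$ constant. Pointwise $G$-symmetry: for every $p$ the group of $h_p$-isometries $L$ of $T_pM$ with $\det L=1$ and $K_p(LX,LY)=LK_p(X,Y)$ is isomorphic to $G$. Under pointwise $S_3$-symmetry there is locally an $h$-orthonormal frame $\{T,V,W\}$ ($h(T,T)=-1$, $h(V,V)=h(W,W)=1$) and a function $a_6>0$ with $K(T,X)=0$ for all $X$, $K(V,V)=a_6V$, $K(V,W)=-a_6W$, $K(W,W)=-a_6V$; the invariant functions are $\alpha_{22}:=h(\hat\nabla_VT,V)$ and $\alpha_{23}:=h(\hat\nabla_VT,W)$. (The paper denotes the function $\eta$ by $h$; renamed to avoid clash with the metric.) *)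

theory Defs
  imports "HOL-Analysis.Analysis" "HOL-Algebra.Sym_Groups"
begin

fun ddir :: "'a::real_normed_vector list \<Rightarrow> ('a \<Rightarrow> 'b::real_normed_vector) \<Rightarrow> 'a \<Rightarrow> 'b" where
  "ddir [] f = f"
| "ddir (v # vs) f = (\<lambda>p. frechet_derivative (ddir vs f) (at p) v)"

definition smooth_on :: "'a::real_normed_vector set \<Rightarrow> ('a \<Rightarrow> 'b::real_normed_vector) \<Rightarrow> bool" where
  "smooth_on U f \<longleftrightarrow> (\<forall>vs. ddir vs f differentiable_on U)"

definition dphi :: "(real^3 \<Rightarrow> real^4) \<Rightarrow> real^3 \<Rightarrow> real^3 \<Rightarrow> real^4" where
  "dphi \<phi> p X = frechet_derivative \<phi> (at p) X"

definition d2phi :: "(real^3 \<Rightarrow> real^4) \<Rightarrow> real^3 \<Rightarrow> real^3 \<Rightarrow> real^3 \<Rightarrow> real^4" where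
  "d2phi \<phi> p X Y = frechet_derivative (\<lambda>q. frechet_derivative \<phi> (at q) Y) (at p) X"

definition hdet :: "(real^3 \<Rightarrow> real^3 \<Rightarrow> real^3 \<Rightarrow> real) \<Rightarrow> real^3 \<Rightarrow> real" where
  "hdet h p = det ((\<chi> i j. h p (axis i 1) (axis j 1)) :: real^3^3)"

definition theta :: "(real^3 \<Rightarrow> real^4) \<Rightarrow> (real^3 \<Rightarrow> real^4) \<Rightarrow> real^3 \<Rightarrow> real" where
  "theta \<phi> \<xi> p = det ((vector [dphi \<phi> p (axis 1 1), dphi \<phi> p (axis 2 1),
                                dphi \<phi> p (axis 3 1), \<xi> p]) :: real^4^4)"

text \<open>xi is the affine (Blaschke) normal of phi on U, with induced connection
  (coefficients Gamma, i.e. nabla_X Y = D_X Y + Gamma(X,Y)) and affine metric h: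
  transversal, Gauss formula, equiaffine (D xi tangent), h nondegenerate and
  the volume condition |det(phi_*e1,phi_*e2,phi_*e3,xi)| = |det h|^(1/2).\<close>
definition blaschke_structure ::
  "(real^3) set \<Rightarrow> (real^3 \<Rightarrow> real^4) \<Rightarrow> (real^3 \<Rightarrow> real^4)
   \<Rightarrow> (real^3 \<Rightarrow> real^3 \<Rightarrow> real^3 \<Rightarrow> real^3) \<Rightarrow> (real^3 \<Rightarrow> real^3 \<Rightarrow> real^3 \<Rightarrow> real) \<Rightarrow> bool" where
  "blaschke_structure U \<phi> \<xi> \<Gamma> h \<longleftrightarrow>
     (\<forall>p\<in>U. \<xi> p \<notin> range (dphi \<phi> p)) \<and>
     (\<forall>p\<in>U. \<forall>X Y. d2phi \<phi> p X Y = dphi \<phi> p (\<Gamma> p X Y) + h p X Y *\<^sub>R \<xi> p) \<and>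
     (\<forall>p\<in>U. \<xi> differentiable (at p) \<and> (\<forall>X. frechet_derivative \<xi> (at p) X \<in> range (dphi \<phi> p))) \<and>
     (\<forall>p\<in>U. hdet h p \<noteq> 0 \<and> \<bar>theta \<phi> \<xi> p\<bar> = sqrt \<bar>hdet h p\<bar>)"

text \<open>Affine hypersphere with S = H Id, H = 1:  D_X xi = - phi_*(X).\<close>
definition hypersphere_H1 :: "(real^3) set \<Rightarrow> (real^3 \<Rightarrow> real^4) \<Rightarrow> (real^3 \<Rightarrow> real^4) \<Rightarrow> bool" where
  "hypersphere_H1 U \<phi> \<xi> \<longleftrightarrow> (\<forall>p\<in>U. (\<xi> has_derivative (\<lambda>X. - dphi \<phi> p X)) (at p))"

text \<open>Gamma_hat are the coefficients of the Levi-Civita connection of h: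
  torsion free and metric (for constant coordinate fields Y, Z).\<close>
definition levi_civita ::
  "(real^3) set \<Rightarrow> (real^3 \<Rightarrow> real^3 \<Rightarrow> real^3 \<Rightarrow> real) \<Rightarrow> (real^3 \<Rightarrow> real^3 \<Rightarrow> real^3 \<Rightarrow> real^3) \<Rightarrow> bool" where
  "levi_civita U h \<Gamma>h \<longleftrightarrow>
     (\<forall>p\<in>U. (\<forall>X Y. \<Gamma>h p X Y = \<Gamma>h p Y X) \<and>
       (\<forall>Y Z. ((\<lambda>q. h q Y Z) has_derivative
                 (\<lambda>X. h p (\<Gamma>h p X Y) Z + h p Y (\<Gamma>h p X Z))) (at p)))"

definition Kdiff :: "(real^3 \<Rightarrow> real^3 \<Rightarrow> real^3 \<Rightarrow> real^3) \<Rightarrow> (real^3 \<Rightarrow> real^3 \<Rightarrow> real^3 \<Rightarrow> real^3)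
   \<Rightarrow> real^3 \<Rightarrow> real^3 \<Rightarrow> real^3 \<Rightarrow> real^3" where
  "Kdiff \<Gamma> \<Gamma>h p X Y = \<Gamma> p X Y - \<Gamma>h p X Y"

definition Kstab_group :: "(real^3 \<Rightarrow> real^3 \<Rightarrow> real^3 \<Rightarrow> real) \<Rightarrow> (real^3 \<Rightarrow> real^3 \<Rightarrow> real^3 \<Rightarrow> real^3)
   \<Rightarrow> real^3 \<Rightarrow> (real^3 \<Rightarrow> real^3) monoid" where
  "Kstab_group h K p = \<lparr> carrier = {L. linear L \<and> det (matrix L) = 1 \<and>
       (\<forall>X Y. h p (L X) (L Y) = h p X Y) \<and> (\<forall>X Y. K p (L X) (L Y) = L (K p X Y))},
     mult = (\<circ>), one = id \<rparr>"

definition pointwise_S3_symmetric :: "(real^3) set \<Rightarrow> (real^3 \<Rightarrow> real^3 \<Rightarrow> real^3 \<Rightarrow> real)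
   \<Rightarrow> (real^3 \<Rightarrow> real^3 \<Rightarrow> real^3 \<Rightarrow> real^3) \<Rightarrow> bool" where
  "pointwise_S3_symmetric U h K \<longleftrightarrow> (\<forall>p\<in>U. Kstab_group h K p \<cong> sym_group 3)"

definition S3_frame :: "(real^3) set \<Rightarrow> (real^3 \<Rightarrow> real^3 \<Rightarrow> real^3 \<Rightarrow> real)
   \<Rightarrow> (real^3 \<Rightarrow> real^3 \<Rightarrow> real^3 \<Rightarrow> real^3) \<Rightarrow> (real^3 \<Rightarrow> real^3) \<Rightarrow> (real^3 \<Rightarrow> real^3)
   \<Rightarrow> (real^3 \<Rightarrow> real^3) \<Rightarrow> (real^3 \<Rightarrow> real) \<Rightarrow> bool" where
  "S3_frame U h K T V W a6 \<longleftrightarrow>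
     smooth_on U T \<and> smooth_on U V \<and> smooth_on U W \<and>
     (\<forall>p\<in>U. h p (T p) (T p) = -1 \<and> h p (V p) (V p) = 1 \<and> h p (W p) (W p) = 1 \<and>
        h p (T p) (V p) = 0 \<and> h p (T p) (W p) = 0 \<and> h p (V p) (W p) = 0 \<and>
        a6 p > 0 \<and> (\<forall>X. K p (T p) X = 0) \<and>
        K p (V p) (V p) = a6 p *\<^sub>R V p \<and> K p (V p) (W p) = - (a6 p *\<^sub>R W p) \<and>
        K p (W p) (W p) = - (a6 p *\<^sub>R V p))"

definition nablahat_VT :: "(real^3 \<Rightarrow> real^3 \<Rightarrow> real^3 \<Rightarrow> real^3) \<Rightarrow> (real^3 \<Rightarrow> real^3)
   \<Rightarrow> (real^3 \<Rightarrow> real^3) \<Rightarrow> real^3 \<Rightarrow> real^3" where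
  "nablahat_VT \<Gamma>h T V p = frechet_derivative T (at p) (V p) + \<Gamma>h p (V p) (T p)"

definition alpha22 where
  "alpha22 h \<Gamma>h T V p = h p (nablahat_VT \<Gamma>h T V p) (V p)"

definition alpha23 where
  "alpha23 h \<Gamma>h T V W p = h p (nablahat_VT \<Gamma>h T V p) (W p)"

definition lap :: "(real \<times> real \<Rightarrow> real) \<Rightarrow> real \<times> real \<Rightarrow> real" where
  "lap f z = deriv (\<lambda>s. deriv (\<lambda>r. f (r, snd z)) s) (fst z)
           + deriv (\<lambda>s. deriv (\<lambda>r. f (fst z, r)) s) (snd z)"

end

theory Submission
  imports Defs
begin

text \<open>Applying \<open>[X, Y] = X Y - Y X\<close> to the moving frame \<open>(T, V, W, \<xi>)\<close> of the ambient space gives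
  the Gauss and Codazzi equations as algebra on the connection coefficients. They say that
  \<open>\<mu> = \<alpha>22 + i \<alpha>23\<close> satisfies \<open>T \<mu> = 1 - \<mu>^2\<close> and \<open>(V + i W) \<mu> = 0\<close>. Since \<open>\<mu> \<noteq> 1, -1\<close>, one can write
  \<open>\<mu> = tanh (t - i \<eta>)\<close> locally, so that \<open>T t = 1\<close>, \<open>T \<eta> = 0\<close>, and \<open>exp k = a6 * |cosh (t - i \<eta>)|\<close> is
  constant along \<open>T\<close>. The real and imaginary parts of \<open>a6 powr (-1/3) * (cosh (t - i \<eta>)) powr (2/3) * (V - i W)\<close>,
  corrected along \<open>T\<close> so as to annihilate \<open>t\<close>, commute with each other and with \<open>T\<close>. Hence they are
  coordinate fields: the dual forms are closed, therefore exact, and the inverse function theorem applies.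
  The Cauchy-Riemann equations for \<open>t - i \<eta>\<close> and the Gauss equation then become the two
  differential equations.\<close>

section \<open>Smooth functions\<close>

text \<open>Only \<open>\<phi>\<close> and the frame are assumed smooth; the metric, the two
  connections and \<open>a6\<close> are given as bare functions. The moving frame of the ambient
  space repairs this: its derivatives along T, V and W are matrix multiples of itself, and solving
  for these matrices by Cramer's rule makes every coefficient smooth. On the plane of V and W the
  tensor K is the cubic form \<open>a6\<close> Re (x + i y)^3. A cubic form has weight 3 under
  rotations, so the logarithmic derivatives of \<open>a6\<close> along V and W are 3 times the
  rotation coefficients of the frame, up to sign; this is the origin of the exponent -1/3. Along T
  the frame turns at a third of \<alpha>23, which leaves two thirds of \<alpha>23 in [T, V] and
  [T, W]; this is the origin of the exponent 2/3. The bracket [V, W] has T component 2 \<alpha>23.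
  The planes of V and W are therefore in general not integrable, so the fields of v and w cannot
  simply be taken inside them, and a correction along T is forced.\<close>

primrec diffn :: "nat \<Rightarrow> 'a::real_normed_vector set \<Rightarrow> ('a \<Rightarrow> 'b::real_normed_vector) \<Rightarrow> bool" where
  "diffn 0 U f \<longleftrightarrow> f differentiable_on U"
| "diffn (Suc n) U f \<longleftrightarrow> f differentiable_on U \<and> (\<forall>v. diffn n U (\<lambda>p. frechet_derivative f (at p) v))"

lemma diffn_differentiable: "diffn n U f \<Longrightarrow> f differentiable_on U"
  by (cases n) auto

lemma ddir_append: "ddir (us @ vs) f = ddir us (ddir vs f)"
  by (induction us) auto

text \<open>The head of a \<open>ddir\<close> list is the outermost derivative, whereas
  \<open>diffn\<close> takes off the innermost one. The latter order suits inductions that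
  generalise over the function, such as those for products and compositions; the translation needs
  induction on lists from the right.\<close>

lemma smooth_on_iff_diffn: "smooth_on U f \<longleftrightarrow> (\<forall>n. diffn n U f)"
proof
  assume "smooth_on U f"
  have "\<And>f. (\<forall>vs. ddir vs f differentiable_on U) \<Longrightarrow> diffn n U f" for n
  proof (induction n)
    case 0
    from 0[rule_format, of "[]"] show ?case by simp
  next
    case (Suc n)
    have "diffn n U (ddir [v] f)" for v
      by (rule Suc.IH) (metis Suc.prems ddir_append)
    moreover have "f differentiable_on U"
      using Suc.prems[rule_format, of "[]"] by simp
    ultimately show ?case by simp
  qed
  then show "\<forall>n. diffn n U f" using \<open>smooth_on U f\<close> by (auto simp: smooth_on_def)
next
  assume *: "\<forall>n. diffn n U f"
  have "\<And>f. \<forall>n. diffn n U f \<Longrightarrow> ddir vs f differentiable_on U" for vs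
  proof (induction vs rule: rev_induct)
    case Nil
    then show ?case using diffn_differentiable by auto
  next
    case (snoc v vs)
    have "diffn n U (ddir [v] f)" for n
      using snoc.prems[rule_format, of "Suc n"] by simp
    then show ?case using snoc.IH by (simp add: ddir_append)
  qed
  then show "smooth_on U f" using * by (auto simp: smooth_on_def)
qed

lemma smooth_onI: "(\<And>n. diffn n U f) \<Longrightarrow> smooth_on U f"
  by (simp add: smooth_on_iff_diffn)

lemma smooth_onD: "smooth_on U f \<Longrightarrow> diffn n U f"
  by (simp add: smooth_on_iff_diffn)

lemma differentiable_on_has_derivative:
  assumes "f differentiable_on U" "open U" "p \<in> U"
  shows "(f has_derivative frechet_derivative f (at p)) (at p)"
  using assms by (metis at_within_open differentiable_on_def frechet_derivative_works)

lemma differentiable_onI: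
  "(\<And>p. p \<in> U \<Longrightarrow> (f has_derivative f' p) (at p)) \<Longrightarrow> f differentiable_on U"
  by (metis differentiable_at_imp_differentiable_on differentiable_def)

lemmas diffn_has_derivative = differentiable_on_has_derivative[OF diffn_differentiable]

lemma smooth_on_has_derivative:
  assumes "smooth_on U f" "open U" "p \<in> U"
  shows "(f has_derivative frechet_derivative f (at p)) (at p)"
  by (rule diffn_has_derivative[OF smooth_onD[OF assms(1)] assms(2,3)])

lemma frechet_derivative_eqI: "(f has_derivative f') (at p) \<Longrightarrow> frechet_derivative f (at p) = f'"
  by (metis frechet_derivative_at)

lemma frechet_derivative_cong_open:
  assumes "open U" "p \<in> U" "\<And>q. q \<in> U \<Longrightarrow> f q = g q"
  shows "frechet_derivative f (at p) = frechet_derivative g (at p)"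
proof -
  have "(f has_derivative D) (at p) \<longleftrightarrow> (g has_derivative D) (at p)" for D
    using assms has_derivative_transform_within_open[of f D p UNIV U g]
      has_derivative_transform_within_open[of g D p UNIV U f] by auto
  then show ?thesis by (simp add: frechet_derivative_def)
qed

lemma differentiable_on_cong: "(\<And>q. q \<in> U \<Longrightarrow> f q = g q) \<Longrightarrow> f differentiable_on U \<longleftrightarrow> g differentiable_on U"
  unfolding differentiable_on_def differentiable_def
  by (metis (no_types, lifting) has_derivative_transform)

lemma diffn_cong:
  assumes "open U" "\<And>q. q \<in> U \<Longrightarrow> f q = g q"
  shows "diffn n U f \<longleftrightarrow> diffn n U g"
  using assms(2)
proof (induction n arbitrary: f g)
  case 0
  then show ?case using differentiable_on_cong[of U f g] by simp
next
  case (Suc n)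
  have "diffn n U (\<lambda>p. frechet_derivative f (at p) v) = diffn n U (\<lambda>p. frechet_derivative g (at p) v)" for v
    by (rule Suc.IH) (metis frechet_derivative_cong_open[OF \<open>open U\<close>] Suc.prems)
  then show ?case using differentiable_on_cong[of U f g] Suc.prems by simp
qed

lemma smooth_on_cong:
  assumes "open U" "\<And>q. q \<in> U \<Longrightarrow> f q = g q"
  shows "smooth_on U f \<longleftrightarrow> smooth_on U g"
  using diffn_cong[OF assms] by (simp add: smooth_on_iff_diffn)

lemma diffn_subset: "diffn n U f \<Longrightarrow> N \<subseteq> U \<Longrightarrow> diffn n N f"
  by (induction n arbitrary: f) (auto intro: differentiable_on_subset)

lemma smooth_on_subset: "smooth_on U f \<Longrightarrow> N \<subseteq> U \<Longrightarrow> smooth_on N f"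
  by (auto simp: smooth_on_iff_diffn intro: diffn_subset[of _ U])

lemma diffn_Suc_imp: "diffn (Suc n) U f \<Longrightarrow> diffn n U f"
proof (induction n arbitrary: f)
  case (Suc n)
  have "f differentiable_on U" "\<And>v. diffn (Suc n) U (\<lambda>p. frechet_derivative f (at p) v)"
    using Suc.prems by (simp_all only: diffn.simps(2)[of "Suc n"])
  moreover have "diffn n U (\<lambda>p. frechet_derivative f (at p) v)" for v
    by (rule Suc.IH) fact
  ultimately show ?case by simp
qed simp

lemma diffn_SucI:
  assumes "open U" "\<And>p. p \<in> U \<Longrightarrow> (f has_derivative f' p) (at p)"
    and "\<And>v. diffn n U (\<lambda>p. f' p v)"
  shows "diffn (Suc n) U f"
proof -
  have "f differentiable_on U"
    using assms(2) by (metis differentiable_at_imp_differentiable_on differentiable_def)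
  moreover have "diffn n U (\<lambda>p. frechet_derivative f (at p) v)" for v
    by (rule iffD1[OF diffn_cong[OF assms(1)] assms(3)[of v]])
      (simp add: frechet_derivative_eqI[OF assms(2)])
  ultimately show ?thesis by simp
qed

lemma diffn_const: "open U \<Longrightarrow> diffn n U (\<lambda>x. c)"
proof (induction n arbitrary: c)
  case (Suc n)
  show ?case
    by (rule diffn_SucI[of _ _ "\<lambda>_ _. 0"]) (use Suc in \<open>auto\<close>)
qed simp

lemma diffn_linear:
  assumes "bounded_linear L" "open U" "diffn n U f"
  shows "diffn n U (\<lambda>x. L (f x))"
  using assms(3)
proof (induction n arbitrary: f)
  case 0
  have "((\<lambda>x. L (f x)) has_derivative (\<lambda>v. L (frechet_derivative f (at p) v))) (at p)" if "p \<in> U" for p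
    using differentiable_on_has_derivative[OF diffn_differentiable[OF 0] \<open>open U\<close> that]
      bounded_linear.has_derivative[OF assms(1)] by blast
  then show ?case
    unfolding diffn.simps by (rule differentiable_onI)
next
  case (Suc n)
  show ?case
  proof (rule diffn_SucI[OF \<open>open U\<close>])
    show "((\<lambda>x. L (f x)) has_derivative (\<lambda>v. L (frechet_derivative f (at p) v))) (at p)" if "p \<in> U" for p
      using differentiable_on_has_derivative[OF diffn_differentiable[OF Suc.prems] \<open>open U\<close> that]
        bounded_linear.has_derivative[OF assms(1)] by blast
    show "diffn n U (\<lambda>p. L (frechet_derivative f (at p) v))" for v
      using Suc by auto
  qed
qed

lemma diffn_add:
  assumes "open U" "diffn n U f" "diffn n U g"
  shows "diffn n U (\<lambda>x. f x + g x)"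
  using assms(2,3)
proof (induction n arbitrary: f g)
  case (Suc n)
  show ?case
  proof (rule diffn_SucI[OF \<open>open U\<close>])
    show "((\<lambda>x. f x + g x) has_derivative (\<lambda>v. frechet_derivative f (at p) v + frechet_derivative g (at p) v)) (at p)"
      if "p \<in> U" for p
      using diffn_has_derivative[OF Suc.prems(1) \<open>open U\<close> that] diffn_has_derivative[OF Suc.prems(2) \<open>open U\<close> that]
      by (rule has_derivative_add)
  qed (use Suc in auto)
qed (auto intro: differentiable_on_add)

lemma diffn_bilinear:
  assumes B: "bounded_bilinear B" and "open U" "diffn n U f" "diffn n U g"
  shows "diffn n U (\<lambda>x. B (f x) (g x))"
  using assms(3,4)
proof (induction n arbitrary: f g)
  case 0
  have "((\<lambda>x. B (f x) (g x)) has_derivative (\<lambda>v. B (f p) (frechet_derivative g (at p) v) + B (frechet_derivative f (at p) v) (g p))) (at p)"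
      if "p \<in> U" for p
    using diffn_has_derivative[OF 0(1) \<open>open U\<close> that] diffn_has_derivative[OF 0(2) \<open>open U\<close> that]
    by (rule bounded_bilinear.FDERIV[OF B])
  then show ?case
    unfolding diffn.simps by (rule differentiable_onI)
next
  case (Suc n)
  show ?case
  proof (rule diffn_SucI[OF \<open>open U\<close>])
    show "((\<lambda>x. B (f x) (g x)) has_derivative (\<lambda>v. B (f p) (frechet_derivative g (at p) v) + B (frechet_derivative f (at p) v) (g p))) (at p)"
      if "p \<in> U" for p
      using diffn_has_derivative[OF Suc.prems(1) \<open>open U\<close> that] diffn_has_derivative[OF Suc.prems(2) \<open>open U\<close> that]
      by (rule bounded_bilinear.FDERIV[OF B])
    show "diffn n U (\<lambda>p. B (f p) (frechet_derivative g (at p) v) + B (frechet_derivative f (at p) v) (g p))" for v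
      using Suc.prems Suc.prems[THEN diffn_Suc_imp] by (intro diffn_add \<open>open U\<close> Suc.IH) auto
  qed
qed

text \<open>The outer derivative \<open>g'\<close> is asked for one order less than the conclusion.
  A function whose derivative is expressed through itself, such as \<open>exp\<close> or
  \<open>inverse\<close>, can thus climb by induction on the order.\<close>

lemma diffn_field_chain:
  fixes f :: "'a::real_normed_vector \<Rightarrow> 'b::real_normed_field"
  assumes "open U" "\<And>p. p \<in> U \<Longrightarrow> (g has_field_derivative g' (f p)) (at (f p))"
    and "diffn (Suc n) U f" "diffn n U (\<lambda>x. g' (f x))"
  shows "diffn (Suc n) U (\<lambda>x. g (f x))"
proof (rule diffn_SucI[OF \<open>open U\<close>])
  show "((\<lambda>x. g (f x)) has_derivative (\<lambda>v. g' (f p) * frechet_derivative f (at p) v)) (at p)" if "p \<in> U" for p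
    using has_derivative_compose[OF differentiable_on_has_derivative[OF diffn_differentiable[OF assms(3)] assms(1) that]
        assms(2)[OF that, unfolded has_field_derivative_def]] .
  show "diffn n U (\<lambda>p. g' (f p) * frechet_derivative f (at p) v)" for v
    using assms(3,4) by (intro diffn_bilinear[OF bounded_bilinear_mult] assms(1)) auto
qed

lemma diffn_field_chain_0:
  fixes f :: "'a::real_normed_vector \<Rightarrow> 'b::real_normed_field"
  assumes "open U" "\<And>p. p \<in> U \<Longrightarrow> (g has_field_derivative g' (f p)) (at (f p))"
    and "diffn 0 U f"
  shows "diffn 0 U (\<lambda>x. g (f x))"
proof -
  have "((\<lambda>x. g (f x)) has_derivative (\<lambda>v. g' (f p) * frechet_derivative f (at p) v)) (at p)" if "p \<in> U" for p
    using has_derivative_compose[OF differentiable_on_has_derivative[OF diffn_differentiable[OF assms(3)] assms(1) that]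
        assms(2)[OF that, unfolded has_field_derivative_def]] .
  then show ?thesis
    unfolding diffn.simps by (rule differentiable_onI)
qed

section \<open>Closure properties of smoothness\<close>

lemma smooth_on_const: "open U \<Longrightarrow> smooth_on U (\<lambda>x. c)"
  by (intro smooth_onI diffn_const)

lemma smooth_on_linear: "bounded_linear L \<Longrightarrow> open U \<Longrightarrow> smooth_on U f \<Longrightarrow> smooth_on U (\<lambda>x. L (f x))"
  by (rule smooth_onI, rule diffn_linear) (simp_all add: smooth_onD)

lemma smooth_on_add: "open U \<Longrightarrow> smooth_on U f \<Longrightarrow> smooth_on U g \<Longrightarrow> smooth_on U (\<lambda>x. f x + g x)"
  by (intro smooth_onI diffn_add) (simp_all add: smooth_onD)

lemma smooth_on_bilinear:
  "bounded_bilinear B \<Longrightarrow> open U \<Longrightarrow> smooth_on U f \<Longrightarrow> smooth_on U g \<Longrightarrow> smooth_on U (\<lambda>x. B (f x) (g x))"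
  by (rule smooth_onI, rule diffn_bilinear) (simp_all add: smooth_onD)

lemmas smooth_on_scaleR = smooth_on_bilinear[OF bounded_bilinear_scaleR]
lemmas smooth_on_mult = smooth_on_bilinear[OF bounded_bilinear_mult]
lemmas smooth_on_inner = smooth_on_bilinear[OF bounded_bilinear_inner]
lemmas smooth_on_nth = smooth_on_linear[OF bounded_linear_vec_nth]
lemmas smooth_on_minus = smooth_on_linear[OF bounded_linear_minus[OF bounded_linear_ident]]

lemma smooth_on_diff: "open U \<Longrightarrow> smooth_on U f \<Longrightarrow> smooth_on U g \<Longrightarrow> smooth_on U (\<lambda>x. f x - g x)"
  using smooth_on_add[of U f "\<lambda>x. - g x"] smooth_on_minus[of U g] by simp

lemma smooth_on_sum:
  assumes "open U" "\<And>i. i \<in> I \<Longrightarrow> smooth_on U (f i)"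
  shows "smooth_on U (\<lambda>x. \<Sum>i\<in>I. f i x)"
  using assms(2)
  by (induction I rule: infinite_finite_induct) (auto intro: smooth_on_add smooth_on_const assms(1))

lemma smooth_on_prod:
  fixes f :: "'i \<Rightarrow> 'a::real_normed_vector \<Rightarrow> 'b::real_normed_field"
  assumes "open U" "\<And>i. i \<in> I \<Longrightarrow> smooth_on U (f i)"
  shows "smooth_on U (\<lambda>x. \<Prod>i\<in>I. f i x)"
  using assms(2)
  by (induction I rule: infinite_finite_induct) (auto intro: smooth_on_mult smooth_on_const assms(1))

lemma smooth_on_inverse:
  fixes f :: "'a::real_normed_vector \<Rightarrow> 'b::real_normed_field"
  assumes "open U" "smooth_on U f" "\<And>p. p \<in> U \<Longrightarrow> f p \<noteq> 0"
  shows "smooth_on U (\<lambda>x. inverse (f x))"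
proof (rule smooth_onI)
  fix n
  have d: "p \<in> U \<Longrightarrow> (inverse has_field_derivative - (inverse (f p) * inverse (f p))) (at (f p))" for p
    using assms(3) by (auto intro!: derivative_eq_intros)
  show "diffn n U (\<lambda>x. inverse (f x))"
  proof (induction n)
    case 0
    show ?case
      by (rule diffn_field_chain_0[OF assms(1) d smooth_onD[OF assms(2)]])
  next
    case (Suc n)
    show ?case
      by (intro diffn_field_chain[OF assms(1), of inverse "\<lambda>z. - (inverse z * inverse z)"] d smooth_onD[OF assms(2)]
        diffn_linear[OF bounded_linear_minus[OF bounded_linear_ident]] diffn_bilinear[OF bounded_bilinear_mult] Suc assms(1))
  qed
qed

lemma smooth_on_field_chain:
  fixes f :: "'a::real_normed_vector \<Rightarrow> 'b::real_normed_field"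
  assumes "open U" "smooth_on U f" "\<And>p. p \<in> U \<Longrightarrow> (g has_field_derivative g' (f p)) (at (f p))"
    and "smooth_on U (\<lambda>x. g' (f x))"
  shows "smooth_on U (\<lambda>x. g (f x))"
proof (rule smooth_onI)
  show "diffn n U (\<lambda>x. g (f x))" for n
  proof (cases n)
    case 0
    show ?thesis unfolding 0
      by (rule diffn_field_chain_0[OF assms(1,3) smooth_onD[OF assms(2)]])
  next
    case (Suc m)
    show ?thesis unfolding Suc
      by (rule diffn_field_chain[OF assms(1,3) smooth_onD[OF assms(2)] smooth_onD[OF assms(4)]])
  qed
qed

lemma smooth_on_exp:
  fixes f :: "'a::real_normed_vector \<Rightarrow> 'b::{real_normed_field,banach}"
  assumes "open U" "smooth_on U f"
  shows "smooth_on U (\<lambda>x. exp (f x))"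
proof (rule smooth_onI)
  show "diffn n U (\<lambda>x. exp (f x))" for n
  proof (induction n)
    case 0
    show ?case by (rule diffn_field_chain_0[OF assms(1) DERIV_exp smooth_onD[OF assms(2)]])
  next
    case (Suc n)
    then show ?case by (rule diffn_field_chain[OF assms(1) DERIV_exp smooth_onD[OF assms(2)]])
  qed
qed

lemma smooth_on_ln:
  fixes f :: "'a::real_normed_vector \<Rightarrow> real"
  assumes "open U" "smooth_on U f" "\<And>p. p \<in> U \<Longrightarrow> f p > 0"
  shows "smooth_on U (\<lambda>x. ln (f x))"
proof (rule smooth_on_field_chain[OF assms(1,2), of ln inverse])
  show "(ln has_field_derivative inverse (f p)) (at (f p))" if "p \<in> U" for p
    using DERIV_ln assms(3) that by blast
  show "smooth_on U (\<lambda>x. inverse (f x))"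
    using assms(3) by (intro smooth_on_inverse assms(1,2)) force
qed

lemma smooth_on_Ln:
  fixes f :: "'a::real_normed_vector \<Rightarrow> complex"
  assumes "open U" "smooth_on U f" "\<And>p. p \<in> U \<Longrightarrow> f p \<notin> \<real>\<^sub>\<le>\<^sub>0"
  shows "smooth_on U (\<lambda>x. Ln (f x))"
proof (rule smooth_on_field_chain[OF assms(1,2), of Ln inverse])
  show "(Ln has_field_derivative inverse (f p)) (at (f p))" if "p \<in> U" for p
    using has_field_derivative_Ln assms(3) that by blast
  show "smooth_on U (\<lambda>x. inverse (f x))"
    using assms(3) by (intro smooth_on_inverse assms(1,2)) (fastforce simp: complex_nonpos_Reals_iff)
qed

lemma smooth_on_det:
  fixes M :: "'a::real_normed_vector \<Rightarrow> real^'n^'n"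
  assumes "open U" "\<And>i j. smooth_on U (\<lambda>x. M x $ i $ j)"
  shows "smooth_on U (\<lambda>x. det (M x))"
  unfolding det_def
  by (intro smooth_on_sum smooth_on_mult smooth_on_prod smooth_on_const assms)

lemma smooth_on_frechet:
  assumes "smooth_on U f"
  shows "smooth_on U (\<lambda>p. frechet_derivative f (at p) v)"
proof -
  have "diffn n U (\<lambda>p. frechet_derivative f (at p) v)" for n
    using smooth_onD[OF assms, of "Suc n"] by simp
  then show ?thesis by (rule smooth_onI)
qed

lemma smooth_on_vec_lambda:
  fixes f :: "'n::finite \<Rightarrow> 'a::real_normed_vector \<Rightarrow> 'b::euclidean_space"
  assumes "open U" "\<And>i. smooth_on U (f i)"
  shows "smooth_on U (\<lambda>x. \<chi> i. f i x)"
proof -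
  have "(\<lambda>x. \<chi> i. f i x) = (\<lambda>x. \<Sum>i\<in>UNIV. (\<chi> j. if j = i then f i x else 0))"
    by (auto simp: vec_eq_iff)
  moreover have "bounded_linear (\<lambda>b :: 'b. (\<chi> j. if j = i then b else 0) :: 'b^'n)" for i
    by (auto intro!: linear_conv_bounded_linear[THEN iffD1] linearI simp: vec_eq_iff)
  ultimately show ?thesis
    by (simp, intro smooth_on_sum smooth_on_linear[where L="\<lambda>b. \<chi> j. if j = _ then b else 0"] assms)
qed

text \<open>The derivative in direction \<open>v\<close> is the derivative of \<open>g\<close> in
  the constant direction \<open>L v\<close>, evaluated at the same affine argument, so the induction
  stays within compositions of this shape. It serves to restrict functions to a coordinate
  plane.\<close>

lemma smooth_on_compose_affine:
  fixes L :: "'c::real_normed_vector \<Rightarrow> 'a::real_normed_vector" and g :: "'a \<Rightarrow> 'b::real_normed_vector"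
  assumes L: "bounded_linear L" and "open D" "open \<Omega>" and sub: "\<And>z. z \<in> D \<Longrightarrow> q + L z \<in> \<Omega>" and g: "smooth_on \<Omega> g"
  shows "smooth_on D (\<lambda>z. g (q + L z))"
proof (rule smooth_onI)
  fix n
  have dg: "((\<lambda>z. g (q + L z)) has_derivative (\<lambda>v. frechet_derivative g (at (q + L z)) (L v))) (at z)"
    if "z \<in> D" "smooth_on \<Omega> g" for z and g :: "'a \<Rightarrow> 'b"
  proof -
    have "((\<lambda>z. q + L z) has_derivative L) (at z)"
      using bounded_linear.has_derivative[OF L has_derivative_ident[of "at z"]] by (auto intro!: derivative_eq_intros)
    from has_derivative_compose[OF this smooth_on_has_derivative[OF that(2) assms(3) sub[OF that(1)]]] show ?thesis .
  qed
  show "diffn n D (\<lambda>z. g (q + L z))"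
    using g
  proof (induction n arbitrary: g)
    case 0
    show ?case unfolding diffn.simps by (rule differentiable_onI[OF dg[OF _ 0]])
  next
    case (Suc n)
    show ?case
      by (rule diffn_SucI[OF assms(2) dg[OF _ Suc.prems] Suc.IH[OF smooth_on_frechet[OF Suc.prems]]])
  qed
qed

section \<open>Lie derivatives\<close>

lemma has_real_derivative_along_line:
  fixes f :: "'a::real_normed_vector \<Rightarrow> real"
  assumes "(f has_derivative D) (at (p + s *\<^sub>R u))"
  shows "((\<lambda>s. f (p + s *\<^sub>R u)) has_real_derivative D u) (at s)"
proof -
  have "((\<lambda>s. f (p + s *\<^sub>R u)) has_derivative (\<lambda>h. D (h *\<^sub>R u))) (at s)"
    by (rule has_derivative_compose[of "\<lambda>s. p + s *\<^sub>R u", OF _ assms]) (auto intro!: derivative_eq_intros)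
  then show ?thesis
    by (simp add: has_field_derivative_def linear_scale[OF has_derivative_linear[OF assms]] mult.commute[of _ "D u"])
qed

text \<open>The mean value theorem is applied first along \<open>u\<close>, to a difference of two
  parallel lines, and then along \<open>v\<close>. The left-hand side is symmetric in
  \<open>u\<close> and \<open>v\<close>, the right-hand side is not visibly so; Schwarz's theorem
  comes from this contrast.\<close>

lemma second_difference_mvt:
  fixes f :: "'a::real_normed_vector \<Rightarrow> real"
  assumes "open U" "smooth_on U f" "h > 0"
    and sub: "\<And>s t. 0 \<le> s \<Longrightarrow> s \<le> h \<Longrightarrow> 0 \<le> t \<Longrightarrow> t \<le> h \<Longrightarrow> p + s *\<^sub>R u + t *\<^sub>R v \<in> U"
  shows "\<exists>s t. 0 < s \<and> s < h \<and> 0 < t \<and> t < h \<and>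
    f (p + h *\<^sub>R u + h *\<^sub>R v) - f (p + h *\<^sub>R u) - f (p + h *\<^sub>R v) + f p
      = h * h * frechet_derivative (\<lambda>q. frechet_derivative f (at q) u) (at (p + s *\<^sub>R u + t *\<^sub>R v)) v"
proof -
  let ?fu = "\<lambda>q. frechet_derivative f (at q) u"
  note df = smooth_on_has_derivative[OF assms(2,1)]
  note dfu = smooth_on_has_derivative[OF smooth_on_frechet[OF assms(2)] assms(1)]
  have 1: "((\<lambda>s. f ((p + h *\<^sub>R v) + s *\<^sub>R u) - f (p + s *\<^sub>R u)) has_real_derivative
      (?fu ((p + h *\<^sub>R v) + s *\<^sub>R u) - ?fu (p + s *\<^sub>R u))) (at s)" if "0 \<le> s" "s \<le> h" for s
    using sub[of s h] sub[of s 0] that \<open>h > 0\<close>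
    by (intro DERIV_diff has_real_derivative_along_line df) (auto simp: algebra_simps)
  obtain s where s: "0 < s" "s < h" and es: "(f ((p + h *\<^sub>R v) + h *\<^sub>R u) - f (p + h *\<^sub>R u)) - (f ((p + h *\<^sub>R v) + 0 *\<^sub>R u) - f (p + 0 *\<^sub>R u))
      = (h - 0) * (?fu ((p + h *\<^sub>R v) + s *\<^sub>R u) - ?fu (p + s *\<^sub>R u))"
    using MVT2[OF \<open>h > 0\<close> 1] by blast
  have 2: "((\<lambda>t. ?fu ((p + s *\<^sub>R u) + t *\<^sub>R v)) has_real_derivative frechet_derivative ?fu (at ((p + s *\<^sub>R u) + t *\<^sub>R v)) v) (at t)"
    if "0 \<le> t" "t \<le> h" for t
    using sub[of s t] that s by (intro has_real_derivative_along_line dfu) auto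
  obtain t where t: "0 < t" "t < h" and et: "?fu ((p + s *\<^sub>R u) + h *\<^sub>R v) - ?fu ((p + s *\<^sub>R u) + 0 *\<^sub>R v)
      = (h - 0) * frechet_derivative ?fu (at ((p + s *\<^sub>R u) + t *\<^sub>R v)) v"
    using MVT2[OF \<open>h > 0\<close> 2] by blast
  have "f (p + h *\<^sub>R u + h *\<^sub>R v) - f (p + h *\<^sub>R u) - f (p + h *\<^sub>R v) + f p
      = h * h * frechet_derivative ?fu (at (p + s *\<^sub>R u + t *\<^sub>R v)) v"
    using es et by (simp add: algebra_simps)
  then show ?thesis using s t by blast
qed

text \<open>Both mixed derivatives are attained by one and the same second difference, at points
  arbitrarily close to \<open>p\<close>; continuity of both then identifies their values at
  \<open>p\<close>.\<close>

lemma second_derivative_symmetric_real: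
  fixes f :: "'a::real_normed_vector \<Rightarrow> real"
  assumes "open U" "smooth_on U f" "p \<in> U"
  shows "frechet_derivative (\<lambda>q. frechet_derivative f (at q) u) (at p) v
       = frechet_derivative (\<lambda>q. frechet_derivative f (at q) v) (at p) u"
proof -
  define A where "A q = frechet_derivative (\<lambda>q. frechet_derivative f (at q) u) (at q) v" for q
  define B where "B q = frechet_derivative (\<lambda>q. frechet_derivative f (at q) v) (at q) u" for q
  have "continuous (at p) A" "continuous (at p) B"
    unfolding A_def B_def
    by (rule has_derivative_continuous, rule smooth_on_has_derivative[OF _ assms(1,3)], intro smooth_on_frechet assms(2))+
  have "A p = B p"
  proof (rule ccontr)
    assume "A p \<noteq> B p"
    \<comment> \<open>Half the gap: a common value within \<open>e\<close> of both
      \<open>A p\<close> and \<open>B p\<close> is impossible.\<close>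
    define e where "e = \<bar>A p - B p\<bar> / 2"
    have "e > 0" using \<open>A p \<noteq> B p\<close> by (simp add: e_def)
    obtain d1 where d1: "d1 > 0" "\<And>q. dist q p < d1 \<Longrightarrow> dist (A q) (A p) < e"
      using \<open>continuous (at p) A\<close> \<open>e > 0\<close> unfolding continuous_at_eps_delta by (metis dist_real_def dist_norm)
    obtain d2 where d2: "d2 > 0" "\<And>q. dist q p < d2 \<Longrightarrow> dist (B q) (B p) < e"
      using \<open>continuous (at p) B\<close> \<open>e > 0\<close> unfolding continuous_at_eps_delta by (metis dist_real_def dist_norm)
    obtain d3 where d3: "d3 > 0" "ball p d3 \<subseteq> U"
      using assms(1,3) open_contains_ball by blast
    define d where "d = min d1 (min d2 d3)"
    have d: "d > 0" using d1 d2 d3 by (simp add: d_def)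
    \<comment> \<open>Small enough for the whole parallelogram spanned by
      \<open>h *\<^sub>R u\<close> and \<open>h *\<^sub>R v\<close> to stay within distance
      \<open>d\<close>; the summand 1 covers the case that both vectors vanish.\<close>
    define h where "h = d / (2 * (norm u + norm v + 1))"
    have pos: "norm u + norm v + 1 > 0" by (metis add_nonneg_pos norm_ge_zero add_nonneg_nonneg zero_less_one)
    have h: "h > 0" using d pos by (simp add: h_def)
    have near: "norm (s *\<^sub>R u + t *\<^sub>R v) < d" if "0 \<le> s" "s \<le> h" "0 \<le> t" "t \<le> h" for s t
    proof -
      have "norm (s *\<^sub>R u + t *\<^sub>R v) \<le> s * norm u + t * norm v"
        using norm_triangle_ineq[of "s *\<^sub>R u" "t *\<^sub>R v"] that by simp
      also have "\<dots> \<le> h * norm u + h * norm v"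
        using that by (intro add_mono mult_right_mono) auto
      also have "\<dots> < h * (norm u + norm v + 1)" using h by (simp add: algebra_simps)
      also have "\<dots> = d / 2" using pos by (simp add: h_def field_simps)
      finally show ?thesis using d by simp
    qed
    have dist1: "dist (p + s *\<^sub>R u + t *\<^sub>R v) p < d" if "0 \<le> s" "s \<le> h" "0 \<le> t" "t \<le> h" for s t
      using near[OF that] by (simp add: dist_norm add.assoc)
    have dist2: "dist (p + s *\<^sub>R v + t *\<^sub>R u) p < d" if "0 \<le> s" "s \<le> h" "0 \<le> t" "t \<le> h" for s t
      using near[of t s] that by (simp add: dist_norm add.assoc add.commute)
    have inU: "q \<in> U" if "dist q p < d" for q
      using that d3(2) unfolding d_def by (auto simp: dist_commute subset_iff)
    obtain s t where st: "0 < s" "s < h" "0 < t" "t < h" and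
      1: "f (p + h *\<^sub>R u + h *\<^sub>R v) - f (p + h *\<^sub>R u) - f (p + h *\<^sub>R v) + f p = h * h * A (p + s *\<^sub>R u + t *\<^sub>R v)"
      using second_difference_mvt[OF assms(1,2) h inU[OF dist1]] unfolding A_def by blast
    obtain s' t' where st': "0 < s'" "s' < h" "0 < t'" "t' < h" and
      2: "f (p + h *\<^sub>R v + h *\<^sub>R u) - f (p + h *\<^sub>R v) - f (p + h *\<^sub>R u) + f p = h * h * B (p + s' *\<^sub>R v + t' *\<^sub>R u)"
      using second_difference_mvt[OF assms(1,2) h inU[OF dist2]] unfolding B_def by blast
    have e: "p + h *\<^sub>R v + h *\<^sub>R u = p + h *\<^sub>R u + h *\<^sub>R v" by simp
    have "h * h * A (p + s *\<^sub>R u + t *\<^sub>R v) = h * h * B (p + s' *\<^sub>R v + t' *\<^sub>R u)"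
      using 1 2 unfolding e by linarith
    then have "A (p + s *\<^sub>R u + t *\<^sub>R v) = B (p + s' *\<^sub>R v + t' *\<^sub>R u)" using h by simp
    moreover have "dist (A (p + s *\<^sub>R u + t *\<^sub>R v)) (A p) < e"
      using dist1[of s t] st by (intro d1) (auto simp: d_def)
    moreover have "dist (B (p + s' *\<^sub>R v + t' *\<^sub>R u)) (B p) < e"
      using dist2[of s' t'] st' by (intro d2) (auto simp: d_def)
    ultimately show False unfolding e_def dist_real_def
      by (smt (verit) field_sum_of_halves)
  qed
  then show ?thesis by (simp add: A_def B_def)
qed

lemma frechet_derivative_linear_comp:
  assumes "bounded_linear L" "f differentiable (at p)"
  shows "frechet_derivative (\<lambda>q. L (f q)) (at p) v = L (frechet_derivative f (at p) v)"
  using frechet_derivative_eqI[OF bounded_linear.has_derivative[OF assms(1)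
      frechet_derivative_works[THEN iffD1, OF assms(2)]]] by simp

lemma smooth_on_differentiable_at: "smooth_on U f \<Longrightarrow> open U \<Longrightarrow> p \<in> U \<Longrightarrow> f differentiable (at p)"
  using smooth_on_has_derivative by (auto simp: differentiable_def)

text \<open>Reduction to scalar components, since the mean value theorem is a scalar
  statement.\<close>

lemma second_derivative_symmetric:
  fixes f :: "'a::real_normed_vector \<Rightarrow> 'b::euclidean_space"
  assumes "open U" "smooth_on U f" "p \<in> U"
  shows "frechet_derivative (\<lambda>q. frechet_derivative f (at q) u) (at p) v
       = frechet_derivative (\<lambda>q. frechet_derivative f (at q) v) (at p) u"
proof (rule euclidean_eqI)
  fix b :: 'b assume "b \<in> Basis"
  let ?g = "\<lambda>q. f q \<bullet> b"
  have *: "frechet_derivative (\<lambda>q. frechet_derivative ?g (at q) w) (at p) z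
      = frechet_derivative (\<lambda>q. frechet_derivative f (at q) w) (at p) z \<bullet> b" for w z
  proof -
    have "frechet_derivative (\<lambda>q. frechet_derivative ?g (at q) w) (at p)
       = frechet_derivative (\<lambda>q. frechet_derivative f (at q) w \<bullet> b) (at p)"
      by (intro frechet_derivative_cong_open[OF assms(1,3)]
          frechet_derivative_linear_comp[OF bounded_linear_inner_left] smooth_on_differentiable_at[OF assms(2,1)])
    then show ?thesis
      using frechet_derivative_linear_comp[OF bounded_linear_inner_left
          smooth_on_differentiable_at[OF smooth_on_frechet[OF assms(2)] assms(1,3)]] by metis
  qed
  show "frechet_derivative (\<lambda>q. frechet_derivative f (at q) u) (at p) v \<bullet> b
       = frechet_derivative (\<lambda>q. frechet_derivative f (at q) v) (at p) u \<bullet> b"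
    unfolding *[symmetric]
    by (rule second_derivative_symmetric_real[OF assms(1) smooth_on_linear[OF bounded_linear_inner_left assms(1,2)] assms(3)])
qed

section \<open>Derivatives along vector fields\<close>

text \<open>For a vector field \<open>Y\<close>, \<open>lie X Y\<close> is the flat derivative of
  \<open>Y\<close> along \<open>X\<close>, not the Lie bracket; the bracket [X, Y] is
  \<open>lie X Y p - lie Y X p\<close>.\<close>

definition lie :: "('a::real_normed_vector \<Rightarrow> 'a) \<Rightarrow> ('a \<Rightarrow> 'b::real_normed_vector) \<Rightarrow> 'a \<Rightarrow> 'b" where
  "lie X f p = frechet_derivative f (at p) (X p)"

lemma lie_eqI: "(f has_derivative f') (at p) \<Longrightarrow> lie X f p = f' (X p)"
  by (simp add: lie_def frechet_derivative_eqI)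

lemma lie_cong_open:
  assumes "open U" "p \<in> U" "\<And>q. q \<in> U \<Longrightarrow> f q = g q"
  shows "lie X f p = lie X g p"
  unfolding lie_def using frechet_derivative_cong_open[OF assms] by simp

lemma linear_Basis_expansion:
  fixes D :: "'a::euclidean_space \<Rightarrow> 'b::real_vector"
  assumes "linear D"
  shows "D w = (\<Sum>b\<in>Basis. (w \<bullet> b) *\<^sub>R D b)"
proof -
  have "D w = D (\<Sum>b\<in>Basis. (w \<bullet> b) *\<^sub>R b)" by (simp add: euclidean_representation)
  then show ?thesis by (simp add: linear_sum[OF assms] linear_scale[OF assms])
qed

text \<open>Smoothness speaks of derivatives in fixed directions. The moving direction
  \<open>Y\<close> is therefore expanded in the basis, and the product rule splits off the
  derivative of \<open>Y\<close>.\<close>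

lemma has_derivative_along_field:
  fixes f :: "'a::euclidean_space \<Rightarrow> 'b::real_normed_vector" and Y :: "'a \<Rightarrow> 'a"
  assumes "open U" "smooth_on U f" "smooth_on U Y" "p \<in> U"
  shows "(lie Y f has_derivative
     (\<lambda>v. frechet_derivative f (at p) (frechet_derivative Y (at p) v)
        + (\<Sum>b\<in>Basis. (Y p \<bullet> b) *\<^sub>R frechet_derivative (\<lambda>q. frechet_derivative f (at q) b) (at p) v))) (at p)"
proof (rule has_derivative_transform_within_open[OF _ assms(1,4)])
  have exp: "frechet_derivative f (at q) w = (\<Sum>b\<in>Basis. (w \<bullet> b) *\<^sub>R frechet_derivative f (at q) b)" if "q \<in> U" for q w
  proof -
    have "linear (frechet_derivative f (at q))"
      by (rule has_derivative_linear[OF smooth_on_has_derivative[OF assms(2,1) that]])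
    then show ?thesis by (rule linear_Basis_expansion)
  qed
  show "(\<Sum>b\<in>Basis. (Y q \<bullet> b) *\<^sub>R frechet_derivative f (at q) b) = lie Y f q" if "q \<in> U" for q
    using exp[OF that, of "Y q"] by (simp add: lie_def)
  have "((\<lambda>q. \<Sum>b\<in>Basis. (Y q \<bullet> b) *\<^sub>R frechet_derivative f (at q) b) has_derivative
     (\<lambda>v. \<Sum>b\<in>Basis. (Y p \<bullet> b) *\<^sub>R frechet_derivative (\<lambda>q. frechet_derivative f (at q) b) (at p) v
        + (frechet_derivative Y (at p) v \<bullet> b) *\<^sub>R frechet_derivative f (at p) b)) (at p)"
    by (intro has_derivative_sum has_derivative_scaleR has_derivative_inner_left
        smooth_on_has_derivative[OF _ assms(1,4)] assms smooth_on_frechet)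
  then show "((\<lambda>q. \<Sum>b\<in>Basis. (Y q \<bullet> b) *\<^sub>R frechet_derivative f (at q) b) has_derivative
     (\<lambda>v. frechet_derivative f (at p) (frechet_derivative Y (at p) v)
        + (\<Sum>b\<in>Basis. (Y p \<bullet> b) *\<^sub>R frechet_derivative (\<lambda>q. frechet_derivative f (at q) b) (at p) v))) (at p)"
    using exp[OF assms(4), of "frechet_derivative Y (at p) _"] by (simp add: sum.distrib add.commute)
qed

lemma smooth_on_lie:
  fixes f :: "'a::euclidean_space \<Rightarrow> 'b::real_normed_vector"
  assumes "open U" "smooth_on U X" "smooth_on U f"
  shows "smooth_on U (lie X f)"
proof -
  have "lie X f q = (\<Sum>b\<in>Basis. (X q \<bullet> b) *\<^sub>R frechet_derivative f (at q) b)" if "q \<in> U" for q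
  proof -
    have "linear (frechet_derivative f (at q))"
      by (rule has_derivative_linear[OF smooth_on_has_derivative[OF assms(3,1) that]])
    then show ?thesis unfolding lie_def by (rule linear_Basis_expansion)
  qed
  moreover have "smooth_on U (\<lambda>q. \<Sum>b\<in>Basis. (X q \<bullet> b) *\<^sub>R frechet_derivative f (at q) b)"
    by (intro smooth_on_sum smooth_on_scaleR smooth_on_inner smooth_on_frechet smooth_on_const assms)
  ultimately show ?thesis by (subst smooth_on_cong[OF assms(1)])
qed

lemma lie_lie:
  fixes f :: "'a::euclidean_space \<Rightarrow> 'b::euclidean_space"
  assumes "open U" "smooth_on U f" "smooth_on U Y" "p \<in> U"
  shows "lie X (lie Y f) p = frechet_derivative f (at p) (lie X Y p)
    + frechet_derivative (\<lambda>q. frechet_derivative f (at q) (Y p)) (at p) (X p)"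
proof -
  let ?H = "\<lambda>v w. frechet_derivative (\<lambda>q. frechet_derivative f (at q) w) (at p) v"
  have lin: "linear (\<lambda>v. ?H v w)" for w
    by (intro has_derivative_linear[OF smooth_on_has_derivative[OF smooth_on_frechet assms(1,4)]] assms)
  \<comment> \<open>The second derivative is evidently linear only in its outer direction. Symmetry
    moves the basis sum there, where it collapses to \<open>Y p\<close>, and then moves it
    back.\<close>
  have "(\<Sum>b\<in>Basis. (Y p \<bullet> b) *\<^sub>R ?H (X p) b) = (\<Sum>b\<in>Basis. (Y p \<bullet> b) *\<^sub>R ?H b (X p))"
    by (intro sum.cong arg_cong2[where f=scaleR] second_derivative_symmetric[OF assms(1,2,4)]) auto
  also have "\<dots> = ?H (\<Sum>b\<in>Basis. (Y p \<bullet> b) *\<^sub>R b) (X p)"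
    by (simp add: linear_sum[OF lin] linear_scale[OF lin])
  also have "\<dots> = ?H (Y p) (X p)" by (simp add: euclidean_representation)
  also have "\<dots> = ?H (X p) (Y p)"
    by (rule second_derivative_symmetric[OF assms(1,2,4)])
  finally show ?thesis
    using lie_eqI[OF has_derivative_along_field[OF assms], of X] by (simp add: lie_def)
qed

lemma lie_commutator:
  fixes f :: "'a::euclidean_space \<Rightarrow> 'b::euclidean_space"
  assumes "open U" "smooth_on U f" "smooth_on U X" "smooth_on U Y" "p \<in> U"
  shows "lie X (lie Y f) p - lie Y (lie X f) p = frechet_derivative f (at p) (lie X Y p - lie Y X p)"
proof -
  have "linear (frechet_derivative f (at p))"
    by (rule has_derivative_linear[OF smooth_on_has_derivative[OF assms(2,1,5)]])
  then show ?thesis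
    using lie_lie[OF assms(1,2,4,5), of X] lie_lie[OF assms(1,2,3,5), of Y]
      second_derivative_symmetric[OF assms(1,2,5), of "X p" "Y p"] by (simp add: linear_diff)
qed

lemma lie_const [simp]: "lie X (\<lambda>q. c) p = 0"
  by (simp add: lie_def)

lemma lie_minus: "smooth_on U f \<Longrightarrow> open U \<Longrightarrow> p \<in> U \<Longrightarrow> lie X (\<lambda>q. - f q) p = - lie X f p"
  unfolding lie_def using frechet_derivative_linear_comp[OF bounded_linear_minus[OF bounded_linear_ident] smooth_on_differentiable_at] by metis

lemma lie_add:
  assumes "smooth_on U f" "smooth_on U g" "open U" "p \<in> U"
  shows "lie X (\<lambda>q. f q + g q) p = lie X f p + lie X g p"
  using lie_eqI[OF has_derivative_add[OF smooth_on_has_derivative[OF assms(1,3,4)] smooth_on_has_derivative[OF assms(2,3,4)]], of X]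
  by (simp add: lie_def)

lemma lie_diff:
  assumes "smooth_on U f" "smooth_on U g" "open U" "p \<in> U"
  shows "lie X (\<lambda>q. f q - g q) p = lie X f p - lie X g p"
  using lie_eqI[OF has_derivative_diff[OF smooth_on_has_derivative[OF assms(1,3,4)] smooth_on_has_derivative[OF assms(2,3,4)]], of X]
  by (simp add: lie_def)

lemma lie_mult:
  fixes f g :: "'a::real_normed_vector \<Rightarrow> 'b::real_normed_field"
  assumes "smooth_on U f" "smooth_on U g" "open U" "p \<in> U"
  shows "lie X (\<lambda>q. f q * g q) p = f p * lie X g p + lie X f p * g p"
  using lie_eqI[OF has_derivative_mult[OF smooth_on_has_derivative[OF assms(1,3,4)] smooth_on_has_derivative[OF assms(2,3,4)]], of X]
  by (simp add: lie_def)

lemma lie_linear_comp: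
  assumes "bounded_linear L" "smooth_on U f" "open U" "p \<in> U"
  shows "lie X (\<lambda>q. L (f q)) p = L (lie X f p)"
  unfolding lie_def by (rule frechet_derivative_linear_comp[OF assms(1) smooth_on_differentiable_at[OF assms(2-4)]])

lemma lie_exp:
  fixes f :: "'a::real_normed_vector \<Rightarrow> 'b::{real_normed_field,banach}"
  assumes "smooth_on U f" "open U" "p \<in> U"
  shows "lie X (\<lambda>q. exp (f q)) p = exp (f p) * lie X f p"
  using lie_eqI[OF has_derivative_compose[OF smooth_on_has_derivative[OF assms]
    DERIV_exp[of "f p", unfolded has_field_derivative_def]], of X] by (simp add: lie_def)

lemma lie_scaleR:
  assumes "smooth_on U f" "smooth_on U Y" "open U" "p \<in> U"
  shows "lie X (\<lambda>q. f q *\<^sub>R Y q) p = f p *\<^sub>R lie X Y p + lie X f p *\<^sub>R Y p"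
  using lie_eqI[OF has_derivative_scaleR[OF smooth_on_has_derivative[OF assms(1,3,4)] smooth_on_has_derivative[OF assms(2-4)]], of X]
  by (simp add: lie_def)

lemma lie_combination:
  assumes "smooth_on U f" "open U" "p \<in> U"
  shows "lie (\<lambda>q. c q *\<^sub>R X q + d q *\<^sub>R Y q) f p = c p *\<^sub>R lie X f p + d p *\<^sub>R lie Y f p"
proof -
  have lin: "linear (frechet_derivative f (at p))"
    by (rule has_derivative_linear[OF smooth_on_has_derivative[OF assms]])
  show ?thesis by (simp add: lie_def linear_add[OF lin] linear_scale[OF lin])
qed

section \<open>Commuting frames are coordinate frames\<close>

text \<open>The potential is the line integral of \<open>c\<close> along the segment from
  \<open>p\<close> to \<open>x\<close>. By closedness the gradient of the integrand in
  \<open>x\<close> equals the derivative of s c(p + s (x - p)) in s, so the differentiated integral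
  telescopes to \<open>c x\<close>.\<close>

lemma poincare_lemma_convex:
  fixes c :: "'a::euclidean_space \<Rightarrow> 'a"
  assumes U: "open U" "convex U" "p \<in> U" and c: "smooth_on U c"
    and sym: "\<And>x u v. x \<in> U \<Longrightarrow> frechet_derivative c (at x) u \<bullet> v = frechet_derivative c (at x) v \<bullet> u"
  shows "\<exists>f. \<forall>x\<in>U. (f has_derivative (\<lambda>v. c x \<bullet> v)) (at x)"
proof -
  define y where "y x s = p + s *\<^sub>R (x - p)" for x and s :: real
  \<comment> \<open>The derivative in s of s c(y x s), which is also the gradient in x of the
    integrand of the potential.\<close>
  define G where "G x s = s *\<^sub>R frechet_derivative c (at (y x s)) (x - p) + c (y x s)" for x s
  have yU: "y x s \<in> U" if "x \<in> U" "s \<in> cbox 0 1" for x s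
  proof -
    have "y x s = (1 - s) *\<^sub>R p + s *\<^sub>R x" by (simp add: y_def algebra_simps)
    then show ?thesis using convexD[OF U(2,3) that(1), of "1 - s" s] that by simp
  qed
  note dc = smooth_on_has_derivative[OF c U(1)]
  have contc: "continuous_on U c"
    using dc has_derivative_continuous by (intro continuous_at_imp_continuous_on) blast
  have contdc: "continuous_on U (\<lambda>x. frechet_derivative c (at x) b)" for b
    using has_derivative_continuous[OF smooth_on_has_derivative[OF smooth_on_frechet[OF c] U(1)]]
    by (intro continuous_at_imp_continuous_on) blast
  have conty: "continuous_on (U \<times> cbox 0 1) (\<lambda>z. y (fst z) (snd z))"
    unfolding y_def by (intro continuous_intros)
  have subU: "(\<lambda>z. y (fst z) (snd z)) ` (U \<times> cbox 0 1) \<subseteq> U"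
    using yU by fastforce
  have contG: "continuous_on (U \<times> cbox 0 1) (\<lambda>z. G (fst z) (snd z))"
  proof -
    \<comment> \<open>Continuity is available for derivatives in fixed directions only, hence the
      expansion of \<open>x - p\<close> in the basis.\<close>
    have "continuous_on (U \<times> cbox 0 1) (\<lambda>z. snd z *\<^sub>R (\<Sum>b\<in>Basis. ((fst z - p) \<bullet> b) *\<^sub>R
        frechet_derivative c (at (y (fst z) (snd z))) b) + c (y (fst z) (snd z)))"
      by (intro continuous_intros continuous_on_compose2[OF contdc conty subU] continuous_on_compose2[OF contc conty subU])
    moreover have "frechet_derivative c (at (y x s)) (x - p)
        = (\<Sum>b\<in>Basis. ((x - p) \<bullet> b) *\<^sub>R frechet_derivative c (at (y x s)) b)" if "x \<in> U" "s \<in> cbox 0 1" for x s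
      by (rule linear_Basis_expansion[OF has_derivative_linear[OF dc[OF yU[OF that]]]])
    ultimately show ?thesis
      unfolding G_def by (subst continuous_on_cong[OF refl]) auto
  qed
  define f where "f x = integral (cbox 0 1) (\<lambda>s. c (y x s) \<bullet> (x - p))" for x
  have contseg: "continuous_on (cbox 0 1) (\<lambda>s. H (x, s))"
    if "continuous_on (U \<times> cbox 0 1) H" "x \<in> U" for H :: "'a \<times> real \<Rightarrow> 'b::topological_space" and x
    by (rule continuous_on_compose2[OF that(1)]) (use that(2) in \<open>auto intro!: continuous_intros\<close>)
  have "(f has_derivative (\<lambda>v. c x \<bullet> v)) (at x)" if x: "x \<in> U" for x
  proof -
    have "(f has_derivative integral (cbox 0 1) (\<lambda>s. blinfun_inner_right (G x s))) (at x within U)"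
      unfolding f_def
    proof (rule leibniz_rule[where fx = "\<lambda>x s. blinfun_inner_right (G x s)"])
      fix x s assume x: "x \<in> U" and s: "s \<in> cbox (0::real) 1"
      have dy: "((\<lambda>x. y x s) has_derivative (\<lambda>v. s *\<^sub>R v)) (at x)"
        unfolding y_def by (auto intro!: derivative_eq_intros)
      have "((\<lambda>x. c (y x s) \<bullet> (x - p)) has_derivative
          (\<lambda>v. c (y x s) \<bullet> v + frechet_derivative c (at (y x s)) (s *\<^sub>R v) \<bullet> (x - p))) (at x)"
        by (rule has_derivative_inner[OF has_derivative_compose[OF dy dc[OF yU[OF x s]]]])
          (auto intro!: derivative_eq_intros)
      moreover have "(\<lambda>v. c (y x s) \<bullet> v + frechet_derivative c (at (y x s)) (s *\<^sub>R v) \<bullet> (x - p))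
          = blinfun_apply (blinfun_inner_right (G x s))"
        by (auto simp: G_def inner_add_left sym[OF yU[OF x s], of _ "x - p"]
            linear_scale[OF has_derivative_linear[OF dc[OF yU[OF x s]]]])
      ultimately show "((\<lambda>x. c (y x s) \<bullet> (x - p)) has_derivative blinfun_apply (blinfun_inner_right (G x s))) (at x within U)"
        by (simp add: has_derivative_at_withinI)
    next
      fix x assume x: "x \<in> U"
      have "continuous_on (U \<times> cbox 0 1) (\<lambda>z. c (y (fst z) (snd z)) \<bullet> (fst z - p))"
        by (intro continuous_intros continuous_on_compose2[OF contc conty subU])
      from contseg[OF this x] show "(\<lambda>s. c (y x s) \<bullet> (x - p)) integrable_on cbox 0 1"
        by (intro integrable_continuous) simp
    next
      show "continuous_on (U \<times> cbox 0 1) (\<lambda>(x, s). blinfun_inner_right (G x s))"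
        using bounded_linear.continuous_on[OF bounded_linear_blinfun_inner_right contG]
        by (simp add: case_prod_beta)
    qed (use x U in auto)
    moreover have "integral (cbox 0 1) (\<lambda>s. blinfun_inner_right (G x s)) = blinfun_inner_right (c x)"
    proof -
      have "(G x has_integral 1 *\<^sub>R c (y x 1) - 0 *\<^sub>R c (y x 0)) {0..1}"
      proof (rule fundamental_theorem_of_calculus)
        fix s :: real assume "s \<in> {0..1}"
        then have s: "y x s \<in> U" using yU[OF x, of s] by simp
        have dy: "((\<lambda>s. y x s) has_derivative (\<lambda>h. h *\<^sub>R (x - p))) (at s)"
          unfolding y_def by (auto intro!: derivative_eq_intros)
        have "((\<lambda>s. s *\<^sub>R c (y x s)) has_derivative
            (\<lambda>h. s *\<^sub>R frechet_derivative c (at (y x s)) (h *\<^sub>R (x - p)) + h *\<^sub>R c (y x s))) (at s)"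
          by (intro has_derivative_scaleR has_derivative_ident has_derivative_compose[OF dy dc[OF s]])
        then have "((\<lambda>s. s *\<^sub>R c (y x s)) has_vector_derivative G x s) (at s)"
          by (simp add: has_vector_derivative_def G_def linear_scale[OF has_derivative_linear[OF dc[OF s]]]
              scaleR_add_right mult.commute)
        then show "((\<lambda>s. s *\<^sub>R c (y x s)) has_vector_derivative G x s) (at s within {0..1})"
          by (rule has_vector_derivative_at_within)
      qed simp
      then have "(G x has_integral c x) (cbox 0 1)" by (simp add: y_def)
      then have "((blinfun_inner_right \<circ> G x) has_integral blinfun_inner_right (c x)) (cbox 0 1)"
        by (rule has_integral_linear[OF _ bounded_linear_blinfun_inner_right])
      then show ?thesis by (simp add: integral_unique o_def)
    qed
    ultimately have "(f has_derivative blinfun_apply (blinfun_inner_right (c x))) (at x within U)" by simp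
    then show ?thesis using at_within_open[OF x U(1)] by (simp add: blinfun_inner_right.rep_eq)
  qed
  then show ?thesis by blast
qed

section \<open>Cramer's rule and dual coframes\<close>

text \<open>By Cramer's rule the solution is a quotient of determinants in the data. This makes
  functions smooth that are known only through a linear system which they satisfy.\<close>

lemma smooth_on_linear_solve:
  fixes A :: "'a::real_normed_vector \<Rightarrow> real^'n^'n" and u b :: "'a \<Rightarrow> real^'n"
  assumes "open U" "\<And>i j. smooth_on U (\<lambda>x. A x $ i $ j)" "smooth_on U b"
    and nz: "\<And>x. x \<in> U \<Longrightarrow> det (A x) \<noteq> 0" and eq: "\<And>x. x \<in> U \<Longrightarrow> A x *v u x = b x"
  shows "smooth_on U u"
proof -
  have "u x = (\<chi> k. det (\<chi> i j. if j = k then b x $ i else A x $ i $ j) * inverse (det (A x)))" if "x \<in> U" for x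
    using cramer[OF nz[OF that], of "u x" "b x"] eq[OF that] by (simp add: divide_inverse)
  moreover have "smooth_on U (\<lambda>x. \<chi> k. det (\<chi> i j. if j = k then b x $ i else A x $ i $ j) * inverse (det (A x)))"
  proof (intro smooth_on_vec_lambda smooth_on_mult smooth_on_inverse smooth_on_det assms)
    show "smooth_on U (\<lambda>x. (\<chi> i j. if j = k then b x $ i else A x $ i $ j) $ i $ j)" for i j k
      using smooth_on_nth[OF assms(1,3)] assms(2) by (cases "j = k") auto
  qed
  ultimately show ?thesis by (subst smooth_on_cong[OF assms(1)])
qed

lemma det_rows_nonzero_iff_span:
  fixes E :: "'n::finite \<Rightarrow> real^'n"
  shows "det (\<chi> k. E k) \<noteq> 0 \<longleftrightarrow> span (range E) = UNIV"
proof -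
  have "rows (\<chi> k. E k) = range E"
    by (auto simp: rows_def row_def vec_lambda_eta)
  then show ?thesis
    using matrix_left_invertible_span_rows[of "\<chi> k. E k"] invertible_det_nz[of "\<chi> k. E k"]
    by (metis invertible_left_inverse)
qed

lemma linear_eq_on_spanning:
  assumes "linear f" "linear g" "span (range E) = UNIV" "\<And>k. f (E k) = g (E k)"
  shows "f v = g v"
  by (rule linear_eq_on[OF assms(1,2), of v "range E"]) (use assms(3,4) in auto)

text \<open>The covectors are the columns of the inverse of the matrix with rows
  \<open>E k x\<close>. They are picked pointwise as solutions of linear systems; Cramer's rule
  shows that the choice is smooth.\<close>

lemma dual_coframe:
  fixes E :: "'n::finite \<Rightarrow> real^'n \<Rightarrow> real^'n"
  assumes "open U" "\<And>i. smooth_on U (E i)" and span: "\<And>x. x \<in> U \<Longrightarrow> span (range (\<lambda>k. E k x)) = UNIV"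
  obtains c :: "'n \<Rightarrow> real^'n \<Rightarrow> real^'n" where "\<And>i. smooth_on U (c i)"
    "\<And>x i j. x \<in> U \<Longrightarrow> c i x \<bullet> E j x = (if i = j then 1 else 0)"
proof -
  define R where "R x = (\<chi> k. E k x)" for x
  have nz: "det (R x) \<noteq> 0" if "x \<in> U" for x
    using det_rows_nonzero_iff_span[of "\<lambda>k. E k x"] span[OF that] by (simp add: R_def)
  have "\<exists>w. R x *v w = axis i 1" if "x \<in> U" for x i
    using nz[OF that] unfolding invertible_det_nz[symmetric] invertible_def
    by (metis matrix_vector_mul_assoc matrix_vector_mul_lid)
  note ex = this
  define c where "c i x = (SOME w. R x *v w = axis i 1)" for i x
  have Rc: "R x *v c i x = axis i 1" if "x \<in> U" for x i
    unfolding c_def by (rule someI_ex[OF ex[OF that]])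
  show thesis
  proof
    show "smooth_on U (c i)" for i
    proof (rule smooth_on_linear_solve[where A = R, OF assms(1) _ _ nz Rc])
      show "smooth_on U (\<lambda>x. R x $ k $ j)" for k j
        unfolding R_def by (simp add: smooth_on_nth assms)
    qed (rule smooth_on_const[OF assms(1)])
    show "c i x \<bullet> E j x = (if i = j then 1 else 0)" if "x \<in> U" for x i j
    proof -
      have "c i x \<bullet> E j x = (R x *v c i x) $ j"
        by (simp add: R_def matrix_vector_mult_def inner_vec_def mult.commute)
      then show ?thesis using Rc[OF that] by (simp add: axis_def)
    qed
  qed
qed

text \<open>Closedness of the dual forms. Differentiating the constant pairing of \<open>ci\<close>
  with \<open>E j\<close> moves the derivative to \<open>E j\<close>; on two frame vectors the
  asymmetry is then the pairing of \<open>ci\<close> with their bracket, which vanishes. Bilinearity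
  extends this to all vectors.\<close>

lemma dual_coframe_symmetric:
  fixes E c :: "'n::finite \<Rightarrow> real^'n \<Rightarrow> real^'n"
  assumes U: "open U" "x \<in> U" and E: "\<And>i. smooth_on U (E i)" and c: "smooth_on U ci"
    and span: "span (range (\<lambda>k. E k x)) = UNIV"
    and dual: "\<And>x j. x \<in> U \<Longrightarrow> ci x \<bullet> E j x = (if i = j then 1 else 0)"
    and comm: "\<And>j k. lie (E j) (E k) x = lie (E k) (E j) x"
  shows "frechet_derivative ci (at x) u \<bullet> v = frechet_derivative ci (at x) v \<bullet> u"
proof -
  let ?D = "frechet_derivative ci (at x)"
  have lin: "linear ?D"
    by (rule has_derivative_linear[OF smooth_on_has_derivative[OF c U]])
  have lin1: "linear (\<lambda>u. ?D u \<bullet> w)" "linear (\<lambda>u. ?D w \<bullet> u)" for w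
    using linear_compose[OF lin bounded_linear.linear[OF bounded_linear_inner_left[of w]]]
    by (simp_all add: o_def bounded_linear.linear[OF bounded_linear_inner_right])
  have 1: "?D w \<bullet> E j x = - (ci x \<bullet> frechet_derivative (E j) (at x) w)" for j w
  proof -
    have "((\<lambda>x. ci x \<bullet> E j x) has_derivative (\<lambda>w. ci x \<bullet> frechet_derivative (E j) (at x) w + ?D w \<bullet> E j x)) (at x)"
      by (intro has_derivative_inner smooth_on_has_derivative[OF _ U] E c)
    moreover have "((\<lambda>x. ci x \<bullet> E j x) has_derivative (\<lambda>w. 0)) (at x)"
      by (rule has_derivative_transform_within_open[OF has_derivative_const U]) (simp add: dual)
    ultimately have "ci x \<bullet> frechet_derivative (E j) (at x) w + ?D w \<bullet> E j x = 0"
      by (rule fun_cong[OF has_derivative_unique])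
    then show ?thesis by linarith
  qed
  have 2: "?D (E k x) \<bullet> E j x = ?D (E j x) \<bullet> E k x" for j k
    using comm[of k j] by (simp add: 1 lie_def)
  have 3: "?D w \<bullet> E j x = ?D (E j x) \<bullet> w" for j w
    by (rule linear_eq_on_spanning[OF lin1 span 2])
  show ?thesis
    by (rule linear_eq_on_spanning[OF lin1(2) lin1(1) span 3])
qed

section \<open>Charts adapted to a commuting frame\<close>

lemma has_derivative_compose_frame:
  fixes E :: "'n::finite \<Rightarrow> real^'n \<Rightarrow> real^'n" and f :: "real^'n \<Rightarrow> 'b::real_normed_vector"
  assumes "open N" "\<psi> x \<in> N" "smooth_on N f"
    and d: "(\<psi> has_derivative (\<lambda>v. \<Sum>i\<in>UNIV. v $ i *\<^sub>R E i (\<psi> x))) (at x)"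
  shows "((\<lambda>x. f (\<psi> x)) has_derivative (\<lambda>v. \<Sum>i\<in>UNIV. v $ i *\<^sub>R lie (E i) f (\<psi> x))) (at x)"
proof -
  have D: "(f has_derivative frechet_derivative f (at (\<psi> x))) (at (\<psi> x))"
    by (rule smooth_on_has_derivative[OF assms(3,1,2)])
  show ?thesis
    using has_derivative_compose[OF d D]
    by (simp add: lie_def linear_sum[OF has_derivative_linear[OF D]] linear_scale[OF has_derivative_linear[OF D]])
qed

text \<open>Partial derivatives of f o \<psi> are the functions (E i f) o \<psi>, again of the same
  shape, so knowing the first derivative of \<psi> is enough for all orders. With the identity as
  \<open>f\<close> the smoothness of \<psi> itself follows.\<close>

lemma smooth_on_compose_frame:
  fixes E :: "'n::finite \<Rightarrow> real^'n \<Rightarrow> real^'n" and f :: "real^'n \<Rightarrow> 'b::real_normed_vector"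
  assumes "open \<Omega>" "open N" "\<psi> ` \<Omega> \<subseteq> N" and E: "\<And>i. smooth_on N (E i)"
    and d: "\<And>x. x \<in> \<Omega> \<Longrightarrow> (\<psi> has_derivative (\<lambda>v. \<Sum>i\<in>UNIV. v $ i *\<^sub>R E i (\<psi> x))) (at x)"
    and f: "smooth_on N f"
  shows "smooth_on \<Omega> (\<lambda>x. f (\<psi> x))"
proof (rule smooth_onI)
  fix n
  have df: "((\<lambda>x. f (\<psi> x)) has_derivative (\<lambda>v. \<Sum>i\<in>UNIV. v $ i *\<^sub>R lie (E i) f (\<psi> x))) (at x)"
    if "x \<in> \<Omega>" "smooth_on N f" for x and f :: "real^'n \<Rightarrow> 'b"
    by (rule has_derivative_compose_frame[where E = E and \<psi> = \<psi> and x = x, OF assms(2) _ that(2) d[OF that(1)]])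
      (use assms(3) that(1) in auto)
  show "diffn n \<Omega> (\<lambda>x. f (\<psi> x))"
    using f
  proof (induction n arbitrary: f)
    case 0
    show ?case unfolding diffn.simps by (rule differentiable_onI[OF df[OF _ 0]])
  next
    case (Suc n)
    have "diffn n \<Omega> (\<lambda>x. (\<lambda>y. \<Sum>i\<in>UNIV. v $ i *\<^sub>R lie (E i) f y) (\<psi> x))" for v :: "real^'n"
      by (intro Suc.IH smooth_on_sum smooth_on_scaleR smooth_on_const smooth_on_lie E Suc.prems assms(2))
    then show ?case
      by (intro diffn_SucI[OF assms(1) df[OF _ Suc.prems]]) auto
  qed
qed

lemma smooth_on_ident: "open U \<Longrightarrow> smooth_on U (\<lambda>x. x)"
proof (rule smooth_onI)
  fix n assume "open U"
  show "diffn n U (\<lambda>x. x)"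
  proof (cases n)
    case (Suc m)
    show ?thesis unfolding Suc
      by (rule diffn_SucI[OF \<open>open U\<close>, of _ "\<lambda>p v. v"]) (auto intro: diffn_const \<open>open U\<close>)
  qed simp
qed

lemma smooth_onI_derivative:
  assumes "open U" "\<And>p. p \<in> U \<Longrightarrow> (f has_derivative f' p) (at p)"
    and "\<And>v. smooth_on U (\<lambda>p. f' p v)"
  shows "smooth_on U f"
proof (rule smooth_onI)
  fix n
  have "diffn (Suc n) U f"
    by (rule diffn_SucI[OF assms(1,2) smooth_onD[OF assms(3)]])
  then show "diffn n U f" by (rule diffn_Suc_imp)
qed

lemma has_derivative_vec_lambda:
  fixes f :: "'n::finite \<Rightarrow> 'a::real_normed_vector \<Rightarrow> real"
  assumes "\<And>i. (f i has_derivative f' i) F"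
  shows "((\<lambda>x. \<chi> i. f i x) has_derivative (\<lambda>v. \<chi> i. f' i v)) F"
proof -
  have "(\<chi> i. g i) = (\<Sum>i\<in>UNIV. g i *\<^sub>R axis i 1)" for g :: "'n \<Rightarrow> real"
    by (auto simp: vec_eq_iff axis_def if_distrib[of "\<lambda>x. _ * x"] cong: if_cong)
  then show ?thesis
    by (auto intro!: has_derivative_sum has_derivative_scaleR_left assms)
qed

text \<open>Boxes serve as chart domains because they are convex and are products: the slice through
  the centre \<open>q\<close> with fixed first coordinate then meets every line parallel to the
  first axis that meets the box.\<close>

lemma open_contains_open_box:
  fixes q :: "real^'n"
  assumes "open V" "q \<in> V"
  obtains e where "\<And>i. e i > 0" "{y. \<forall>i. \<bar>y $ i - q $ i\<bar> < e i} \<subseteq> V"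
proof -
  have "\<exists>A. (\<forall>i. open (A i) \<and> q $ i \<in> A i) \<and> (\<forall>y. (\<forall>i. y $ i \<in> A i) \<longrightarrow> y \<in> V)"
    using assms by (simp add: open_vec_def)
  then obtain A where A: "\<And>i. open (A i)" "\<And>i. q $ i \<in> A i" "\<And>y. (\<forall>i. y $ i \<in> A i) \<Longrightarrow> y \<in> V"
    by auto
  have "\<exists>e>0. ball (q $ i) e \<subseteq> A i" for i using A open_contains_ball by blast
  then obtain e where e: "\<And>i. e i > 0" "\<And>i. ball (q $ i) (e i) \<subseteq> A i" by metis
  show thesis
  proof
    show "{y. \<forall>i. \<bar>y $ i - q $ i\<bar> < e i} \<subseteq> V"
    proof
      fix y assume "y \<in> {y. \<forall>i. \<bar>y $ i - q $ i\<bar> < e i}"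
      then have "y $ i \<in> ball (q $ i) (e i)" for i by (simp add: dist_real_def abs_minus_commute)
      then show "y \<in> V" using subsetD[OF e(2)] by (simp add: A(3))
    qed
  qed (rule e)
qed

lemma open_box: "open {y :: real^'n. \<forall>i. \<bar>y $ i - q $ i\<bar> < e i}"
proof -
  have "{y :: real^'n. \<forall>i. \<bar>y $ i - q $ i\<bar> < e i} = (\<Inter>i. {y. \<bar>y $ i - q $ i\<bar> < e i})" by auto
  moreover have "open {y :: real^'n. \<bar>y $ i - q $ i\<bar> < e i}" for i
    by (intro open_Collect_less continuous_intros)
  ultimately show ?thesis by (auto intro: open_INT)
qed

lemma convex_box: "convex {y :: real^'n. \<forall>i. \<bar>y $ i - q $ i\<bar> < e i}"
proof -
  have "{y :: real^'n. \<forall>i. \<bar>y $ i - q $ i\<bar> < e i} = (\<Inter>i. (\<lambda>y. y $ i) -` ball (q $ i) (e i))"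
    by (auto simp: dist_real_def abs_minus_commute)
  moreover have "convex ((\<lambda>y :: real^'n. y $ i) -` ball (q $ i) (e i))" for i
    by (intro convex_linear_vimage convex_ball bounded_linear.linear[OF bounded_linear_vec_nth])
  ultimately show ?thesis by (auto intro: convex_INT)
qed

theorem commuting_frame_coordinates:
  fixes E :: "'n::finite \<Rightarrow> real^'n \<Rightarrow> real^'n" and q :: "real^'n"
  assumes U: "open U" "p \<in> U" and E: "\<And>i. smooth_on U (E i)"
    and span: "\<And>x. x \<in> U \<Longrightarrow> span (range (\<lambda>k. E k x)) = UNIV"
    and comm: "\<And>x j k. x \<in> U \<Longrightarrow> lie (E j) (E k) x = lie (E k) (E j) x"
  obtains e N \<psi> \<psi>i where "\<And>i. e i > (0::real)" "open N" "p \<in> N" "N \<subseteq> U"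
    "\<psi> ` {y. \<forall>i. \<bar>y $ i - q $ i\<bar> < e i} = N" "\<psi> q = p"
    "\<And>x. \<forall>i. \<bar>x $ i - q $ i\<bar> < e i \<Longrightarrow> \<psi>i (\<psi> x) = x"
    "smooth_on {y. \<forall>i. \<bar>y $ i - q $ i\<bar> < e i} \<psi>" "smooth_on N \<psi>i"
    "\<And>x. \<forall>i. \<bar>x $ i - q $ i\<bar> < e i \<Longrightarrow>
       (\<psi> has_derivative (\<lambda>v. \<Sum>i\<in>UNIV. v $ i *\<^sub>R E i (\<psi> x))) (at x)"
proof -
  obtain c :: "'n \<Rightarrow> real^'n \<Rightarrow> real^'n" where c: "\<And>i. smooth_on U (c i)"
    and dual: "\<And>x i j. x \<in> U \<Longrightarrow> c i x \<bullet> E j x = (if i = j then 1 else 0)"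
    using dual_coframe[OF U(1) E span] by blast
  obtain r where r: "r > 0" "ball p r \<subseteq> U" using U open_contains_ball by blast
  have "\<exists>f. \<forall>x\<in>ball p r. (f has_derivative (\<lambda>v. c i x \<bullet> v)) (at x)" for i
  proof (rule poincare_lemma_convex)
    show "p \<in> ball p r" using r by simp
    show "smooth_on (ball p r) (c i)" by (rule smooth_on_subset[OF c r(2)])
    show "frechet_derivative (c i) (at x) u \<bullet> v = frechet_derivative (c i) (at x) v \<bullet> u" if "x \<in> ball p r" for x u v
      using that r(2) by (intro dual_coframe_symmetric[OF U(1) _ E c span dual comm]) auto
  qed auto
  then obtain f where f: "\<And>i x. x \<in> ball p r \<Longrightarrow> (f i has_derivative (\<lambda>v. c i x \<bullet> v)) (at x)" by metis
  \<comment> \<open>The additive constants send \<open>p\<close> to the prescribed point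
    \<open>q\<close>. This freedom later makes the first coordinate equal to the given function t,
    not merely up to a constant.\<close>
  define \<Phi> where "\<Phi> x = (\<chi> i. f i x + (q $ i - f i p))" for x
  have d\<Phi>: "(\<Phi> has_derivative (\<lambda>v. \<chi> i. c i x \<bullet> v)) (at x)" if "x \<in> ball p r" for x
    unfolding \<Phi>_def using f[OF that]
    by (intro has_derivative_vec_lambda) (auto intro!: derivative_eq_intros)
  have \<Phi>p: "\<Phi> p = q" by (simp add: \<Phi>_def vec_eq_iff)
  define D where "D x = Blinfun (\<lambda>v. \<chi> i. c i x \<bullet> v)" for x
  have D: "blinfun_apply (D x) = (\<lambda>v. \<chi> i. c i x \<bullet> v)" for x
    unfolding D_def
    by (rule bounded_linear_Blinfun_apply)
      (auto intro!: linear_conv_bounded_linear[THEN iffD1] linearI simp: vec_eq_iff inner_add_right)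
  have DE: "D x (\<Sum>j\<in>UNIV. w $ j *\<^sub>R E j x) = w" if "x \<in> U" for x w
    using dual[OF that] by (simp add: D vec_eq_iff inner_sum_right if_distrib[of "\<lambda>x. _ * x"] cong: if_cong)
  have ED: "(\<Sum>j\<in>UNIV. (c j x \<bullet> v) *\<^sub>R E j x) = v" if "x \<in> U" for x v
  proof (rule linear_eq_on_spanning[OF _ _ span[OF that], of "\<lambda>v. \<Sum>j\<in>UNIV. (c j x \<bullet> v) *\<^sub>R E j x" "\<lambda>v. v"])
    show "linear (\<lambda>v. \<Sum>j\<in>UNIV. (c j x \<bullet> v) *\<^sub>R E j x)"
      by (rule linearI) (auto simp: inner_add_right scaleR_add_left sum.distrib scaleR_sum_right)
    show "linear (\<lambda>v. v)" by (rule linear_ident)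
    show "(\<Sum>j\<in>UNIV. (c j x \<bullet> E k x) *\<^sub>R E j x) = E k x" for k
      using dual[OF that] by (simp add: if_distrib[of "\<lambda>s. s *\<^sub>R _"] cong: if_cong)
  qed
  have contD: "continuous_on (ball p r) D"
  proof (rule continuous_on_blinfun_componentwise)
    fix b :: "real^'n"
    have "continuous_on (ball p r) (c i)" for i
      using has_derivative_continuous[OF smooth_on_has_derivative[OF c U(1)]] r(2)
      by (intro continuous_at_imp_continuous_on) blast
    then show "continuous_on (ball p r) (\<lambda>x. D x b)"
      unfolding D by (intro continuous_on_vec_lambda continuous_on_inner continuous_on_const)
  qed
  define invf where "invf = Blinfun (\<lambda>w::real^'n. \<Sum>j\<in>UNIV. w $ j *\<^sub>R E j p)"
  have invf: "blinfun_apply invf = (\<lambda>w. \<Sum>j\<in>UNIV. w $ j *\<^sub>R E j p)"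
    unfolding invf_def
    by (rule bounded_linear_Blinfun_apply)
      (auto intro!: linear_conv_bounded_linear[THEN iffD1] linearI simp: scaleR_add_left sum.distrib scaleR_sum_right)
  have invD: "invf o\<^sub>L D p = id_blinfun"
    by (rule blinfun_eqI) (simp add: invf D ED[OF U(2)])
  have dD: "(\<Phi> has_derivative blinfun_apply (D x)) (at x)" if "x \<in> ball p r" for x
    unfolding D by (rule d\<Phi>[OF that])
  have pball: "p \<in> ball p r" using r by simp
  obtain U' V g g' where ift: "open U'" "U' \<subseteq> ball p r" "p \<in> U'" "open V" "\<Phi> p \<in> V" "homeomorphism U' V \<Phi> g"
    "\<And>y. y \<in> V \<Longrightarrow> (g has_derivative (g' y)) (at y)"
    "\<And>y. y \<in> V \<Longrightarrow> g' y = inv_into UNIV (blinfun_apply (D (g y)))"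
    "\<And>y. y \<in> V \<Longrightarrow> bij (blinfun_apply (D (g y)))"
  proof (rule inverse_function_theorem[OF open_ball dD contD pball invD], assumption, goal_cases)
    case (1 U' V g g')
    then show ?case by (intro 1(1)[of U' V g g']) simp_all
  qed
  have gV: "g y \<in> U'" "\<Phi> (g y) = y" if "y \<in> V" for y
    using ift(6) that by (auto simp: homeomorphism_def)
  have gU: "\<Phi> x \<in> V" "g (\<Phi> x) = x" if "x \<in> U'" for x
    using ift(6) that by (auto simp: homeomorphism_def)
  have U'U: "U' \<subseteq> U" using ift(2) r(2) by blast
  obtain e where e: "\<And>i. e i > 0" "{y. \<forall>i. \<bar>y $ i - q $ i\<bar> < e i} \<subseteq> V"
    using open_contains_open_box[OF ift(4), of q] ift(5) unfolding \<Phi>p by blast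
  define \<Omega> where "\<Omega> = {y. \<forall>i. \<bar>y $ i - q $ i\<bar> < e i}"
  have "open \<Omega>" unfolding \<Omega>_def by (rule open_box)
  have \<Omega>V: "\<Omega> \<subseteq> V" using e by (simp add: \<Omega>_def)
  have q\<Omega>: "q \<in> \<Omega>" using e(1) by (simp add: \<Omega>_def)
  have dg: "(g has_derivative (\<lambda>v. \<Sum>i\<in>UNIV. v $ i *\<^sub>R E i (g x))) (at x)" if "x \<in> V" for x
  proof -
    have "g' x = (\<lambda>v. \<Sum>i\<in>UNIV. v $ i *\<^sub>R E i (g x))"
    proof
      fix v
      have "blinfun_apply (D (g x)) (\<Sum>i\<in>UNIV. v $ i *\<^sub>R E i (g x)) = v"
        by (rule DE[OF subsetD[OF U'U gV(1)[OF that]]])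
      then show "g' x v = (\<Sum>i\<in>UNIV. v $ i *\<^sub>R E i (g x))"
        unfolding ift(8)[OF that] by (rule sym[OF iffD2[OF bij_inv_eq_iff[OF ift(9)[OF that]]]])
    qed
    then show ?thesis using ift(7)[OF that] by simp
  qed
  have gN: "g ` \<Omega> = {x \<in> U'. \<Phi> x \<in> \<Omega>}"
    using gV gU \<Omega>V by (auto simp: image_iff) (metis gU(2) subset_iff)
  have "continuous_on U' \<Phi>" using ift(6) by (simp add: homeomorphism_def)
  then have openN: "open (g ` \<Omega>)"
    unfolding gN using continuous_open_preimage[OF _ ift(1) \<open>open \<Omega>\<close>] by (simp add: vimage_def Int_def)
  have NU: "g ` \<Omega> \<subseteq> U'" using gN by blast
  show thesis
  proof
    show "e i > 0" for i by (rule e)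
    show "open (g ` \<Omega>)" by (rule openN)
    show "g q = p" using gU(2)[OF ift(3)] \<Phi>p by simp
    then show "p \<in> g ` \<Omega>" using q\<Omega> by blast
    show "g ` \<Omega> \<subseteq> U" using NU U'U by blast
    show "g ` {y. \<forall>i. \<bar>y $ i - q $ i\<bar> < e i} = g ` \<Omega>" by (simp add: \<Omega>_def)
    show "\<Phi> (g x) = x" if "\<forall>i. \<bar>x $ i - q $ i\<bar> < e i" for x
      using that \<Omega>V by (intro gV) (auto simp: \<Omega>_def)
    show "(g has_derivative (\<lambda>v. \<Sum>i\<in>UNIV. v $ i *\<^sub>R E i (g x))) (at x)" if "\<forall>i. \<bar>x $ i - q $ i\<bar> < e i" for x
      using that \<Omega>V by (intro dg) (auto simp: \<Omega>_def)
    \<comment> \<open>The inverse function theorem gives only a first derivative of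
      \<open>g\<close>; since it is built from the smooth fields \<open>E i\<close> at the image
      point, all orders follow.\<close>
    have "smooth_on \<Omega> (\<lambda>x. (\<lambda>y. y) (g x))"
      using \<Omega>V \<open>g ` \<Omega> \<subseteq> U\<close>
      by (intro smooth_on_compose_frame[OF \<open>open \<Omega>\<close> openN order_refl smooth_on_subset[OF E] dg smooth_on_ident[OF openN]]) auto
    then show "smooth_on {y. \<forall>i. \<bar>y $ i - q $ i\<bar> < e i} g" by (simp add: \<Omega>_def)
    show "smooth_on (g ` \<Omega>) \<Phi>"
    proof (rule smooth_onI_derivative[OF openN d\<Phi>])
      show "x \<in> ball p r" if "x \<in> g ` \<Omega>" for x using that NU ift(2) by blast
      show "smooth_on (g ` \<Omega>) (\<lambda>x. \<chi> i. c i x \<bullet> v)" for v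
        by (intro smooth_on_vec_lambda smooth_on_inner smooth_on_const openN
            smooth_on_subset[OF c \<open>g ` \<Omega> \<subseteq> U\<close>])
    qed
  qed
qed

text \<open>The derivative is tested in the direction \<open>y - x\<close> alone, so the lemma
  covers functions constant on lines parallel to an axis as well as functions with zero
  derivative.\<close>

lemma has_derivative_zero_on_segment:
  fixes f :: "'a::real_normed_vector \<Rightarrow> real"
  assumes "convex \<Omega>" "x \<in> \<Omega>" "y \<in> \<Omega>"
    and d: "\<And>z. z \<in> \<Omega> \<Longrightarrow> (f has_derivative f' z) (at z)" and z: "\<And>z. z \<in> \<Omega> \<Longrightarrow> f' z (y - x) = 0"
  shows "f x = f y"
proof -
  have seg: "x + s *\<^sub>R (y - x) \<in> \<Omega>" if "s \<in> {0..1}" for s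
  proof -
    have "x + s *\<^sub>R (y - x) = (1 - s) *\<^sub>R x + s *\<^sub>R y" by (simp add: algebra_simps)
    then show ?thesis using convexD[OF assms(1-3), of "1 - s" s] that by simp
  qed
  have "((\<lambda>s. f (x + s *\<^sub>R (y - x))) has_real_derivative 0) (at s within {0..1})" if "s \<in> {0..1}" for s
    using has_real_derivative_along_line[OF d[OF seg[OF that]]] z[OF seg[OF that]]
    by (simp add: has_field_derivative_at_within)
  then obtain c where "\<And>s. s \<in> {0..1} \<Longrightarrow> f (x + s *\<^sub>R (y - x)) = c"
    using has_field_derivative_zero_constant[of "{0..1::real}" "\<lambda>s. f (x + s *\<^sub>R (y - x))"] by auto
  from this[of 0] this[of 1] show ?thesis by simp
qed

section \<open>Structure equations of the hypersphere\<close>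

lemma vector_4 [simp]:
  "(vector [w, x, y, z] :: 'a::zero^4) $ 1 = w"
  "(vector [w, x, y, z] :: 'a::zero^4) $ 2 = x"
  "(vector [w, x, y, z] :: 'a::zero^4) $ 3 = y"
  "(vector [w, x, y, z] :: 'a::zero^4) $ 4 = z"
  unfolding vector_def by simp_all

lemma matrix_mult_row: "(A ** B) $ i = (\<Sum>k\<in>UNIV. A $ i $ k *\<^sub>R B $ k)"
  for A :: "real^'n^'m" and B :: "real^'k^'n"
  by (simp add: matrix_matrix_mult_def vec_eq_iff)

lemma bounded_bilinear_matrix_matrix_mult:
  "bounded_bilinear ((**) :: real^'n^'m \<Rightarrow> real^'k^'n \<Rightarrow> real^'k^'m)"
  unfolding bilinear_conv_bounded_bilinear[symmetric] bilinear_def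
  by (intro conjI allI linearI)
    (auto simp: matrix_matrix_mult_def vec_eq_iff sum.distrib algebra_simps sum_distrib_left)

lemma lie_component:
  assumes "smooth_on U F" "open U" "p \<in> U"
  shows "lie X (\<lambda>q. F q $ i) p = lie X F p $ i"
  unfolding lie_def
  by (rule frechet_derivative_linear_comp[OF bounded_linear_vec_nth smooth_on_differentiable_at[OF assms]])

text \<open>Applying \<open>XY - YX = [X, Y]\<close> to a moving frame of the ambient space yields the Gauss and
  Codazzi equations in one go.\<close>

lemma flat_frame_integrability:
  fixes F :: "'a::euclidean_space \<Rightarrow> real^'m^'m" and A B :: "'a \<Rightarrow> real^'m^'m" and C :: "real^'m^'m"
  assumes U: "open U" "p \<in> U" and sm: "smooth_on U X" "smooth_on U Y" "smooth_on U F" "smooth_on U A" "smooth_on U B"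
    and XF: "\<And>q. q \<in> U \<Longrightarrow> lie X F q = A q ** F q" and YF: "\<And>q. q \<in> U \<Longrightarrow> lie Y F q = B q ** F q"
    and br: "frechet_derivative F (at p) (lie X Y p - lie Y X p) = C ** F p"
    and inv: "invertible (F p)"
  shows "lie X B p - lie Y A p + B p ** A p - A p ** B p = C"
proof -
  have L: "lie Z (\<lambda>q. M q ** F q) p = M p ** lie Z F p + lie Z M p ** F p" if "smooth_on U M" for Z and M :: "'a \<Rightarrow> real^'m^'m"
    by (rule lie_eqI[OF bounded_bilinear.FDERIV[OF bounded_bilinear_matrix_matrix_mult
          smooth_on_has_derivative[OF that U] smooth_on_has_derivative[OF sm(3) U]], of Z, folded lie_def])
  have "lie X (lie Y F) p = B p ** (A p ** F p) + lie X B p ** F p"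
    using lie_cong_open[OF U, of "lie Y F" "\<lambda>q. B q ** F q" X, OF YF] L[OF sm(5), of X] XF[OF U(2)] by simp
  moreover have "lie Y (lie X F) p = A p ** (B p ** F p) + lie Y A p ** F p"
    using lie_cong_open[OF U, of "lie X F" "\<lambda>q. A q ** F q" Y, OF XF] L[OF sm(4), of Y] YF[OF U(2)] by simp
  ultimately have "(lie X B p - lie Y A p + B p ** A p - A p ** B p) ** F p = C ** F p"
    using lie_commutator[OF U(1) sm(3,1,2) U(2)] br
    by (simp add: bounded_bilinear.diff_left[OF bounded_bilinear_matrix_matrix_mult]
        bounded_bilinear.add_left[OF bounded_bilinear_matrix_matrix_mult] matrix_mul_assoc algebra_simps)
  then show ?thesis
    using inv unfolding invertible_def by (metis matrix_mul_assoc matrix_mul_rid)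
qed

text \<open>Each row of \<open>M\<close> solves a linear system with the transpose of
  \<open>F\<close> as matrix, so Cramer's rule applies row by row.\<close>

lemma smooth_on_left_quotient:
  fixes F G M :: "'a::real_normed_vector \<Rightarrow> real^'m^'m"
  assumes "open U" "smooth_on U F" "smooth_on U G"
    and "\<And>q. q \<in> U \<Longrightarrow> invertible (F q)" "\<And>q. q \<in> U \<Longrightarrow> M q ** F q = G q"
  shows "smooth_on U M"
proof -
  have row: "smooth_on U (\<lambda>q. M q $ j)" for j
  proof (rule smooth_on_linear_solve[where A = "\<lambda>q. transpose (F q)" and b = "\<lambda>q. G q $ j", OF assms(1)])
    show "smooth_on U (\<lambda>x. transpose (F x) $ i $ k)" for i k
      using smooth_on_nth[OF assms(1) smooth_on_nth[OF assms(1,2)]] by (simp add: transpose_def)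
    show "smooth_on U (\<lambda>q. G q $ j)" by (rule smooth_on_nth[OF assms(1,3)])
    show "det (transpose (F q)) \<noteq> 0" if "q \<in> U" for q
      using assms(4)[OF that] by (simp add: det_transpose invertible_det_nz)
    show "transpose (F q) *v (M q $ j) = G q $ j" if "q \<in> U" for q
      unfolding assms(5)[OF that, symmetric]
      by (simp add: transpose_def matrix_vector_mult_def matrix_matrix_mult_def vec_eq_iff mult.commute)
  qed
  show ?thesis using smooth_on_vec_lambda[OF assms(1), of "\<lambda>j q. M q $ j", OF row] unfolding vec_lambda_eta .
qed

section \<open>Affine metric and induced connection\<close>

locale S3_hypersphere =
  fixes U :: "(real^3) set" and \<phi> \<xi> :: "real^3 \<Rightarrow> real^4"
    and \<Gamma> \<Gamma>h :: "real^3 \<Rightarrow> real^3 \<Rightarrow> real^3 \<Rightarrow> real^3"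
    and h :: "real^3 \<Rightarrow> real^3 \<Rightarrow> real^3 \<Rightarrow> real"
    and T V W :: "real^3 \<Rightarrow> real^3" and a :: "real^3 \<Rightarrow> real"
  assumes U: "open U" and \<phi>: "smooth_on U \<phi>"
    and inj: "\<And>p. p \<in> U \<Longrightarrow> inj (dphi \<phi> p)"
    and blaschke: "blaschke_structure U \<phi> \<xi> \<Gamma> h"
    and hypersphere: "hypersphere_H1 U \<phi> \<xi>"
    and levi_civita: "levi_civita U h \<Gamma>h"
    and frame: "S3_frame U h (Kdiff \<Gamma> \<Gamma>h) T V W a"
begin

lemma linear_dphi: "p \<in> U \<Longrightarrow> linear (dphi \<phi> p)"
  unfolding dphi_def by (rule has_derivative_linear[OF smooth_on_has_derivative[OF \<phi> U]])

lemma gauss: "p \<in> U \<Longrightarrow> d2phi \<phi> p X Y = dphi \<phi> p (\<Gamma> p X Y) + h p X Y *\<^sub>R \<xi> p"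
  using blaschke by (simp add: blaschke_structure_def)

text \<open>Tangential and transversal parts of a vector of the ambient space are unique. Symmetry
  of \<open>h\<close> and \<open>\<Gamma>\<close> and linearity of \<open>h\<close> are read off
  from the second derivative of \<open>\<phi>\<close> in this way.\<close>

lemma transversal:
  assumes "p \<in> U" "dphi \<phi> p u + c *\<^sub>R \<xi> p = dphi \<phi> p v + d *\<^sub>R \<xi> p"
  shows "u = v" "c = d"
proof -
  interpret linear "dphi \<phi> p" by (rule linear_dphi[OF assms(1)])
  have *: "(d - c) *\<^sub>R \<xi> p = dphi \<phi> p (u - v)"
    using assms(2) by (simp add: diff algebra_simps)
  show "c = d"
  proof (rule ccontr)
    assume "c \<noteq> d"
    then have "\<xi> p = dphi \<phi> p ((1 / (d - c)) *\<^sub>R (u - v))"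
      using * by (simp add: scale[symmetric] *[symmetric] del: diff) (simp add: scale *[symmetric])
    then show False using blaschke assms(1) by (auto simp: blaschke_structure_def)
  qed
  then have "dphi \<phi> p u = dphi \<phi> p v" using assms(2) by simp
  then show "u = v" using inj[OF assms(1)] by (simp add: inj_eq)
qed

lemma d2phi_sym: "p \<in> U \<Longrightarrow> d2phi \<phi> p X Y = d2phi \<phi> p Y X"
  unfolding d2phi_def by (rule second_derivative_symmetric[OF U \<phi>])

lemma h_sym: "p \<in> U \<Longrightarrow> h p X Y = h p Y X"
  using transversal(2)[of p "\<Gamma> p X Y" "h p X Y" "\<Gamma> p Y X" "h p Y X"] d2phi_sym[of p X Y] by (simp add: gauss)

lemma \<Gamma>_sym: "p \<in> U \<Longrightarrow> \<Gamma> p X Y = \<Gamma> p Y X"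
  using transversal(1)[of p "\<Gamma> p X Y" "h p X Y" "\<Gamma> p Y X" "h p Y X"] d2phi_sym[of p X Y] by (simp add: gauss)

lemma linear_h1:
  assumes "p \<in> U" shows "linear (\<lambda>X. h p X Y)"
proof -
  interpret D: linear "dphi \<phi> p" by (rule linear_dphi[OF assms(1)])
  interpret D2: linear "\<lambda>X. d2phi \<phi> p X Y"
    unfolding d2phi_def by (rule has_derivative_linear[OF smooth_on_has_derivative[OF smooth_on_frechet[OF \<phi>] U assms]])
  show ?thesis
  proof (rule linearI)
    fix X X' and c :: real
    show "h p (X + X') Y = h p X Y + h p X' Y"
      using D2.add[of X X'] by (intro transversal(2)[OF assms, of "\<Gamma> p (X + X') Y" _ "\<Gamma> p X Y + \<Gamma> p X' Y"])
        (simp add: gauss[OF assms] D.add algebra_simps)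
    show "h p (c *\<^sub>R X) Y = c *\<^sub>R h p X Y"
      using D2.scale[of c X] by (intro transversal(2)[OF assms, of "\<Gamma> p (c *\<^sub>R X) Y" _ "c *\<^sub>R \<Gamma> p X Y"])
        (simp add: gauss[OF assms] D.scale algebra_simps)
  qed
qed

lemma linear_h2: "p \<in> U \<Longrightarrow> linear (h p X)"
proof -
  assume p: "p \<in> U"
  then have "h p X = (\<lambda>Y. h p Y X)" by (intro ext h_sym)
  then show ?thesis using linear_h1[OF p, of X] by simp
qed

lemmas h_linear_simps =
  linear_add[OF linear_h1] linear_add[OF linear_h2] linear_diff[OF linear_h1] linear_diff[OF linear_h2]
  linear_scale[OF linear_h1] linear_scale[OF linear_h2] linear_neg[OF linear_h1] linear_neg[OF linear_h2]

lemma smooth_frame: "smooth_on U T" "smooth_on U V" "smooth_on U W"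
  and a_pos: "p \<in> U \<Longrightarrow> a p > 0"
  and orthonormal: "p \<in> U \<Longrightarrow> h p (T p) (T p) = -1" "p \<in> U \<Longrightarrow> h p (V p) (V p) = 1" "p \<in> U \<Longrightarrow> h p (W p) (W p) = 1"
    "p \<in> U \<Longrightarrow> h p (T p) (V p) = 0" "p \<in> U \<Longrightarrow> h p (T p) (W p) = 0" "p \<in> U \<Longrightarrow> h p (V p) (W p) = 0"
    "p \<in> U \<Longrightarrow> h p (V p) (T p) = 0" "p \<in> U \<Longrightarrow> h p (W p) (T p) = 0" "p \<in> U \<Longrightarrow> h p (W p) (V p) = 0"
  using frame h_sym by (auto simp: S3_frame_def)

text \<open>Orthonormality provides a left inverse of the map from coefficients to vectors, and
  equality of dimensions makes that map surjective. The minus sign reflects h(T, T) = -1.\<close>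

lemma frame_expansion:
  assumes p: "p \<in> U"
  shows "u = (- h p u (T p)) *\<^sub>R T p + h p u (V p) *\<^sub>R V p + h p u (W p) *\<^sub>R W p"
proof -
  define g where "g x = x $ 1 *\<^sub>R T p + x $ 2 *\<^sub>R V p + x $ 3 *\<^sub>R W p" for x :: "real^3"
  define f where "f u = (vector [- h p u (T p), h p u (V p), h p u (W p)] :: real^3)" for u
  have fg: "f (g x) = x" for x
    by (simp add: f_def g_def vec_eq_iff forall_3 h_linear_simps[OF p] orthonormal[OF p])
  have "linear g" by (rule linearI) (auto simp: g_def algebra_simps)
  moreover have "inj_on g UNIV" using fg by (metis injI)
  ultimately have "surj g" by (rule linear_injective_imp_surjective) simp
  then obtain x where "u = g x" by blast
  then have "u = g (f u)" using fg by simp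
  then show ?thesis by (simp add: g_def f_def)
qed

lemma span_frame:
  assumes "p \<in> U"
  shows "span {T p, V p, W p} = UNIV"
proof -
  have "u \<in> span {T p, V p, W p}" for u
    by (subst frame_expansion[OF assms, of u], intro span_add span_scale span_base) auto
  then show ?thesis by auto
qed

definition nabla_hat :: "(real^3 \<Rightarrow> real^3) \<Rightarrow> (real^3 \<Rightarrow> real^3) \<Rightarrow> real^3 \<Rightarrow> real^3" where
  "nabla_hat X Y p = lie X Y p + \<Gamma>h p (X p) (Y p)"

lemma h_Basis_expansion:
  assumes "p \<in> U"
  shows "h p Y Z = (\<Sum>b\<in>Basis. \<Sum>c\<in>Basis. (Y \<bullet> b) * (Z \<bullet> c) * h p b c)"
proof -
  have "h p Y Z = (\<Sum>b\<in>Basis. (Y \<bullet> b) * h p b Z)"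
    using linear_Basis_expansion[OF linear_h1[OF assms], of Y Z] by simp
  also have "\<dots> = (\<Sum>b\<in>Basis. (Y \<bullet> b) * (\<Sum>c\<in>Basis. (Z \<bullet> c) * h p b c))"
    using linear_Basis_expansion[OF linear_h2[OF assms], of _ Z] by simp
  finally show ?thesis by (simp add: sum_distrib_left mult.assoc)
qed

lemma has_derivative_h:
  assumes "p \<in> U"
  shows "((\<lambda>q. h q Y Z) has_derivative (\<lambda>X. h p (\<Gamma>h p X Y) Z + h p Y (\<Gamma>h p X Z))) (at p)"
  using levi_civita assms by (simp add: levi_civita_def)

lemma metric_compatible:
  assumes p: "p \<in> U" and "smooth_on U Y" "smooth_on U Z"
  shows "lie X (\<lambda>q. h q (Y q) (Z q)) p = h p (nabla_hat X Y p) (Z p) + h p (Y p) (nabla_hat X Z p)"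
proof -
  note dY = smooth_on_has_derivative[OF assms(2) U p] and dZ = smooth_on_has_derivative[OF assms(3) U p]
  let ?G = "\<lambda>b c x. h p (\<Gamma>h p x b) c + h p b (\<Gamma>h p x c)"
  \<comment> \<open>With the arguments frozen at \<open>Y p\<close> and \<open>Z p\<close>, the
    metric is differentiated in two ways, through the basis expansion and directly. Uniqueness of
    the derivative then plays the role of bilinearity of the Christoffel terms.\<close>
  have "((\<lambda>q. \<Sum>b\<in>Basis. \<Sum>c\<in>Basis. (Y p \<bullet> b) * (Z p \<bullet> c) * h q b c) has_derivative
     (\<lambda>x. \<Sum>b\<in>Basis. \<Sum>c\<in>Basis. (Y p \<bullet> b) * (Z p \<bullet> c) * ?G b c x)) (at p)"
    by (intro has_derivative_sum has_derivative_mult_right has_derivative_h[OF p])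
  moreover have "((\<lambda>q. \<Sum>b\<in>Basis. \<Sum>c\<in>Basis. (Y p \<bullet> b) * (Z p \<bullet> c) * h q b c) has_derivative
     (\<lambda>x. h p (\<Gamma>h p x (Y p)) (Z p) + h p (Y p) (\<Gamma>h p x (Z p)))) (at p)"
    by (rule has_derivative_transform_within_open[OF has_derivative_h[OF p] U p]) (rule h_Basis_expansion)
  ultimately have G: "(\<Sum>b\<in>Basis. \<Sum>c\<in>Basis. (Y p \<bullet> b) * (Z p \<bullet> c) * ?G b c x)
     = h p (\<Gamma>h p x (Y p)) (Z p) + h p (Y p) (\<Gamma>h p x (Z p))" for x
    by (rule fun_cong[OF has_derivative_unique])
  let ?Y' = "frechet_derivative Y (at p)" and ?Z' = "frechet_derivative Z (at p)"
  have "((\<lambda>q. \<Sum>b\<in>Basis. \<Sum>c\<in>Basis. (Y q \<bullet> b) * (Z q \<bullet> c) * h q b c) has_derivative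
     (\<lambda>x. \<Sum>b\<in>Basis. \<Sum>c\<in>Basis. (Y p \<bullet> b) * (Z p \<bullet> c) * ?G b c x
        + ((Y p \<bullet> b) * (?Z' x \<bullet> c) + (?Y' x \<bullet> b) * (Z p \<bullet> c)) * h p b c)) (at p)"
    by (intro has_derivative_sum has_derivative_mult has_derivative_inner_left dY dZ has_derivative_h[OF p])
  then have "((\<lambda>q. h q (Y q) (Z q)) has_derivative
     (\<lambda>x. \<Sum>b\<in>Basis. \<Sum>c\<in>Basis. (Y p \<bullet> b) * (Z p \<bullet> c) * ?G b c x
        + ((Y p \<bullet> b) * (?Z' x \<bullet> c) + (?Y' x \<bullet> b) * (Z p \<bullet> c)) * h p b c)) (at p)"
    by (rule has_derivative_transform_within_open[OF _ U p]) (simp add: h_Basis_expansion[symmetric])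
  moreover have "(\<Sum>b\<in>Basis. \<Sum>c\<in>Basis. (Y p \<bullet> b) * (Z p \<bullet> c) * ?G b c x
        + ((Y p \<bullet> b) * (?Z' x \<bullet> c) + (?Y' x \<bullet> b) * (Z p \<bullet> c)) * h p b c)
     = (h p (\<Gamma>h p x (Y p)) (Z p) + h p (Y p) (\<Gamma>h p x (Z p))) + (h p (Y p) (?Z' x) + h p (?Y' x) (Z p))" for x
    unfolding G[symmetric] h_Basis_expansion[OF p, of "Y p" "?Z' x"] h_Basis_expansion[OF p, of "?Y' x" "Z p"]
    by (simp only: distrib_right sum.distrib)
  ultimately have "((\<lambda>q. h q (Y q) (Z q)) has_derivative
     (\<lambda>x. (h p (\<Gamma>h p x (Y p)) (Z p) + h p (Y p) (\<Gamma>h p x (Z p))) + (h p (Y p) (?Z' x) + h p (?Y' x) (Z p)))) (at p)"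
    by simp
  from lie_eqI[OF this, of X] show ?thesis
    by (simp add: nabla_hat_def lie_def h_linear_simps[OF p])
qed

section \<open>Connection forms of the orthonormal frame\<close>

abbreviation "K \<equiv> Kdiff \<Gamma> \<Gamma>h"

text \<open>The three connection forms of the frame, evaluated on \<open>X\<close>. The values
  \<open>conn_TV V\<close> and \<open>conn_TW V\<close> are the invariants \<alpha>22 and
  \<alpha>23; \<open>conn_VW\<close> measures the rotation in the plane of V and W.\<close>

definition "conn_TV X p = h p (nabla_hat X T p) (V p)"
definition "conn_TW X p = h p (nabla_hat X T p) (W p)"
definition "conn_VW X p = h p (nabla_hat X V p) (W p)"

lemma nabla_hat_skew:
  assumes p: "p \<in> U" and "smooth_on U Y" "smooth_on U Z" and "\<And>q. q \<in> U \<Longrightarrow> h q (Y q) (Z q) = c"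
  shows "h p (nabla_hat X Y p) (Z p) = - h p (nabla_hat X Z p) (Y p)"
proof -
  have "lie X (\<lambda>q. h q (Y q) (Z q)) p = lie X (\<lambda>q. c) p"
    by (rule lie_cong_open[OF U p]) (rule assms(4))
  then show ?thesis
    using metric_compatible[OF assms(1-3), of X] h_sym[OF p, of "Y p" "nabla_hat X Z p"] by simp
qed

lemma nabla_hat_frame:
  assumes p: "p \<in> U"
  shows "nabla_hat X T p = conn_TV X p *\<^sub>R V p + conn_TW X p *\<^sub>R W p"
    and "nabla_hat X V p = conn_TV X p *\<^sub>R T p + conn_VW X p *\<^sub>R W p"
    and "nabla_hat X W p = conn_TW X p *\<^sub>R T p - conn_VW X p *\<^sub>R V p"
proof -
  note sk = nabla_hat_skew[OF p]
  have "h p (nabla_hat X T p) (T p) = 0" "h p (nabla_hat X V p) (V p) = 0" "h p (nabla_hat X W p) (W p) = 0"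
    using sk[OF smooth_frame(1) smooth_frame(1) orthonormal(1)] sk[OF smooth_frame(2) smooth_frame(2) orthonormal(2)]
      sk[OF smooth_frame(3) smooth_frame(3) orthonormal(3)] by (smt (verit))+
  moreover have "h p (nabla_hat X V p) (T p) = - conn_TV X p" "h p (nabla_hat X W p) (T p) = - conn_TW X p"
    "h p (nabla_hat X W p) (V p) = - conn_VW X p"
    using sk[OF smooth_frame(2) smooth_frame(1) orthonormal(7)] sk[OF smooth_frame(3) smooth_frame(1) orthonormal(8)]
      sk[OF smooth_frame(3) smooth_frame(2) orthonormal(9)]
    by (simp_all add: conn_TV_def conn_TW_def conn_VW_def)
  ultimately show "nabla_hat X T p = conn_TV X p *\<^sub>R V p + conn_TW X p *\<^sub>R W p"
    "nabla_hat X V p = conn_TV X p *\<^sub>R T p + conn_VW X p *\<^sub>R W p"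
    "nabla_hat X W p = conn_TW X p *\<^sub>R T p - conn_VW X p *\<^sub>R V p"
    using frame_expansion[OF p, of "nabla_hat X T p"] frame_expansion[OF p, of "nabla_hat X V p"]
      frame_expansion[OF p, of "nabla_hat X W p"]
    by (simp_all add: conn_TV_def[symmetric] conn_TW_def[symmetric] conn_VW_def[symmetric])
qed

lemma \<Gamma>h_sym: "p \<in> U \<Longrightarrow> \<Gamma>h p X Y = \<Gamma>h p Y X"
  using levi_civita unfolding levi_civita_def by blast

lemma torsion_free: "p \<in> U \<Longrightarrow> lie X Y p - lie Y X p = nabla_hat X Y p - nabla_hat Y X p"
  using \<Gamma>h_sym[of p "X p" "Y p"] by (simp add: nabla_hat_def)

lemma K_frame:
  assumes p: "p \<in> U"
  shows "K p (T p) X = 0" "K p X (T p) = 0" "K p (V p) (V p) = a p *\<^sub>R V p" "K p (V p) (W p) = - (a p *\<^sub>R W p)"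
    "K p (W p) (V p) = - (a p *\<^sub>R W p)" "K p (W p) (W p) = - (a p *\<^sub>R V p)"
proof -
  have sym: "K p X Y = K p Y X" for X Y
    using \<Gamma>_sym[OF p, of X Y] \<Gamma>h_sym[OF p, of X Y] by (simp add: Kdiff_def)
  show "K p (T p) X = 0" "K p X (T p) = 0" "K p (V p) (V p) = a p *\<^sub>R V p" "K p (V p) (W p) = - (a p *\<^sub>R W p)"
    "K p (W p) (V p) = - (a p *\<^sub>R W p)" "K p (W p) (W p) = - (a p *\<^sub>R V p)"
    using frame p sym[of X "T p"] sym[of "W p" "V p"] by (simp_all add: S3_frame_def)
qed

lemma lie_\<phi>: "lie X \<phi> p = dphi \<phi> p (X p)"
  by (simp add: lie_def dphi_def)

lemma gauss_formula:
  assumes p: "p \<in> U" and Y: "smooth_on U Y"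
  shows "lie X (lie Y \<phi>) p = dphi \<phi> p (nabla_hat X Y p + K p (X p) (Y p)) + h p (X p) (Y p) *\<^sub>R \<xi> p"
proof -
  have "nabla_hat X Y p + K p (X p) (Y p) = lie X Y p + \<Gamma> p (X p) (Y p)"
    by (simp add: nabla_hat_def Kdiff_def)
  then show ?thesis
    using lie_lie[OF U \<phi> Y p, of X] gauss[OF p, of "X p" "Y p"]
    by (simp add: d2phi_def dphi_def[symmetric] linear_add[OF linear_dphi[OF p]])
qed

lemma has_derivative_\<xi>: "p \<in> U \<Longrightarrow> (\<xi> has_derivative (\<lambda>X. - dphi \<phi> p X)) (at p)"
  using hypersphere by (simp add: hypersphere_H1_def)

text \<open>The hypersphere condition gives \<open>\<xi>\<close> the derivative -d\<phi>, which is
  smooth; one derivative of \<open>\<xi>\<close> therefore yields all of them.\<close>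

lemma smooth_\<xi>: "smooth_on U \<xi>"
proof (rule smooth_onI_derivative[OF U has_derivative_\<xi>])
  show "smooth_on U (\<lambda>p. - dphi \<phi> p v)" for v
    unfolding dphi_def by (rule smooth_on_minus[OF U smooth_on_frechet[OF \<phi>]])
qed

lemma lie_\<xi>: "p \<in> U \<Longrightarrow> lie X \<xi> p = - lie X \<phi> p"
  using lie_eqI[OF has_derivative_\<xi>, of p X] by (simp add: lie_\<phi>)

section \<open>The flat connection in the moving frame\<close>

definition moving_frame :: "real^3 \<Rightarrow> real^4^4" where
  "moving_frame p = vector [lie T \<phi> p, lie V \<phi> p, lie W \<phi> p, \<xi> p]"

text \<open>Matrices of the flat connection of the ambient space in the moving frame
  \<open>(T, V, W, \<xi>)\<close>: the entries containing \<open>a\<close> come from the difference tensor, the last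
  column from the affine metric and the last row from the shape operator.\<close>

definition MT :: "real^3 \<Rightarrow> real^4^4" where
  "MT p = vector [vector [0, conn_TV T p, conn_TW T p, - 1], vector [conn_TV T p, 0, conn_VW T p, 0],
     vector [conn_TW T p, - conn_VW T p, 0, 0], vector [- 1, 0, 0, 0]]"

definition MV :: "real^3 \<Rightarrow> real^4^4" where
  "MV p = vector [vector [0, conn_TV V p, conn_TW V p, 0], vector [conn_TV V p, a p, conn_VW V p, 1],
     vector [conn_TW V p, - conn_VW V p, - a p, 0], vector [0, - 1, 0, 0]]"

definition MW :: "real^3 \<Rightarrow> real^4^4" where
  "MW p = vector [vector [0, conn_TV W p, conn_TW W p, 0], vector [conn_TV W p, 0, conn_VW W p - a p, 0],
     vector [conn_TW W p, - conn_VW W p - a p, 0, 1], vector [0, 0, - 1, 0]]"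

lemma smooth_moving_frame: "smooth_on U moving_frame"
proof -
  have "smooth_on U (\<lambda>p. \<chi> i. moving_frame p $ i)"
  proof (rule smooth_on_vec_lambda[OF U])
    have "\<forall>i. smooth_on U (\<lambda>p. moving_frame p $ i)"
      by (simp add: forall_4 moving_frame_def smooth_\<xi> smooth_on_lie[OF U _ \<phi>] smooth_frame)
    then show "smooth_on U (\<lambda>p. moving_frame p $ i)" for i by blast
  qed
  then show ?thesis unfolding vec_lambda_eta .
qed

lemma lie_moving_frame_rows:
  assumes "p \<in> U"
  shows "lie X moving_frame p = vector [lie X (lie T \<phi>) p, lie X (lie V \<phi>) p, lie X (lie W \<phi>) p, lie X \<xi> p]"
proof -
  have "\<forall>i. lie X moving_frame p $ i = vector [lie X (lie T \<phi>) p, lie X (lie V \<phi>) p, lie X (lie W \<phi>) p, lie X \<xi> p] $ i"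
    unfolding lie_component[OF smooth_moving_frame U assms, symmetric] by (simp add: forall_4 moving_frame_def)
  then show ?thesis by (simp add: vec_eq_iff)
qed

lemma lie_moving_frame:
  assumes p: "p \<in> U"
  shows "lie T moving_frame p = MT p ** moving_frame p" "lie V moving_frame p = MV p ** moving_frame p" "lie W moving_frame p = MW p ** moving_frame p"
proof -
  note simps = vec_eq_iff[of "vector [_, _, _, _] :: real^4^4"] forall_4 lie_moving_frame_rows[OF p] matrix_mult_row sum_4
    gauss_formula[OF p] lie_\<xi>[OF p] nabla_hat_frame[OF p] K_frame[OF p]
    orthonormal[OF p] linear_add[OF linear_dphi[OF p]] linear_diff[OF linear_dphi[OF p]]
    linear_scale[OF linear_dphi[OF p]] linear_neg[OF linear_dphi[OF p]] linear_0[OF linear_dphi[OF p]]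
    lie_\<phi>[symmetric] smooth_frame
  show "lie T moving_frame p = MT p ** moving_frame p"
    by (simp only: simps moving_frame_def MT_def vector_4) (simp add: simps algebra_simps)
  show "lie V moving_frame p = MV p ** moving_frame p"
    by (simp only: simps moving_frame_def MV_def vector_4) (simp add: simps algebra_simps)
  show "lie W moving_frame p = MW p ** moving_frame p"
    by (simp only: simps moving_frame_def MW_def vector_4) (simp add: simps algebra_simps)
qed

lemma invertible_moving_frame:
  assumes p: "p \<in> U"
  shows "invertible (moving_frame p)"
proof -
  have "c = 0" if "(\<Sum>i\<in>UNIV. c $ i *\<^sub>R moving_frame p $ i) = 0" for c :: "real^4"
  proof -
    have "dphi \<phi> p (c $ 1 *\<^sub>R T p + c $ 2 *\<^sub>R V p + c $ 3 *\<^sub>R W p) + c $ 4 *\<^sub>R \<xi> p = dphi \<phi> p 0 + 0 *\<^sub>R \<xi> p"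
      using that by (simp add: sum_4 moving_frame_def lie_\<phi> linear_add[OF linear_dphi[OF p]]
          linear_scale[OF linear_dphi[OF p]] linear_0[OF linear_dphi[OF p]])
    from transversal[OF p this] have z: "c $ 1 *\<^sub>R T p + c $ 2 *\<^sub>R V p + c $ 3 *\<^sub>R W p = 0" and "c $ 4 = 0" by auto
    have "h p (c $ 1 *\<^sub>R T p + c $ 2 *\<^sub>R V p + c $ 3 *\<^sub>R W p) X = 0" for X
      unfolding z by (rule linear_0[OF linear_h1[OF p]])
    from this[of "T p"] this[of "V p"] this[of "W p"] \<open>c $ 4 = 0\<close> show "c = 0"
      by (simp add: h_linear_simps[OF p] orthonormal[OF p] vec_eq_iff forall_4)
  qed
  then have "\<exists>B. moving_frame p ** B = mat 1"
    unfolding matrix_right_invertible_independent_rows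
    by (simp add: row_def vec_lambda_eta scalar_mult_eq_scaleR) (metis (mono_tags, lifting) vec_lambda_beta zero_index sum.cong)
  then show ?thesis by (simp add: invertible_right_inverse)
qed

text \<open>The matrices relate two smooth objects, the moving frame and its derivative along a
  smooth field. Their entries then yield the smoothness of \<open>a\<close> and of all connection
  coefficients.\<close>

lemma smooth_conn: "smooth_on U MT" "smooth_on U MV" "smooth_on U MW"
  by (rule smooth_on_left_quotient[OF U smooth_moving_frame smooth_on_lie[OF U _ smooth_moving_frame] invertible_moving_frame lie_moving_frame(1)[symmetric]] smooth_frame
      smooth_on_left_quotient[OF U smooth_moving_frame smooth_on_lie[OF U _ smooth_moving_frame] invertible_moving_frame lie_moving_frame(2)[symmetric]]
      smooth_on_left_quotient[OF U smooth_moving_frame smooth_on_lie[OF U _ smooth_moving_frame] invertible_moving_frame lie_moving_frame(3)[symmetric]]; (rule smooth_frame | assumption))+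

lemma smooth_coeffs:
  shows "smooth_on U a" "smooth_on U (conn_TV T)" "smooth_on U (conn_TV V)" "smooth_on U (conn_TV W)"
    "smooth_on U (conn_TW T)" "smooth_on U (conn_TW V)" "smooth_on U (conn_TW W)"
    "smooth_on U (conn_VW T)" "smooth_on U (conn_VW V)" "smooth_on U (conn_VW W)"
proof -
  note entry = smooth_on_nth[OF U smooth_on_nth[OF U]]
  show a: "smooth_on U a" using entry[OF smooth_conn(2), of 2 2] by (simp add: MV_def)
  show "smooth_on U (conn_TV T)" "smooth_on U (conn_TW T)" "smooth_on U (conn_VW T)"
    using entry[OF smooth_conn(1), of 2 1] entry[OF smooth_conn(1), of 3 1] entry[OF smooth_conn(1), of 2 3] by (simp_all add: MT_def)
  show "smooth_on U (conn_TV V)" "smooth_on U (conn_TW V)" "smooth_on U (conn_VW V)"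
    using entry[OF smooth_conn(2), of 2 1] entry[OF smooth_conn(2), of 3 1] entry[OF smooth_conn(2), of 2 3] by (simp_all add: MV_def)
  show "smooth_on U (conn_TV W)" "smooth_on U (conn_TW W)"
    using entry[OF smooth_conn(3), of 2 1] entry[OF smooth_conn(3), of 3 1] by (simp_all add: MW_def)
  show "smooth_on U (conn_VW W)"
    using smooth_on_add[OF U entry[OF smooth_conn(3), of 2 3] a] by (simp add: MW_def)
qed

lemma frechet_moving_frame:
  assumes p: "p \<in> U"
  shows "frechet_derivative moving_frame (at p) (x *\<^sub>R T p + y *\<^sub>R V p + z *\<^sub>R W p) = (x *\<^sub>R MT p + y *\<^sub>R MV p + z *\<^sub>R MW p) ** moving_frame p"
proof -
  have lin: "linear (frechet_derivative moving_frame (at p))"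
    by (rule has_derivative_linear[OF smooth_on_has_derivative[OF smooth_moving_frame U p]])
  interpret M: bounded_bilinear "(**) :: real^4^4 \<Rightarrow> real^4^4 \<Rightarrow> real^4^4"
    by (rule bounded_bilinear_matrix_matrix_mult)
  show ?thesis
    using lie_moving_frame[OF p] by (simp add: lie_def linear_add[OF lin] linear_scale[OF lin] M.add_left M.scaleR_left)
qed

lemma brackets:
  assumes p: "p \<in> U"
  shows "lie T V p - lie V T p = conn_TV T p *\<^sub>R T p + (- conn_TV V p) *\<^sub>R V p + (conn_VW T p - conn_TW V p) *\<^sub>R W p"
    and "lie T W p - lie W T p = conn_TW T p *\<^sub>R T p + (- conn_VW T p - conn_TV W p) *\<^sub>R V p + (- conn_TW W p) *\<^sub>R W p"
    and "lie V W p - lie W V p = (conn_TW V p - conn_TV W p) *\<^sub>R T p + (- conn_VW V p) *\<^sub>R V p + (- conn_VW W p) *\<^sub>R W p"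
  unfolding torsion_free[OF p] nabla_hat_frame[OF p] by (simp_all add: algebra_simps)

lemma flatness:
  assumes p: "p \<in> U"
  shows "lie T MV p - lie V MT p + MV p ** MT p - MT p ** MV p
      = conn_TV T p *\<^sub>R MT p + (- conn_TV V p) *\<^sub>R MV p + (conn_VW T p - conn_TW V p) *\<^sub>R MW p"
    and "lie T MW p - lie W MT p + MW p ** MT p - MT p ** MW p
      = conn_TW T p *\<^sub>R MT p + (- conn_VW T p - conn_TV W p) *\<^sub>R MV p + (- conn_TW W p) *\<^sub>R MW p"
    and "lie V MW p - lie W MV p + MW p ** MV p - MV p ** MW p
      = (conn_TW V p - conn_TV W p) *\<^sub>R MT p + (- conn_VW V p) *\<^sub>R MV p + (- conn_VW W p) *\<^sub>R MW p"
  by (rule flat_frame_integrability[OF U p smooth_frame(1,2) smooth_moving_frame smooth_conn(1,2) lie_moving_frame(1,2) _ invertible_moving_frame[OF p]],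
      assumption+, simp only: brackets[OF p] frechet_moving_frame[OF p],
      rule flat_frame_integrability[OF U p smooth_frame(1,3) smooth_moving_frame smooth_conn(1,3) lie_moving_frame(1,3) _ invertible_moving_frame[OF p]],
      assumption+, simp only: brackets[OF p] frechet_moving_frame[OF p],
      rule flat_frame_integrability[OF U p smooth_frame(2,3) smooth_moving_frame smooth_conn(2,3) lie_moving_frame(2,3) _ invertible_moving_frame[OF p]],
      assumption+, simp only: brackets[OF p] frechet_moving_frame[OF p])

lemma lie_entry:
  assumes "smooth_on U M" "p \<in> U"
  shows "lie X M p $ i $ j = lie X (\<lambda>q. M q $ i $ j) p"
  using lie_component[OF smooth_on_nth[OF U assms(1)] U assms(2)] lie_component[OF assms(1) U assms(2)] by simp

lemmas lie_entries = vector_minus_component vector_add_component vector_scaleR_component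
  lie_entry[OF smooth_conn(1)] lie_entry[OF smooth_conn(2)] lie_entry[OF smooth_conn(3)] matrix_matrix_mult_def sum_4 vec_lambda_beta

lemmas lie_coeffs = lie_add[OF _ _ U] lie_diff[OF _ _ U] lie_minus[OF _ U] lie_const smooth_coeffs smooth_on_minus[OF U]
  MT_def MV_def MW_def

section \<open>Codazzi and Gauss equations\<close>

text \<open>Passing from an entry of the flatness identity to the transposed one changes the
  relative sign between the Levi-Civita terms and the terms linear in \<open>a\<close>. Comparing
  transposed entries thus isolates multiples of \<open>a p\<close>, which is positive and can be
  cancelled.\<close>

lemma codazzi_TV:
  assumes p: "p \<in> U"
  shows "conn_TV T p = 0" "conn_TW T p = 0" "conn_VW T p = conn_TW V p / 3" "lie T a p = - conn_TV V p * a p"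
proof -
  have e: "(lie T MV p - lie V MT p + MV p ** MT p - MT p ** MV p) $ i $ j
      = (conn_TV T p *\<^sub>R MT p + (- conn_TV V p) *\<^sub>R MV p + (conn_VW T p - conn_TW V p) *\<^sub>R MW p) $ i $ j" for i j
    by (simp only: flatness(1)[OF p])
  note e' = e[simplified lie_entries p]
  have e12: "lie T (conn_TV V) p - lie V (conn_TV T) p - conn_TW V p * conn_VW T p - (conn_TV T p * a p - conn_TW T p * conn_VW V p + 1)
     = conn_TV T p * conn_TV T p - conn_TV V p * conn_TV V p + (conn_VW T p - conn_TW V p) * conn_TV W p"
    using e'[of 1 2] by (simp add: lie_coeffs p)
  have e21: "lie T (conn_TV V) p - lie V (conn_TV T) p + a p * conn_TV T p + conn_VW V p * conn_TW T p - 1 - conn_VW T p * conn_TW V p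
     = conn_TV T p * conn_TV T p - conn_TV V p * conn_TV V p + (conn_VW T p - conn_TW V p) * conn_TV W p"
    using e'[of 2 1] by (simp add: lie_coeffs p)
  have "a p * conn_TV T p = 0" using e12 e21 by (simp only: algebra_simps)
  then show T0: "conn_TV T p = 0" using a_pos[OF p] by simp
  \<comment> \<open>Here \<open>z\<close> stands for the whole product, which is shown to vanish in
    one piece before the positive factor is cancelled.\<close>
  have "a p * conn_TW T p = z \<Longrightarrow> z = 0" for z
    using e'[of 1 3] e'[of 3 1] by (simp add: lie_coeffs p T0 algebra_simps)
  then have "a p * conn_TW T p = 0" by blast
  then show T1: "conn_TW T p = 0" using a_pos[OF p] by simp
  show "lie T a p = - conn_TV V p * a p"
    using e'[of 2 2] by (simp add: lie_coeffs p T0 T1 algebra_simps)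
  have "z = a p * (3 * conn_VW T p - conn_TW V p) \<Longrightarrow> z = 0" for z
    using e'[of 2 3] e'[of 3 2] by (simp add: lie_coeffs p T0 T1 algebra_simps)
  then have "a p * (3 * conn_VW T p - conn_TW V p) = 0" by blast
  then show "conn_VW T p = conn_TW V p / 3" using a_pos[OF p] by simp
qed

text \<open>As a consequence, the covariant derivative of T acts on the plane of V and W as a
  complex multiplication, with V as 1 and W as i. The multiplier is \<mu> = \<alpha>22 + i
  \<alpha>23, which is why the two invariants behave as one complex function.\<close>

lemma codazzi_TW:
  assumes p: "p \<in> U"
  shows "conn_TV W p = - conn_TW V p" "conn_TW W p = conn_TV V p"
proof -
  have e: "(lie T MW p - lie W MT p + MW p ** MT p - MT p ** MW p) $ i $ j
      = (conn_TW T p *\<^sub>R MT p + (- conn_VW T p - conn_TV W p) *\<^sub>R MV p + (- conn_TW W p) *\<^sub>R MW p) $ i $ j" for i j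
    by (simp only: flatness(2)[OF p])
  note e' = e[simplified lie_entries p]
  have "a p * (conn_TV W p + conn_TW V p) = 0"
    using e'[of 2 2] by (simp add: lie_coeffs p codazzi_TV[OF p] field_simps)
  then show "conn_TV W p = - conn_TW V p" using a_pos[OF p] by simp
  have "z = a p * (conn_TW W p - conn_TV V p) \<Longrightarrow> z = 0" for z
    using e'[of 2 3] e'[of 3 2] by (simp add: lie_coeffs p codazzi_TV[OF p] field_simps)
  then have "a p * (conn_TW W p - conn_TV V p) = 0" by blast
  then show "conn_TW W p = conn_TV V p" using a_pos[OF p] by simp
qed

lemma lie_codazzi:
  assumes p: "p \<in> U"
  shows "lie X (conn_TV T) p = 0" "lie X (conn_TW T) p = 0" "lie X (conn_TV W) p = - lie X (conn_TW V) p" "lie X (conn_TW W) p = lie X (conn_TV V) p"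
  using lie_cong_open[OF U p, of "conn_TV T" "\<lambda>q. 0" X] lie_cong_open[OF U p, of "conn_TW T" "\<lambda>q. 0" X]
    lie_cong_open[OF U p, of "conn_TV W" "\<lambda>q. - conn_TW V q" X] lie_cong_open[OF U p, of "conn_TW W" "conn_TV V" X]
  by (simp_all add: codazzi_TV codazzi_TW lie_coeffs p)

text \<open>Gauss equations of the planes containing T. The constant 1 comes from the \<xi>
  components, as the product of h(T, T) = -1 with the factor -1 in the derivative of \<xi>. Read for
  \<mu>, this is a Riccati equation solved by tanh.\<close>

lemma lie_T_coeffs:
  assumes p: "p \<in> U"
  shows "lie T (conn_TV V) p = 1 - (conn_TV V p)\<^sup>2 + (conn_TW V p)\<^sup>2" "lie T (conn_TW V) p = - 2 * conn_TV V p * conn_TW V p"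
proof -
  have e: "(lie T MV p - lie V MT p + MV p ** MT p - MT p ** MV p) $ i $ j
      = (conn_TV T p *\<^sub>R MT p + (- conn_TV V p) *\<^sub>R MV p + (conn_VW T p - conn_TW V p) *\<^sub>R MW p) $ i $ j" for i j
    by (simp only: flatness(1)[OF p])
  note e' = e[simplified lie_entries p]
  show "lie T (conn_TV V) p = 1 - (conn_TV V p)\<^sup>2 + (conn_TW V p)\<^sup>2"
    using e'[of 1 2] by (simp add: lie_coeffs p codazzi_TV[OF p] codazzi_TW[OF p] lie_codazzi[OF p] power2_eq_square field_simps)
  show "lie T (conn_TW V) p = - 2 * conn_TV V p * conn_TW V p"
    using e'[of 1 3] by (simp add: lie_coeffs p codazzi_TV[OF p] codazzi_TW[OF p] lie_codazzi[OF p] field_simps)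
qed

text \<open>The factor 3 is the rotational weight of the cubic form with coefficient
  \<open>a\<close>. The next two equations are Cauchy-Riemann equations for \<mu>, and the last is
  the Gauss equation of the plane of V and W: 2 a^2 is the commutator of K(V, .) and K(W, .), and
  5/3 = 1 + 2/3, where 2/3 is the T component 2 \<alpha>23 of [V, W] times \<open>conn_VW T\<close>
  = \<alpha>23 / 3.\<close>

lemma codazzi_gauss_VW:
  assumes p: "p \<in> U"
  shows "lie W a p = 3 * a p * conn_VW V p" "lie V a p = - 3 * a p * conn_VW W p"
    "lie W (conn_TV V) p = - lie V (conn_TW V) p" "lie W (conn_TW V) p = lie V (conn_TV V) p"
    "lie V (conn_VW W) p - lie W (conn_VW V) p
      = (conn_TV V p)\<^sup>2 + 5 / 3 * (conn_TW V p)\<^sup>2 - (conn_VW V p)\<^sup>2 - (conn_VW W p)\<^sup>2 - 1 - 2 * (a p)\<^sup>2"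
proof -
  have e: "(lie V MW p - lie W MV p + MW p ** MV p - MV p ** MW p) $ i $ j
      = ((conn_TW V p - conn_TV W p) *\<^sub>R MT p + (- conn_VW V p) *\<^sub>R MV p + (- conn_VW W p) *\<^sub>R MW p) $ i $ j" for i j
    by (simp only: flatness(3)[OF p])
  note e' = e[simplified lie_entries p]
  note s = lie_coeffs p codazzi_TV[OF p] codazzi_TW[OF p] lie_codazzi[OF p]
  show "lie W a p = 3 * a p * conn_VW V p"
    using e'[of 2 2] by (simp add: s algebra_simps)
  show Va: "lie V a p = - 3 * a p * conn_VW W p"
    using e'[of 2 3] e'[of 3 2] by (simp add: s algebra_simps)
  show "lie W (conn_TV V) p = - lie V (conn_TW V) p"
    using e'[of 1 2] e'[of 2 1] by (simp add: s algebra_simps)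
  show "lie W (conn_TW V) p = lie V (conn_TV V) p"
    using e'[of 1 3] e'[of 3 1] by (simp add: s algebra_simps)
  show "lie V (conn_VW W) p - lie W (conn_VW V) p
      = (conn_TV V p)\<^sup>2 + 5 / 3 * (conn_TW V p)\<^sup>2 - (conn_VW V p)\<^sup>2 - (conn_VW W p)\<^sup>2 - 1 - 2 * (a p)\<^sup>2"
    using e'[of 2 3] by (simp add: s Va power2_eq_square field_simps)
qed

end

section \<open>Isothermal potentials\<close>

text \<open>Division by \<open>m p\<close> moves the value at the base point to 1, away from the
  branch cut of \<open>Ln\<close>; on the preimage of the right half-plane the principal branch is
  smooth.\<close>

lemma smooth_log_branch:
  fixes m :: "'a::real_normed_vector \<Rightarrow> complex"
  assumes "open U" "p \<in> U" "smooth_on U m" "m p \<noteq> 0"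
  obtains N L where "open N" "p \<in> N" "N \<subseteq> U" "smooth_on N L" "\<And>x. x \<in> N \<Longrightarrow> exp (L x) = m x"
proof -
  define N where "N = {x \<in> U. 0 < Re (m x / m p)}"
  define L where "L x = Ln (m x / m p) + Ln (m p)" for x
  have "continuous_on U m"
    using has_derivative_continuous[OF smooth_on_has_derivative[OF assms(3,1)]]
    by (intro continuous_at_imp_continuous_on) blast
  then have "continuous_on U (\<lambda>x. Re (m x / m p))"
    using assms(4) by (intro continuous_intros) auto
  then have "open N"
    using continuous_open_preimage[of U "\<lambda>x. Re (m x / m p)" "{0<..}"] assms(1)
    by (auto simp: N_def vimage_def Int_def)
  moreover have "p \<in> N" using assms(2,4) by (simp add: N_def)
  moreover have "N \<subseteq> U" by (auto simp: N_def)
  moreover have "smooth_on N L"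
  proof -
    have "smooth_on N (\<lambda>x. inverse (m p) * m x)"
      by (intro smooth_on_mult smooth_on_const smooth_on_subset[OF assms(3)] \<open>open N\<close> \<open>N \<subseteq> U\<close>)
    then have *: "smooth_on N (\<lambda>x. m x / m p)" by (simp add: divide_inverse mult.commute)
    have "smooth_on N (\<lambda>x. Ln (m x / m p))"
      by (rule smooth_on_Ln[OF \<open>open N\<close> *]) (auto simp: N_def complex_nonpos_Reals_iff)
    then show ?thesis
      unfolding L_def by (intro smooth_on_add smooth_on_const \<open>open N\<close>)
  qed
  moreover have "exp (L x) = m x" if "x \<in> N" for x
  proof -
    have "m x / m p \<noteq> 0" using that by (auto simp: N_def)
    then show ?thesis using assms(4) by (simp add: L_def exp_add)
  qed
  ultimately show thesis by (rule that)
qed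

text \<open>With \<zeta> = t - i \<eta>, S = \<kappa> + i \<theta> and \<mu> = \<alpha> + i \<beta>,
  half the sum and half the difference of the hypotheses say exp S = cosh \<zeta> and \<mu> exp S =
  sinh \<zeta>. Moreover c is the squared modulus of cosh \<zeta>.\<close>

lemma tanh_real_imaginary_parts:
  fixes t \<eta> \<kappa> \<theta> \<alpha> \<beta> :: real
  assumes "exp (Complex t (- \<eta>) - Complex \<kappa> \<theta>) = 1 + Complex \<alpha> \<beta>"
    and "exp (- Complex t (- \<eta>) - Complex \<kappa> \<theta>) = 1 - Complex \<alpha> \<beta>"
  defines "c \<equiv> (cos \<eta>)\<^sup>2 + (sinh t)\<^sup>2"
  shows "c = exp (2 * \<kappa>)" "c * \<alpha> = sinh t * cosh t" "c * \<beta> = - (sin \<eta> * cos \<eta>)"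
proof -
  define x where "x = Re (exp (Complex \<kappa> \<theta>))"
  define y where "y = Im (exp (Complex \<kappa> \<theta>))"
  have xy: "x\<^sup>2 + y\<^sup>2 = exp (2 * \<kappa>)"
  proof -
    have "x\<^sup>2 + y\<^sup>2 = (exp \<kappa>)\<^sup>2 * ((cos \<theta>)\<^sup>2 + (sin \<theta>)\<^sup>2)"
      by (simp only: x_def y_def Re_exp Im_exp complex.sel power_mult_distrib distrib_left)
    then show ?thesis by (simp add: exp_double)
  qed
  have e1: "exp (Complex t (- \<eta>)) = (1 + Complex \<alpha> \<beta>) * Complex x y"
    using assms(1) by (simp add: x_def y_def exp_diff field_simps)
  have e2: "exp (- Complex t (- \<eta>)) = (1 - Complex \<alpha> \<beta>) * Complex x y"
    using assms(2) by (simp add: x_def y_def exp_diff field_simps)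
  have r1: "exp t * cos \<eta> = (1 + \<alpha>) * x - \<beta> * y" and i1: "- (exp t * sin \<eta>) = (1 + \<alpha>) * y + \<beta> * x"
    using arg_cong[OF e1, of Re] arg_cong[OF e1, of Im] by (simp_all add: Re_exp Im_exp)
  have r2: "exp (- t) * cos \<eta> = (1 - \<alpha>) * x + \<beta> * y" and i2: "exp (- t) * sin \<eta> = (1 - \<alpha>) * y - \<beta> * x"
    using arg_cong[OF e2, of Re] arg_cong[OF e2, of Im] by (simp_all add: Re_exp Im_exp)
  have x: "x = cosh t * cos \<eta>" and y: "y = - (sinh t * sin \<eta>)"
    and x': "\<alpha> * x - \<beta> * y = sinh t * cos \<eta>" and y': "\<alpha> * y + \<beta> * x = - (cosh t * sin \<eta>)"
    using r1 r2 i1 i2 by (simp_all add: cosh_field_def sinh_field_def field_simps)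
  have ch: "(cosh t)\<^sup>2 = 1 + (sinh t)\<^sup>2" using cosh_square_eq[of t] by simp
  have sn: "(sin \<eta>)\<^sup>2 = 1 - (cos \<eta>)\<^sup>2" by (simp add: sin_squared_eq)
  have cxy: "c = x\<^sup>2 + y\<^sup>2"
    by (simp add: c_def x y power_mult_distrib ch sn algebra_simps)
  then show "c = exp (2 * \<kappa>)" using xy by simp
  \<comment> \<open>Real part of c \<mu>, the product of sinh \<zeta> with the conjugate of cosh
    \<zeta>; the imaginary part follows below.\<close>
  have "c * \<alpha> = x * (\<alpha> * x - \<beta> * y) + y * (\<alpha> * y + \<beta> * x)"
    by (simp add: cxy power2_eq_square algebra_simps)
  also have "\<dots> = sinh t * cosh t * ((cos \<eta>)\<^sup>2 + (sin \<eta>)\<^sup>2)"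
    unfolding x' y' unfolding x y by algebra
  finally show "c * \<alpha> = sinh t * cosh t" by simp
  have "c * \<beta> = x * (\<alpha> * y + \<beta> * x) - y * (\<alpha> * x - \<beta> * y)"
    by (simp add: cxy power2_eq_square algebra_simps)
  also have "\<dots> = - (sin \<eta> * cos \<eta>) * ((cosh t)\<^sup>2 - (sinh t)\<^sup>2)"
    unfolding x' y' unfolding x y by algebra
  finally show "c * \<beta> = - (sin \<eta> * cos \<eta>)" by (simp add: ch)
qed

lemma smooth_Complex:
  assumes "open U" "smooth_on U f" "smooth_on U g"
  shows "smooth_on U (\<lambda>x. Complex (f x) (g x))"
  unfolding Complex_eq
  by (intro smooth_on_add smooth_on_mult smooth_on_const smooth_on_linear[OF bounded_linear_of_real] assms)

lemma lie_Complex: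
  assumes "open U" "p \<in> U" "smooth_on U f" "smooth_on U g"
  shows "lie X (\<lambda>x. Complex (f x) (g x)) p = Complex (lie X f p) (lie X g p)"
proof -
  note s = smooth_Complex[OF assms(1,3,4)]
  show ?thesis
    using lie_linear_comp[OF bounded_linear_Re s assms(1,2), of X] lie_linear_comp[OF bounded_linear_Im s assms(1,2), of X]
    by (simp add: complex_eq_iff)
qed

text \<open>Writing \<open>\<mu> = \<alpha> + i \<beta>\<close>, the functions below are \<open>t - i \<eta> = artanh \<mu>\<close> and
  \<open>\<kappa> + i \<theta> = log (cosh (t - i \<eta>))\<close>, built from logarithms of \<open>1 + \<mu>\<close> and \<open>1 - \<mu>\<close>.\<close>

lemma artanh_coordinates:
  fixes \<alpha> \<beta> :: "'a::real_normed_vector \<Rightarrow> real"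
  assumes U: "open U" "p \<in> U" and sm: "smooth_on U \<alpha>" "smooth_on U \<beta>"
    and ne: "(\<alpha> p, \<beta> p) \<noteq> (1, 0)" "(\<alpha> p, \<beta> p) \<noteq> (- 1, 0)"
  obtains N t \<eta> \<kappa> \<theta> where "open N" "p \<in> N" "N \<subseteq> U"
    "smooth_on N t" "smooth_on N \<eta>" "smooth_on N \<kappa>" "smooth_on N \<theta>"
    "\<And>x. x \<in> N \<Longrightarrow> (cos (\<eta> x))\<^sup>2 + (sinh (t x))\<^sup>2 = exp (2 * \<kappa> x)"
    "\<And>x. x \<in> N \<Longrightarrow> exp (2 * \<kappa> x) * \<alpha> x = sinh (t x) * cosh (t x)"
    "\<And>x. x \<in> N \<Longrightarrow> exp (2 * \<kappa> x) * \<beta> x = - (sin (\<eta> x) * cos (\<eta> x))"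
    "\<And>x. x \<in> N \<Longrightarrow> 1 - (Complex (\<alpha> x) (\<beta> x))\<^sup>2 \<noteq> 0"
    "\<And>X x. x \<in> N \<Longrightarrow> Complex (lie X t x) (- lie X \<eta> x) * (1 - (Complex (\<alpha> x) (\<beta> x))\<^sup>2) = Complex (lie X \<alpha> x) (lie X \<beta> x)"
    "\<And>X x. x \<in> N \<Longrightarrow> Complex (lie X \<kappa> x) (lie X \<theta> x) = Complex (\<alpha> x) (\<beta> x) * Complex (lie X t x) (- lie X \<eta> x)"
proof -
  define \<mu> where "\<mu> x = Complex (\<alpha> x) (\<beta> x)" for x
  have s\<mu>: "smooth_on U \<mu>" unfolding \<mu>_def by (rule smooth_Complex[OF U(1) sm])
  have s1: "smooth_on U (\<lambda>x. 1 + \<mu> x)" "smooth_on U (\<lambda>x. 1 - \<mu> x)"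
    by (intro smooth_on_add smooth_on_diff smooth_on_const s\<mu> U)+
  have ne': "1 + \<mu> p \<noteq> 0" "1 - \<mu> p \<noteq> 0"
    using ne by (auto simp: \<mu>_def complex_eq_iff)
  obtain N1 L1 where L1: "open N1" "p \<in> N1" "N1 \<subseteq> U" "smooth_on N1 L1" "\<And>x. x \<in> N1 \<Longrightarrow> exp (L1 x) = 1 + \<mu> x"
    using smooth_log_branch[OF U s1(1) ne'(1)] by blast
  obtain N2 L2 where L2: "open N2" "p \<in> N2" "N2 \<subseteq> U" "smooth_on N2 L2" "\<And>x. x \<in> N2 \<Longrightarrow> exp (L2 x) = 1 - \<mu> x"
    using smooth_log_branch[OF U s1(2) ne'(2)] by blast
  define N where "N = N1 \<inter> N2"
  have N: "open N" "p \<in> N" "N \<subseteq> U" "N \<subseteq> N1" "N \<subseteq> N2" using L1 L2 by (auto simp: N_def)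
  have sL: "smooth_on N L1" "smooth_on N L2" "smooth_on N \<mu>"
    using smooth_on_subset L1(4) L2(4) s\<mu> N by blast+
  have eL: "exp (L1 x) = 1 + \<mu> x" "exp (L2 x) = 1 - \<mu> x" if "x \<in> N" for x
    using L1(5) L2(5) N that by blast+
  define \<zeta> where "\<zeta> x = (1/2) * (L1 x - L2 x)" for x
  \<comment> \<open>From 1 - tanh^2 = 1 / cosh^2, the logarithm of cosh is minus half the logarithm
    of 1 - \<mu>^2.\<close>
  define S where "S x = - (1/2) * (L1 x + L2 x)" for x
  have s\<zeta>: "smooth_on N \<zeta>" and sS: "smooth_on N S"
    unfolding \<zeta>_def S_def by (intro smooth_on_mult smooth_on_add smooth_on_diff smooth_on_const sL N)+
  have lie1: "(1 + \<mu> x) * lie X L1 x = lie X \<mu> x" and lie2: "(1 - \<mu> x) * lie X L2 x = - lie X \<mu> x" if "x \<in> N" for X x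
  proof -
    have "lie X (\<lambda>x. exp (L1 x)) x = lie X (\<lambda>x. 1 + \<mu> x) x" by (rule lie_cong_open[OF N(1) that eL(1)])
    then show "(1 + \<mu> x) * lie X L1 x = lie X \<mu> x"
      using lie_exp[OF sL(1) N(1) that, of X] eL(1)[OF that] lie_add[OF smooth_on_const[OF N(1)] sL(3) N(1) that, of X 1] by simp
    have "lie X (\<lambda>x. exp (L2 x)) x = lie X (\<lambda>x. 1 - \<mu> x) x" by (rule lie_cong_open[OF N(1) that eL(2)])
    then show "(1 - \<mu> x) * lie X L2 x = - lie X \<mu> x"
      using lie_exp[OF sL(2) N(1) that, of X] eL(2)[OF that] lie_diff[OF smooth_on_const[OF N(1)] sL(3) N(1) that, of X 1] by simp
  qed
  have lie\<zeta>: "lie X \<zeta> x = (1/2) * (lie X L1 x - lie X L2 x)" and lieS: "lie X S x = - (1/2) * (lie X L1 x + lie X L2 x)"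
    if "x \<in> N" for X x
    unfolding \<zeta>_def S_def
    by (subst lie_mult[OF smooth_on_const[OF N(1)] smooth_on_diff[OF N(1) sL(1,2)] N(1) that],
        simp only: lie_const lie_diff[OF sL(1,2) N(1) that] mult_zero_left add_0_right,
        subst lie_mult[OF smooth_on_const[OF N(1)] smooth_on_add[OF N(1) sL(1,2)] N(1) that],
        simp only: lie_const lie_add[OF sL(1,2) N(1) that] mult_zero_left add_0_right)
  have nz: "1 + \<mu> x \<noteq> 0" "1 - \<mu> x \<noteq> 0" if "x \<in> N" for x
    using eL[OF that] by (metis exp_not_eq_zero)+
  have d1: "lie X \<zeta> x * (1 - (\<mu> x)\<^sup>2) = lie X \<mu> x" if "x \<in> N" for X x
  proof -
    have "lie X \<zeta> x * (1 - (\<mu> x)\<^sup>2) = (1/2) * ((1 - \<mu> x) * ((1 + \<mu> x) * lie X L1 x) - (1 + \<mu> x) * ((1 - \<mu> x) * lie X L2 x))"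
      unfolding lie\<zeta>[OF that] by (simp add: power2_eq_square field_simps)
    then show ?thesis unfolding lie1[OF that] lie2[OF that] by (simp add: algebra_simps)
  qed
  have d2: "lie X S x = \<mu> x * lie X \<zeta> x" if "x \<in> N" for X x
  proof -
    have nz2: "1 - (\<mu> x)\<^sup>2 \<noteq> 0" using nz[OF that] by (simp add: power2_eq_1_iff) (metis add.right_inverse diff_self)
    have "lie X S x * (1 - (\<mu> x)\<^sup>2) = - (1/2) * ((1 - \<mu> x) * ((1 + \<mu> x) * lie X L1 x) + (1 + \<mu> x) * ((1 - \<mu> x) * lie X L2 x))"
      unfolding lieS[OF that] by (simp add: power2_eq_square field_simps)
    also have "\<dots> = \<mu> x * lie X \<mu> x" unfolding lie1[OF that] lie2[OF that] by (simp add: algebra_simps)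
    also have "\<dots> = \<mu> x * lie X \<zeta> x * (1 - (\<mu> x)\<^sup>2)" using d1[OF that, of X] by simp
    finally show ?thesis using nz2 by simp
  qed
  define t where "t x = Re (\<zeta> x)" for x
  define \<eta> where "\<eta> x = - Im (\<zeta> x)" for x
  define \<kappa> where "\<kappa> x = Re (S x)" for x
  define \<theta> where "\<theta> x = Im (S x)" for x
  have st: "smooth_on N t" and s\<eta>: "smooth_on N \<eta>" and s\<kappa>: "smooth_on N \<kappa>" and s\<theta>: "smooth_on N \<theta>"
    unfolding t_def \<eta>_def \<kappa>_def \<theta>_def
    by (intro smooth_on_minus smooth_on_linear[OF bounded_linear_Re] smooth_on_linear[OF bounded_linear_Im] s\<zeta> sS N)+
  have \<zeta>: "\<zeta> x = Complex (t x) (- \<eta> x)" and S: "S x = Complex (\<kappa> x) (\<theta> x)" for x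
    by (simp_all add: complex_eq_iff t_def \<eta>_def \<kappa>_def \<theta>_def)
  have lie\<zeta>': "lie X \<zeta> x = Complex (lie X t x) (- lie X \<eta> x)" and lieS': "lie X S x = Complex (lie X \<kappa> x) (lie X \<theta> x)" if "x \<in> N" for X x
    unfolding \<zeta> S lie_Complex[OF N(1) that st smooth_on_minus[OF N(1) s\<eta>]] lie_Complex[OF N(1) that s\<kappa> s\<theta>]
    by (simp_all add: lie_minus[OF s\<eta> N(1) that])
  have val: "exp (Complex (t x) (- \<eta> x) - Complex (\<kappa> x) (\<theta> x)) = 1 + Complex (\<alpha> x) (\<beta> x)"
    "exp (- Complex (t x) (- \<eta> x) - Complex (\<kappa> x) (\<theta> x)) = 1 - Complex (\<alpha> x) (\<beta> x)" if "x \<in> N" for x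
  proof -
    have "\<zeta> x - S x = L1 x" "- \<zeta> x - S x = L2 x" by (simp_all add: \<zeta>_def S_def field_simps)
    then show "exp (Complex (t x) (- \<eta> x) - Complex (\<kappa> x) (\<theta> x)) = 1 + Complex (\<alpha> x) (\<beta> x)"
      "exp (- Complex (t x) (- \<eta> x) - Complex (\<kappa> x) (\<theta> x)) = 1 - Complex (\<alpha> x) (\<beta> x)"
      using eL[OF that] by (simp_all only: \<zeta> S \<mu>_def)
  qed
  show thesis
  proof (rule that[OF N(1-3) st s\<eta> s\<kappa> s\<theta>])
    fix x assume x: "x \<in> N"
    note v = tanh_real_imaginary_parts[OF val[OF x]]
    show "(cos (\<eta> x))\<^sup>2 + (sinh (t x))\<^sup>2 = exp (2 * \<kappa> x)" by (rule v)
    show "exp (2 * \<kappa> x) * \<alpha> x = sinh (t x) * cosh (t x)" "exp (2 * \<kappa> x) * \<beta> x = - (sin (\<eta> x) * cos (\<eta> x))"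
      using v by simp_all
    have "1 - (\<mu> x)\<^sup>2 = (1 + \<mu> x) * (1 - \<mu> x)" by (simp add: power2_eq_square algebra_simps)
    then show "1 - (Complex (\<alpha> x) (\<beta> x))\<^sup>2 \<noteq> 0" using nz[OF x] by (simp add: \<mu>_def)
    fix X
    show "Complex (lie X t x) (- lie X \<eta> x) * (1 - (Complex (\<alpha> x) (\<beta> x))\<^sup>2) = Complex (lie X \<alpha> x) (lie X \<beta> x)"
      using d1[OF x, of X] lie_Complex[OF N(1) x smooth_on_subset[OF sm(1) N(3)] smooth_on_subset[OF sm(2) N(3)], of X]
      unfolding lie\<zeta>'[OF x] \<mu>_def by simp
    show "Complex (lie X \<kappa> x) (lie X \<theta> x) = Complex (\<alpha> x) (\<beta> x) * Complex (lie X t x) (- lie X \<eta> x)"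
      using d2[OF x, of X] unfolding lie\<zeta>'[OF x] lieS'[OF x] \<mu>_def by simp
  qed
qed

section \<open>Brackets in terms of the invariants\<close>

context S3_hypersphere begin

lemma alpha22_eq: "alpha22 h \<Gamma>h T V p = conn_TV V p" and alpha23_eq: "alpha23 h \<Gamma>h T V W p = conn_TW V p"
  by (simp_all add: alpha22_def alpha23_def nablahat_VT_def conn_TV_def conn_TW_def nabla_hat_def lie_def)

lemma reduced_brackets:
  assumes p: "p \<in> U"
  shows "lie T V p = lie V T p - conn_TV V p *\<^sub>R V p - (2 / 3 * conn_TW V p) *\<^sub>R W p"
    and "lie T W p = lie W T p + (2 / 3 * conn_TW V p) *\<^sub>R V p - conn_TV V p *\<^sub>R W p"
    and "lie V W p = lie W V p + (2 * conn_TW V p) *\<^sub>R T p - conn_VW V p *\<^sub>R V p - conn_VW W p *\<^sub>R W p"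
  using brackets[OF p] by (simp_all add: codazzi_TV[OF p] codazzi_TW[OF p] algebra_simps)

lemma commutators:
  fixes f :: "real^3 \<Rightarrow> real"
  assumes N: "open N" "N \<subseteq> U" "p \<in> N" and f: "smooth_on N f"
  shows "lie T (lie V f) p - lie V (lie T f) p = - conn_TV V p * lie V f p - 2 / 3 * conn_TW V p * lie W f p"
    and "lie T (lie W f) p - lie W (lie T f) p = 2 / 3 * conn_TW V p * lie V f p - conn_TV V p * lie W f p"
    and "lie V (lie W f) p - lie W (lie V f) p = 2 * conn_TW V p * lie T f p - conn_VW V p * lie V f p - conn_VW W p * lie W f p"
proof -
  have p: "p \<in> U" using N by blast
  have lin: "linear (frechet_derivative f (at p))"
    by (rule has_derivative_linear[OF smooth_on_has_derivative[OF f N(1,3)]])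
  note sm = smooth_on_subset[OF smooth_frame(1) N(2)] smooth_on_subset[OF smooth_frame(2) N(2)] smooth_on_subset[OF smooth_frame(3) N(2)]
  note simps = reduced_brackets[OF p] lie_def[of _ f] linear_add[OF lin] linear_diff[OF lin] linear_scale[OF lin] linear_neg[OF lin]
  show "lie T (lie V f) p - lie V (lie T f) p = - conn_TV V p * lie V f p - 2 / 3 * conn_TW V p * lie W f p"
    unfolding lie_commutator[OF N(1) f sm(1,2) N(3)] by (simp add: simps)
  show "lie T (lie W f) p - lie W (lie T f) p = 2 / 3 * conn_TW V p * lie V f p - conn_TV V p * lie W f p"
    unfolding lie_commutator[OF N(1) f sm(1,3) N(3)] by (simp add: simps)
  show "lie V (lie W f) p - lie W (lie V f) p = 2 * conn_TW V p * lie T f p - conn_VW V p * lie V f p - conn_VW W p * lie W f p"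
    unfolding lie_commutator[OF N(1) f sm(2,3) N(3)] by (simp add: simps)
qed

end

section \<open>The rescaled frame\<close>

text \<open>For \<zeta> = t - i \<eta> and S = \<kappa> + i \<theta> the assumptions read T \<zeta>
  = 1 and T S = \<mu>, while V + i W annihilates both \<zeta> and S.\<close>

locale S3_potentials = S3_hypersphere +
  fixes N :: "(real^3) set" and t \<eta> \<kappa> \<theta> :: "real^3 \<Rightarrow> real"
  assumes N: "open N" "N \<subseteq> U"
    and smooth_potentials: "smooth_on N t" "smooth_on N \<eta>" "smooth_on N \<kappa>" "smooth_on N \<theta>"
    and lie_T_potentials: "x \<in> N \<Longrightarrow> lie T t x = 1" "x \<in> N \<Longrightarrow> lie T \<eta> x = 0"
      "x \<in> N \<Longrightarrow> lie T \<kappa> x = conn_TV V x" "x \<in> N \<Longrightarrow> lie T \<theta> x = conn_TW V x"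
    and lie_W_potentials: "x \<in> N \<Longrightarrow> lie W t x = lie V \<eta> x" "x \<in> N \<Longrightarrow> lie W \<eta> x = - lie V t x"
      "x \<in> N \<Longrightarrow> lie W \<kappa> x = - lie V \<theta> x" "x \<in> N \<Longrightarrow> lie W \<theta> x = lie V \<kappa> x"
begin

lemma NU: "x \<in> N \<Longrightarrow> x \<in> U" using N by blast

definition "l x = ln (a x)"
definition "k x = l x + \<kappa> x"
text \<open>\<open>F = a powr (-1/3) * (cosh (t - i \<eta>)) powr (2/3)\<close> is the factor for which
  \<open>F * (V - i W)\<close>, that is the pair \<open>A\<close>, \<open>-B\<close>, commutes modulo \<open>T\<close>.\<close>

definition "F x = exp (Complex (- (1/3) * l x + 2/3 * \<kappa> x) (2/3 * \<theta> x))"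
definition "F1 x = Re (F x)"
definition "F2 x = Im (F x)"
definition "A x = F1 x *\<^sub>R V x + F2 x *\<^sub>R W x"
definition "B x = (- F2 x) *\<^sub>R V x + F1 x *\<^sub>R W x"

lemmas smooth_frame_N = smooth_on_subset[OF smooth_frame(1) N(2)] smooth_on_subset[OF smooth_frame(2) N(2)]
  smooth_on_subset[OF smooth_frame(3) N(2)]

lemma smooth_l: "smooth_on N l"
  unfolding l_def by (intro smooth_on_ln N smooth_on_subset[OF smooth_coeffs(1)] a_pos NU)

lemma lie_l:
  assumes x: "x \<in> N"
  shows "lie X l x = lie X a x / a x"
proof -
  have "(l has_derivative (\<lambda>v. frechet_derivative a (at x) v * inverse (a x))) (at x)"
    unfolding l_def
    using has_derivative_compose[OF smooth_on_has_derivative[OF smooth_coeffs(1) U NU[OF x]]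
        DERIV_ln[OF a_pos[OF NU[OF x]], unfolded has_field_derivative_def]] by (simp add: mult.commute)
  from lie_eqI[OF this, of X] show ?thesis by (simp add: lie_def divide_inverse)
qed

lemma lie_frame_l:
  assumes x: "x \<in> N"
  shows "lie T l x = - conn_TV V x" "lie V l x = - 3 * conn_VW W x" "lie W l x = 3 * conn_VW V x"
  using codazzi_TV(4)[OF NU[OF x]] codazzi_gauss_VW(1,2)[OF NU[OF x]] a_pos[OF NU[OF x]] by (simp_all add: lie_l[OF x])

lemma smooth_F: "smooth_on N F" "smooth_on N F1" "smooth_on N F2"
proof -
  show F: "smooth_on N F"
    unfolding F_def by (intro smooth_on_exp smooth_Complex smooth_on_add smooth_on_mult smooth_on_const N smooth_l smooth_potentials)
  show "smooth_on N F1" "smooth_on N F2"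
    unfolding F1_def F2_def by (rule smooth_on_linear[OF bounded_linear_Re N(1) F] smooth_on_linear[OF bounded_linear_Im N(1) F])+
qed

lemma lie_F:
  assumes x: "x \<in> N"
  shows "lie X F1 x = F1 x * (- (1/3) * lie X l x + 2/3 * lie X \<kappa> x) - F2 x * (2/3 * lie X \<theta> x)"
    and "lie X F2 x = F1 x * (2/3 * lie X \<theta> x) + F2 x * (- (1/3) * lie X l x + 2/3 * lie X \<kappa> x)"
proof -
  have s: "smooth_on N (\<lambda>x. - (1/3) * l x + 2/3 * \<kappa> x)" "smooth_on N (\<lambda>x. 2/3 * \<theta> x)"
    by (intro smooth_on_add smooth_on_mult smooth_on_const N smooth_l smooth_potentials)+
  have sc: "smooth_on N (\<lambda>x. c * f x)" "lie X (\<lambda>x. c * f x) x = c * lie X f x" if "smooth_on N f" for c :: real and f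
    using lie_mult[OF smooth_on_const[OF N(1)] that N(1) x] smooth_on_mult[OF N(1) smooth_on_const[OF N(1)] that] by simp_all
  have "lie X F x = F x * Complex (- (1/3) * lie X l x + 2/3 * lie X \<kappa> x) (2/3 * lie X \<theta> x)"
    unfolding F_def lie_exp[OF smooth_Complex[OF N(1) s] N(1) x] lie_Complex[OF N(1) x s]
      lie_add[OF sc(1)[OF smooth_l] sc(1)[OF smooth_potentials(3)] N(1) x]
      sc(2)[OF smooth_l] sc(2)[OF smooth_potentials(3)] sc(2)[OF smooth_potentials(4)] by simp
  moreover have "lie X F1 x = Re (lie X F x)" "lie X F2 x = Im (lie X F x)"
    unfolding F1_def F2_def
    by (rule lie_linear_comp[OF bounded_linear_Re smooth_F(1) N(1) x] lie_linear_comp[OF bounded_linear_Im smooth_F(1) N(1) x])+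
  ultimately show "lie X F1 x = F1 x * (- (1/3) * lie X l x + 2/3 * lie X \<kappa> x) - F2 x * (2/3 * lie X \<theta> x)"
    "lie X F2 x = F1 x * (2/3 * lie X \<theta> x) + F2 x * (- (1/3) * lie X l x + 2/3 * lie X \<kappa> x)"
    by (simp_all add: F1_def F2_def)
qed

text \<open>This is the conformal factor of the Laplacian. The splitting separates exp (-(2/3) k),
  which is constant along T and survives in the differential equations, from exp (2 \<kappa>), which
  will cancel the denominators of the invariants.\<close>

lemma F_norm: "(F1 x)\<^sup>2 + (F2 x)\<^sup>2 = exp (- (2/3) * k x) * exp (2 * \<kappa> x)"
proof -
  have "(F1 x)\<^sup>2 + (F2 x)\<^sup>2 = (cmod (F x))\<^sup>2" by (simp add: F1_def F2_def cmod_power2)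
  also have "\<dots> = exp (2 * (- (1/3) * l x + 2/3 * \<kappa> x))" by (simp only: F_def norm_exp_eq_Re complex.sel exp_double)
  also have "\<dots> = exp (- (2/3) * k x + 2 * \<kappa> x)" by (simp add: k_def field_simps)
  finally show ?thesis by (simp only: exp_add)
qed

lemma smooth_AB: "smooth_on N A" "smooth_on N B"
  unfolding A_def B_def
  by (intro smooth_on_add smooth_on_scaleR smooth_on_minus N smooth_F smooth_frame_N)+

lemma lie_AB:
  assumes "smooth_on N f" "x \<in> N"
  shows "lie A f x = F1 x *\<^sub>R lie V f x + F2 x *\<^sub>R lie W f x"
    and "lie B f x = (- F2 x) *\<^sub>R lie V f x + F1 x *\<^sub>R lie W f x"
  using lie_combination[OF assms(1) N(1) assms(2), of F1 V F2 W] lie_combination[OF assms(1) N(1) assms(2), of "\<lambda>x. - F2 x" V F1 W]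
  by (simp_all add: A_def[abs_def] B_def[abs_def])

lemma lie_of_AB:
  assumes x: "x \<in> N"
  shows "lie X A x = F1 x *\<^sub>R lie X V x + lie X F1 x *\<^sub>R V x + (F2 x *\<^sub>R lie X W x + lie X F2 x *\<^sub>R W x)"
    and "lie X B x = - F2 x *\<^sub>R lie X V x - lie X F2 x *\<^sub>R V x + (F1 x *\<^sub>R lie X W x + lie X F1 x *\<^sub>R W x)"
  unfolding A_def[abs_def] B_def[abs_def]
  by (simp_all add: lie_add[OF smooth_on_scaleR[OF N(1) smooth_F(2) smooth_frame_N(2)] smooth_on_scaleR[OF N(1) smooth_F(3) smooth_frame_N(3)] N(1) x]
      lie_diff[OF smooth_on_scaleR[OF N(1) smooth_F(2) smooth_frame_N(3)] smooth_on_scaleR[OF N(1) smooth_F(3) smooth_frame_N(2)] N(1) x]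
      lie_scaleR[OF smooth_F(2) smooth_frame_N(2) N(1) x] lie_scaleR[OF smooth_F(3) smooth_frame_N(2) N(1) x]
      lie_scaleR[OF smooth_F(2) smooth_frame_N(3) N(1) x] lie_scaleR[OF smooth_F(3) smooth_frame_N(3) N(1) x])

text \<open>The brackets of T with V and W require the logarithmic derivative of \<open>F\<close>
  along T to be \<alpha>22 + (2/3) i \<alpha>23. The power 2/3 of cosh contributes (2/3) \<mu>, and
  the power -1/3 of \<open>a\<close> supplies the missing third of \<alpha>22.\<close>

lemma bracket_T_AB:
  assumes x: "x \<in> N"
  shows "lie T A x = lie A T x" "lie T B x = lie B T x"
proof -
  have F: "lie T F1 x = conn_TV V x * F1 x - 2/3 * conn_TW V x * F2 x" "lie T F2 x = conn_TV V x * F2 x + 2/3 * conn_TW V x * F1 x"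
    by (simp_all add: lie_F[OF x] lie_frame_l[OF x] lie_T_potentials[OF x] algebra_simps)
  show "lie T A x = lie A T x" "lie T B x = lie B T x"
    by (simp_all add: lie_of_AB[OF x] lie_AB[OF smooth_frame_N(1) x] reduced_brackets[OF NU[OF x]] F algebra_simps)
qed

text \<open>In these two combinations the derivatives of \<kappa> and \<theta> cancel by the
  Cauchy-Riemann equations. What remains comes from -1/3 times the derivatives of ln a, which carry
  the factor 3.\<close>

lemma lie_AB_F:
  assumes x: "x \<in> N"
  shows "lie A F2 x + lie B F1 x = - ((F1 x)\<^sup>2 + (F2 x)\<^sup>2) * conn_VW V x"
    and "lie A F1 x - lie B F2 x = ((F1 x)\<^sup>2 + (F2 x)\<^sup>2) * conn_VW W x"
  by (simp_all add: lie_AB[OF smooth_F(2) x] lie_AB[OF smooth_F(3) x] lie_F[OF x]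
      lie_AB[OF smooth_l x] lie_AB[OF smooth_potentials(3) x] lie_AB[OF smooth_potentials(4) x] lie_frame_l[OF x] lie_W_potentials[OF x]
      power2_eq_square algebra_simps)

text \<open>The previous identities are exactly what cancels the V and W components of the bracket.
  The T component comes from [V, W] itself and is beyond the reach of a rescaling.\<close>

lemma bracket_AB:
  assumes x: "x \<in> N"
  shows "lie A B x - lie B A x = (2 * conn_TW V x * ((F1 x)\<^sup>2 + (F2 x)\<^sup>2)) *\<^sub>R T x"
proof -
  have "lie A B x - lie B A x = (- (lie A F2 x + lie B F1 x)) *\<^sub>R V x + (lie A F1 x - lie B F2 x) *\<^sub>R W x
      + ((F1 x)\<^sup>2 + (F2 x)\<^sup>2) *\<^sub>R (lie V W x - lie W V x)"
    by (simp add: lie_of_AB[OF x] lie_AB[OF smooth_frame_N(2) x] lie_AB[OF smooth_frame_N(3) x] power2_eq_square algebra_simps)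
  then show ?thesis
    by (simp add: lie_AB_F[OF x] reduced_brackets[OF NU[OF x]] algebra_simps)
qed

text \<open>Conformal covariance in dimension two: the pair A, B is V, W rotated and dilated by
  \<open>F\<close>. The derivatives of \<open>F\<close> enter only through the two combinations just
  computed, so nothing but the factor |F|^2 remains of it.\<close>

lemma laplacian_AB:
  fixes f :: "real^3 \<Rightarrow> real"
  assumes f: "smooth_on N f" and x: "x \<in> N"
  shows "lie A (lie A f) x + lie B (lie B f) x
    = ((F1 x)\<^sup>2 + (F2 x)\<^sup>2) * (lie V (lie V f) x + lie W (lie W f) x + conn_VW W x * lie V f x - conn_VW V x * lie W f x)"
proof -
  note sVf = smooth_on_lie[OF N(1) smooth_frame_N(2) f] and sWf = smooth_on_lie[OF N(1) smooth_frame_N(3) f]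
  note sm = smooth_F smooth_on_mult[OF N(1)] smooth_on_minus[OF N(1)] sVf sWf
  have "lie A (lie A f) x = lie A (\<lambda>x. F1 x * lie V f x + F2 x * lie W f x) x"
    by (rule lie_cong_open[OF N(1) x]) (simp add: lie_AB[OF f])
  also have "\<dots> = F1 x * lie A (lie V f) x + lie A F1 x * lie V f x + (F2 x * lie A (lie W f) x + lie A F2 x * lie W f x)"
    by (simp add: lie_add[OF _ _ N(1) x] lie_mult[OF _ _ N(1) x] sm)
  finally have 1: "lie A (lie A f) x = \<dots>" .
  have "lie B (lie B f) x = lie B (\<lambda>x. F1 x * lie W f x - F2 x * lie V f x) x"
    by (rule lie_cong_open[OF N(1) x]) (simp add: lie_AB[OF f])
  also have "\<dots> = F1 x * lie B (lie W f) x + lie B F1 x * lie W f x - (F2 x * lie B (lie V f) x + lie B F2 x * lie V f x)"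
    by (simp add: lie_diff[OF _ _ N(1) x] lie_mult[OF _ _ N(1) x] sm)
  finally have 2: "lie B (lie B f) x = \<dots>" .
  have "lie A (lie A f) x + lie B (lie B f) x
    = ((F1 x)\<^sup>2 + (F2 x)\<^sup>2) * (lie V (lie V f) x + lie W (lie W f) x)
      + (lie A F1 x - lie B F2 x) * lie V f x + (lie A F2 x + lie B F1 x) * lie W f x"
    unfolding 1 2 lie_AB[OF sVf x] lie_AB[OF sWf x] by (simp add: power2_eq_square algebra_simps)
  then show ?thesis unfolding lie_AB_F[OF x] by (simp add: algebra_simps)
qed

text \<open>T commutes with A and B, so these send functions with constant T derivative to functions
  constant along T. The case of constant 1 is used for t, the case of constant 0 for \<eta> and
  k.\<close>

lemma lie_T_AB_zero:
  fixes f :: "real^3 \<Rightarrow> real"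
  assumes f: "smooth_on N f" and x: "x \<in> N" and T: "\<And>x. x \<in> N \<Longrightarrow> lie T f x = c"
  shows "lie T (lie A f) x = 0" "lie T (lie B f) x = 0"
proof -
  have 0: "lie X (lie T f) x = 0" for X
    using lie_cong_open[OF N(1) x, of "lie T f" "\<lambda>_. c" X] T by simp
  have "frechet_derivative f (at x) 0 = 0"
    by (rule linear_0[OF has_derivative_linear[OF smooth_on_has_derivative[OF f N(1) x]]])
  then show "lie T (lie A f) x = 0" "lie T (lie B f) x = 0"
    using lie_commutator[OF N(1) f smooth_frame_N(1) smooth_AB(1) x] lie_commutator[OF N(1) f smooth_frame_N(1) smooth_AB(2) x]
    by (simp_all add: 0 bracket_T_AB[OF x])
qed

text \<open>The Cauchy-Riemann equations turn the second-order part for \<eta> into [V, W] applied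
  to t, and for \<kappa> into [V, W] applied to \<theta>. The rotation terms cancel and only the T
  components remain, 2 \<alpha>23 and 2 \<alpha>23^2. For ln a the Gauss equation enters; its
  coefficient -5 of \<alpha>23^2 and the 2 from \<kappa> add up to -3.\<close>

lemma laplace_operator_values:
  assumes x: "x \<in> N"
  shows "lie V (lie V \<eta>) x + lie W (lie W \<eta>) x + conn_VW W x * lie V \<eta> x - conn_VW V x * lie W \<eta> x = 2 * conn_TW V x"
    and "lie V (lie V k) x + lie W (lie W k) x + conn_VW W x * lie V k x - conn_VW V x * lie W k x
       = 3 * (1 - (conn_TV V x)\<^sup>2 - (conn_TW V x)\<^sup>2) + 6 * (a x)\<^sup>2"
proof -
  note c = lie_cong_open[OF N(1) x]
  note s = smooth_on_lie[OF N(1) smooth_frame_N(2)] smooth_on_lie[OF N(1) smooth_frame_N(3)]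
  have "lie V (lie V \<eta>) x = lie V (lie W t) x" "lie W (lie W \<eta>) x = - lie W (lie V t) x"
    using c[of "lie V \<eta>" "lie W t" V] c[of "lie W \<eta>" "\<lambda>x. - lie V t x" W] lie_minus[OF s(1)[OF smooth_potentials(1)] N(1) x, of W]
    by (simp_all add: lie_W_potentials)
  then show "lie V (lie V \<eta>) x + lie W (lie W \<eta>) x + conn_VW W x * lie V \<eta> x - conn_VW V x * lie W \<eta> x = 2 * conn_TW V x"
    using commutators(3)[OF N x smooth_potentials(1)] by (simp add: lie_W_potentials[OF x] lie_T_potentials[OF x])
  have "lie V (lie V \<kappa>) x = lie V (lie W \<theta>) x" "lie W (lie W \<kappa>) x = - lie W (lie V \<theta>) x"
    using c[of "lie V \<kappa>" "lie W \<theta>" V] c[of "lie W \<kappa>" "\<lambda>x. - lie V \<theta> x" W] lie_minus[OF s(1)[OF smooth_potentials(4)] N(1) x, of W]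
    by (simp_all add: lie_W_potentials)
  then have 1: "lie V (lie V \<kappa>) x + lie W (lie W \<kappa>) x + conn_VW W x * lie V \<kappa> x - conn_VW V x * lie W \<kappa> x = 2 * (conn_TW V x)\<^sup>2"
    using commutators(3)[OF N x smooth_potentials(4)]
    by (simp add: lie_W_potentials[OF x] lie_T_potentials[OF x] power2_eq_square)
  have sr: "smooth_on N (conn_VW V)" "smooth_on N (conn_VW W)"
    using smooth_on_subset[OF smooth_coeffs(9) N(2)] smooth_on_subset[OF smooth_coeffs(10) N(2)] by auto
  have "lie V (lie V l) x = - 3 * lie V (conn_VW W) x" "lie W (lie W l) x = 3 * lie W (conn_VW V) x"
    using c[of "lie V l" "\<lambda>x. - 3 * conn_VW W x" V] c[of "lie W l" "\<lambda>x. 3 * conn_VW V x" W]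
      lie_mult[OF smooth_on_const[OF N(1)] sr(2) N(1) x, of V "- 3"] lie_mult[OF smooth_on_const[OF N(1)] sr(1) N(1) x, of W 3]
    by (simp_all add: lie_frame_l)
  then have 2: "lie V (lie V l) x + lie W (lie W l) x + conn_VW W x * lie V l x - conn_VW V x * lie W l x
      = 3 + 6 * (a x)\<^sup>2 - 3 * (conn_TV V x)\<^sup>2 - 5 * (conn_TW V x)\<^sup>2"
    using codazzi_gauss_VW(5)[OF NU[OF x]] by (simp add: lie_frame_l[OF x] power2_eq_square algebra_simps)
  have lk: "lie X k y = lie X l y + lie X \<kappa> y" if "y \<in> N" for X y
    unfolding k_def[abs_def] by (rule lie_add[OF smooth_l smooth_potentials(3) N(1) that])
  have "lie X (lie X k) x = lie X (lie X l) x + lie X (lie X \<kappa>) x" if "smooth_on N X" for X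
    using c[of "lie X k" "\<lambda>y. lie X l y + lie X \<kappa> y" X] lk
      lie_add[OF smooth_on_lie[OF N(1) that smooth_l] smooth_on_lie[OF N(1) that smooth_potentials(3)] N(1) x, of X] by simp
  then show "lie V (lie V k) x + lie W (lie W k) x + conn_VW W x * lie V k x - conn_VW V x * lie W k x
       = 3 * (1 - (conn_TV V x)\<^sup>2 - (conn_TW V x)\<^sup>2) + 6 * (a x)\<^sup>2"
    using 1 2 by (simp add: smooth_frame_N lk[OF x] algebra_simps)
qed

text \<open>Removing the component along \<open>T\<close> from \<open>A\<close> and \<open>B\<close> makes \<open>t\<close> a coordinate of the frame.\<close>

definition "u x = lie A t x"
definition "w x = lie B t x"

definition E :: "3 \<Rightarrow> real^3 \<Rightarrow> real^3" where
  "E i = (if i = 1 then T else if i = 2 then (\<lambda>x. A x - u x *\<^sub>R T x) else (\<lambda>x. B x - w x *\<^sub>R T x))"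

lemma E_simps: "E 1 = T" "E 2 = (\<lambda>x. A x - u x *\<^sub>R T x)" "E 3 = (\<lambda>x. B x - w x *\<^sub>R T x)"
  by (simp_all add: E_def)

lemma smooth_uw: "smooth_on N u" "smooth_on N w"
  using smooth_on_lie[OF N(1) smooth_AB(1) smooth_potentials(1)] smooth_on_lie[OF N(1) smooth_AB(2) smooth_potentials(1)]
  by (simp_all add: u_def[abs_def] w_def[abs_def])

lemma smooth_E: "smooth_on N (E i)"
proof -
  have "\<forall>i. smooth_on N (E i)"
    by (simp add: forall_3 E_simps smooth_frame_N smooth_AB smooth_uw smooth_on_diff[OF N(1)] smooth_on_scaleR[OF N(1)])
  then show ?thesis by blast
qed

lemma lie_E:
  assumes "smooth_on N f" "x \<in> N"
  shows "lie (E 1) f x = lie T f x" "lie (E 2) f x = lie A f x - u x *\<^sub>R lie T f x" "lie (E 3) f x = lie B f x - w x *\<^sub>R lie T f x"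
proof -
  have lin: "linear (frechet_derivative f (at x))"
    by (rule has_derivative_linear[OF smooth_on_has_derivative[OF assms(1) N(1) assms(2)]])
  show "lie (E 1) f x = lie T f x" "lie (E 2) f x = lie A f x - u x *\<^sub>R lie T f x" "lie (E 3) f x = lie B f x - w x *\<^sub>R lie T f x"
    by (simp_all add: E_simps lie_def linear_diff[OF lin] linear_scale[OF lin])
qed

text \<open>The bracket [A, B] is a multiple of T, and since T t = 1 the multiple is found by
  applying the bracket to t: it equals A w - B u. This is precisely what the corrections by
  \<open>u\<close> and \<open>w\<close> subtract, because \<open>u\<close> and \<open>w\<close> are
  constant along T.\<close>

lemma E_commute:
  assumes x: "x \<in> N"
  shows "lie (E i) (E j) x = lie (E j) (E i) x"
proof -
  note T0 = lie_T_AB_zero[OF smooth_potentials(1) x lie_T_potentials(1), folded u_def[abs_def] w_def[abs_def]]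
  have lieE: "lie X (E 2) x = lie X A x - (u x *\<^sub>R lie X T x + lie X u x *\<^sub>R T x)"
    "lie X (E 3) x = lie X B x - (w x *\<^sub>R lie X T x + lie X w x *\<^sub>R T x)" for X
    by (simp_all add: E_simps lie_diff[OF smooth_AB(1) smooth_on_scaleR[OF N(1) smooth_uw(1) smooth_frame_N(1)] N(1) x]
        lie_diff[OF smooth_AB(2) smooth_on_scaleR[OF N(1) smooth_uw(2) smooth_frame_N(1)] N(1) x]
        lie_scaleR[OF smooth_uw(1) smooth_frame_N(1) N(1) x] lie_scaleR[OF smooth_uw(2) smooth_frame_N(1) N(1) x])
  note lE = lie_E[OF smooth_frame_N(1) x] lie_E[OF smooth_AB(1) x] lie_E[OF smooth_AB(2) x] lie_E[OF smooth_uw(1) x] lie_E[OF smooth_uw(2) x]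
  have 12: "lie T (E 2) x = lie (E 2) T x" and 13: "lie T (E 3) x = lie (E 3) T x"
    by (simp_all add: lieE lE T0 bracket_T_AB[OF x])
  have lin: "linear (frechet_derivative t (at x))"
    by (rule has_derivative_linear[OF smooth_on_has_derivative[OF smooth_potentials(1) N(1) x]])
  have "lie A w x - lie B u x = 2 * conn_TW V x * ((F1 x)\<^sup>2 + (F2 x)\<^sup>2)"
    unfolding u_def[abs_def] w_def[abs_def] lie_commutator[OF N(1) smooth_potentials(1) smooth_AB x]
      bracket_AB[OF x] linear_scale[OF lin]
    using lie_T_potentials(1)[OF x] by (simp add: lie_def)
  then have AB: "lie A B x - lie B A x = (lie A w x - lie B u x) *\<^sub>R T x"
    by (simp add: bracket_AB[OF x])
  have "lie (E 2) (E 3) x - lie (E 3) (E 2) x = (lie A B x - lie B A x) - (lie A w x - lie B u x) *\<^sub>R T x"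
    by (simp add: lieE lE T0 bracket_T_AB[OF x] algebra_simps)
  then have 23: "lie (E 2) (E 3) x = lie (E 3) (E 2) x" using AB by simp
  have "\<forall>i j. lie (E i) (E j) x = lie (E j) (E i) x"
    unfolding forall_3 using 12 13 23 by (simp add: E_simps(1))
  then show ?thesis by blast
qed

lemma F_norm_pos: "(F1 x)\<^sup>2 + (F2 x)\<^sup>2 > 0"
  unfolding F_norm by simp

lemma span_E:
  assumes x: "x \<in> N"
  shows "span (range (\<lambda>i. E i x)) = UNIV"
proof -
  let ?S = "span (range (\<lambda>i. E i x))" and ?r = "(F1 x)\<^sup>2 + (F2 x)\<^sup>2"
  have E: "E i x \<in> ?S" for i by (intro span_base) auto
  have T: "T x \<in> ?S" using E[of 1] by (simp add: E_simps)
  have A: "A x \<in> ?S" using span_add[OF E[of 2] span_scale[OF T, of "u x"]] by (simp add: E_simps)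
  have B: "B x \<in> ?S" using span_add[OF E[of 3] span_scale[OF T, of "w x"]] by (simp add: E_simps)
  have "?r \<noteq> 0" using F_norm_pos[of x] by linarith
  then have "1 / ?r * ?r = 1" unfolding times_divide_eq_left mult_1 by (rule divide_self)
  then have "V x = (1 / ?r) *\<^sub>R (?r *\<^sub>R V x)" "W x = (1 / ?r) *\<^sub>R (?r *\<^sub>R W x)"
    by (simp_all only: scaleR_scaleR scaleR_one)
  \<comment> \<open>The rotation and dilation that produced A and B, inverted up to its squared norm
    \<open>?r\<close>.\<close>
  moreover have "?r *\<^sub>R V x = F1 x *\<^sub>R A x - F2 x *\<^sub>R B x" "?r *\<^sub>R W x = F2 x *\<^sub>R A x + F1 x *\<^sub>R B x"
    by (simp_all add: A_def B_def power2_eq_square algebra_simps)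
  ultimately have "V x \<in> ?S" "W x \<in> ?S"
    by (metis span_scale span_add span_diff A B)+
  with T have "span {T x, V x, W x} \<subseteq> ?S" by (intro span_minimal subspace_span) auto
  then show ?thesis using span_frame[OF NU[OF x]] by auto
qed

lemma smooth_k: "smooth_on N k"
  unfolding k_def[abs_def] by (intro smooth_on_add N smooth_l smooth_potentials)

lemma lie_T_k: "x \<in> N \<Longrightarrow> lie T k x = 0"
  unfolding k_def[abs_def] using lie_add[OF smooth_l smooth_potentials(3) N(1), of x T]
  by (simp add: lie_frame_l lie_T_potentials)

text \<open>On functions constant along T the corrections in E 2 and E 3 have no effect, and A f and
  B f are again constant along T, so this holds for the second derivatives as well.\<close>

lemma laplacian_E:
  fixes f :: "real^3 \<Rightarrow> real"
  assumes f: "smooth_on N f" and x: "x \<in> N" and T: "\<And>x. x \<in> N \<Longrightarrow> lie T f x = 0"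
  shows "lie (E 2) (lie (E 2) f) x + lie (E 3) (lie (E 3) f) x
    = ((F1 x)\<^sup>2 + (F2 x)\<^sup>2) * (lie V (lie V f) x + lie W (lie W f) x + conn_VW W x * lie V f x - conn_VW V x * lie W f x)"
proof -
  have "lie (E 2) (lie (E 2) f) x = lie (E 2) (lie A f) x" "lie (E 3) (lie (E 3) f) x = lie (E 3) (lie B f) x"
    using lie_cong_open[OF N(1) x, of "lie (E 2) f" "lie A f" "E 2"] lie_cong_open[OF N(1) x, of "lie (E 3) f" "lie B f" "E 3"]
    by (simp_all add: lie_E[OF f] T)
  then show ?thesis
    using laplacian_AB[OF f x] lie_T_AB_zero[OF f x T]
    by (simp add: lie_E[OF smooth_on_lie[OF N(1) smooth_AB(1) f] x] lie_E[OF smooth_on_lie[OF N(1) smooth_AB(2) f] x])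
qed

section \<open>The chart and the two differential equations\<close>

lemma coordinates:
  assumes p: "p \<in> N"
    and val: "\<And>x. x \<in> N \<Longrightarrow> (cos (\<eta> x))\<^sup>2 + (sinh (t x))\<^sup>2 = exp (2 * \<kappa> x)"
      "\<And>x. x \<in> N \<Longrightarrow> exp (2 * \<kappa> x) * conn_TV V x = sinh (t x) * cosh (t x)"
      "\<And>x. x \<in> N \<Longrightarrow> exp (2 * \<kappa> x) * conn_TW V x = - (sin (\<eta> x) * cos (\<eta> x))"
  shows "\<exists>(\<Omega> :: (real^3) set) N (\<psi> :: real^3 \<Rightarrow> real^3) \<psi>i (D :: (real \<times> real) set)
              (\<eta> :: real \<times> real \<Rightarrow> real) (k :: real \<times> real \<Rightarrow> real).
     open \<Omega> \<and> open N \<and> p \<in> N \<and> N \<subseteq> U \<and> \<psi> ` \<Omega> = N \<and>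
     smooth_on \<Omega> \<psi> \<and> smooth_on N \<psi>i \<and> (\<forall>x\<in>\<Omega>. \<psi>i (\<psi> x) = x) \<and>
     open D \<and> smooth_on D \<eta> \<and> smooth_on D k \<and>
     (\<forall>x\<in>\<Omega>. (x$2, x$3) \<in> D \<and>
        (let t = x$1; z = (x$2, x$3); c = (cos (\<eta> z))\<^sup>2 + (sinh t)\<^sup>2 in
          conn_TV V (\<psi> x) = sinh t * cosh t / c \<and>
          conn_TW V (\<psi> x) = - (sin (\<eta> z) * cos (\<eta> z) / c) \<and>
          a (\<psi> x) = exp (k z) / sqrt c \<and>
          lap \<eta> z = - (exp (- (2/3) * k z) * sin (2 * \<eta> z)) \<and>
          lap k z = 3 * exp (- (2/3) * k z) * (2 * exp (2 * k z) + cos (2 * \<eta> z))))"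
proof -
  \<comment> \<open>The chart is centred at (t p, 0, 0), so that its first coordinate has the value
    of the function t at \<open>p\<close>.\<close>
  define q :: "real^3" where "q = axis 1 (t p)"
  obtain e N' \<psi> \<psi>i where e: "\<And>i. e i > (0::real)" and N': "open N'" "p \<in> N'" "N' \<subseteq> N"
    and \<psi>: "\<psi> ` {y. \<forall>i. \<bar>y $ i - q $ i\<bar> < e i} = N'" "\<psi> q = p"
      "\<And>x. \<forall>i. \<bar>x $ i - q $ i\<bar> < e i \<Longrightarrow> \<psi>i (\<psi> x) = x"
    and sm\<psi>: "smooth_on {y. \<forall>i. \<bar>y $ i - q $ i\<bar> < e i} \<psi>" "smooth_on N' \<psi>i"
    and d\<psi>: "\<And>x. \<forall>i. \<bar>x $ i - q $ i\<bar> < e i \<Longrightarrow>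
       (\<psi> has_derivative (\<lambda>v. \<Sum>i\<in>UNIV. v $ i *\<^sub>R E i (\<psi> x))) (at x)"
    by (rule commuting_frame_coordinates[OF N(1) p smooth_E span_E E_commute]) (assumption | blast)+
  define \<Omega> where "\<Omega> = {y :: real^3. \<forall>i. \<bar>y $ i - q $ i\<bar> < e i}"
  have \<Omega>: "open \<Omega>" "convex \<Omega>" unfolding \<Omega>_def by (rule open_box convex_box)+
  have \<psi>N: "\<psi> x \<in> N" if "x \<in> \<Omega>" for x using \<psi>(1) N'(3) that by (auto simp: \<Omega>_def)
  have d\<psi>': "(\<psi> has_derivative (\<lambda>v. \<Sum>i\<in>UNIV. v $ i *\<^sub>R E i (\<psi> x))) (at x)" if "x \<in> \<Omega>" for x
    using that by (intro d\<psi>) (simp add: \<Omega>_def)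
  have df: "((\<lambda>x. f (\<psi> x)) has_derivative (\<lambda>v. \<Sum>i\<in>UNIV. v $ i *\<^sub>R lie (E i) f (\<psi> x))) (at x)"
    if "smooth_on N f" "x \<in> \<Omega>" for f :: "real^3 \<Rightarrow> real" and x
    by (rule has_derivative_compose_frame[where E = E and \<psi> = \<psi> and x = x, OF N(1) \<psi>N[OF that(2)] that(1) d\<psi>'[OF that(2)]])
  have q: "q \<in> \<Omega>" using e by (simp add: \<Omega>_def)
  \<comment> \<open>The frame satisfies E 1 t = 1 and E 2 t = E 3 t = 0, hence t o \<psi> differs
    from the first coordinate by a constant, which is zero at \<open>q\<close>.\<close>
  have t\<psi>: "t (\<psi> x) = x $ 1" if x: "x \<in> \<Omega>" for x
  proof -
    have "((\<lambda>x. t (\<psi> x) - x $ 1) has_derivative (\<lambda>v. 0)) (at y)" if "y \<in> \<Omega>" for y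
    proof -
      have "((\<lambda>x. t (\<psi> x) - x $ 1) has_derivative (\<lambda>v. (\<Sum>i\<in>UNIV. v $ i *\<^sub>R lie (E i) t (\<psi> y)) - v $ 1)) (at y)"
        by (intro has_derivative_diff df[OF smooth_potentials(1) that] bounded_linear.has_derivative[OF bounded_linear_vec_nth] has_derivative_ident)
      then show ?thesis
        by (simp add: sum_3 lie_E[OF smooth_potentials(1) \<psi>N[OF that]] lie_T_potentials[OF \<psi>N[OF that]] u_def w_def)
    qed
    from has_derivative_zero_on_segment[OF \<Omega>(2) x q this] show ?thesis unfolding \<psi>(2) by (simp add: q_def)
  qed
  define L :: "real \<times> real \<Rightarrow> real^3" where "L z = fst z *\<^sub>R axis 2 1 + snd z *\<^sub>R axis 3 1" for z
  have L: "bounded_linear L"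
    unfolding L_def[abs_def]
    by (intro bounded_linear_add bounded_linear_scaleR_left[THEN bounded_linear_compose] bounded_linear_fst bounded_linear_snd)
  define D where "D = {z :: real \<times> real. \<bar>fst z\<bar> < e 2 \<and> \<bar>snd z\<bar> < e 3}"
  have D: "open D"
    unfolding D_def by (intro open_Collect_conj open_Collect_less continuous_intros)
  have comp: "(q + L z) $ 1 = t p" "(q + L z) $ 2 = fst z" "(q + L z) $ 3 = snd z" for z
    by (simp_all add: q_def L_def axis_def)
  have JD: "q + L z \<in> \<Omega>" if "z \<in> D" for z
    using that e[of 1] unfolding \<Omega>_def mem_Collect_eq forall_3 comp by (simp add: D_def q_def axis_def)
  have xD: "(x $ 2, x $ 3) \<in> D" if "x \<in> \<Omega>" for x
  proof -
    have "\<bar>x $ 2 - q $ 2\<bar> < e 2" "\<bar>x $ 3 - q $ 3\<bar> < e 3" using that by (auto simp: \<Omega>_def)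
    then show ?thesis by (simp add: D_def q_def axis_def)
  qed
  \<comment> \<open>The restriction of \<open>f\<close> to the slice of the chart on which t has the
    value \<open>t p\<close>, as a function of (v, w).\<close>
  define J where "J f z = f (\<psi> (q + L z))" for f :: "real^3 \<Rightarrow> real" and z
  have smJ: "smooth_on D (J f)" if "smooth_on N f" for f
  proof -
    have "smooth_on \<Omega> (\<lambda>x. f (\<psi> x))"
      using \<psi>N by (intro smooth_on_compose_frame[where E = E and \<psi> = \<psi>, OF \<Omega>(1) N(1) _ smooth_E d\<psi>' that]) auto
    from smooth_on_compose_affine[OF L D \<Omega>(1) JD this] show ?thesis by (simp add: J_def[abs_def])
  qed
  \<comment> \<open>The segment from \<open>x\<close> to its projection on the slice is parallel to
    the first axis, along which f o \<psi> has derivative T f = 0.\<close>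
  have Jconst: "f (\<psi> x) = J f (x $ 2, x $ 3)" if f: "smooth_on N f" "\<And>x. x \<in> N \<Longrightarrow> lie T f x = 0" and x: "x \<in> \<Omega>" for f x
    unfolding J_def
  proof (rule has_derivative_zero_on_segment[OF \<Omega>(2) x JD[OF xD[OF x]] df[OF f(1)]])
    fix y assume y: "y \<in> \<Omega>"
    have "(q + L (x $ 2, x $ 3) - x) $ 2 = 0" "(q + L (x $ 2, x $ 3) - x) $ 3 = 0"
      by (simp_all add: q_def L_def axis_def)
    then show "(\<Sum>i\<in>UNIV. (q + L (x $ 2, x $ 3) - x) $ i *\<^sub>R lie (E i) f (\<psi> y)) = 0"
      using f(2)[OF \<psi>N[OF y]] by (simp add: sum_3 lie_E(1)[OF f(1) \<psi>N[OF y]])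
  qed
  have dJ1: "((\<lambda>r. J f (r, snd z)) has_real_derivative J (lie (E 2) f) z) (at (fst z))"
    and dJ2: "((\<lambda>r. J f (fst z, r)) has_real_derivative J (lie (E 3) f) z) (at (snd z))" if "smooth_on N f" "z \<in> D" for f z
  proof -
    have 1: "(q + snd z *\<^sub>R axis 3 1) + r *\<^sub>R axis 2 1 = q + L (r, snd z)" for r by (simp add: L_def)
    have 2: "(q + fst z *\<^sub>R axis 2 1) + r *\<^sub>R axis 3 1 = q + L (fst z, r)" for r by (simp add: L_def)
    show "((\<lambda>r. J f (r, snd z)) has_real_derivative J (lie (E 2) f) z) (at (fst z))"
      using has_real_derivative_along_line[of "\<lambda>x. f (\<psi> x)" _ "q + snd z *\<^sub>R axis 3 1" "fst z" "axis 2 1",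
          unfolded 1 prod.collapse, OF df[OF that(1) JD[OF that(2)]]] by (simp add: J_def sum_3 axis_def)
    show "((\<lambda>r. J f (fst z, r)) has_real_derivative J (lie (E 3) f) z) (at (snd z))"
      using has_real_derivative_along_line[of "\<lambda>x. f (\<psi> x)" _ "q + fst z *\<^sub>R axis 2 1" "snd z" "axis 3 1",
          unfolded 2 prod.collapse, OF df[OF that(1) JD[OF that(2)]]] by (simp add: J_def sum_3 axis_def)
  qed
  have lapJ: "lap (J f) z = lie (E 2) (lie (E 2) f) (\<psi> (q + L z)) + lie (E 3) (lie (E 3) f) (\<psi> (q + L z))"
    if f: "smooth_on N f" and z: "z \<in> D" for f z
  proof -
    \<comment> \<open>The inner derivative must be identified on a neighbourhood, not only at the
      point, before the outer derivative can be taken.\<close>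
    have "eventually (\<lambda>s. (s, snd z) \<in> D) (nhds (fst z))"
    proof (rule eventually_nhds_in_open[of "{s. \<bar>s\<bar> < e 2}", THEN eventually_mono])
      show "open {s. \<bar>s\<bar> < e 2}" by (intro open_Collect_less continuous_intros)
    qed (use z in \<open>auto simp: D_def\<close>)
    then have "eventually (\<lambda>s. deriv (\<lambda>r. J f (r, snd z)) s = J (lie (E 2) f) (s, snd z)) (nhds (fst z))"
      by (rule eventually_mono) (use dJ1[OF f] in \<open>auto intro!: DERIV_imp_deriv\<close>)
    then have 1: "deriv (\<lambda>s. deriv (\<lambda>r. J f (r, snd z)) s) (fst z) = J (lie (E 2) (lie (E 2) f)) z"
      using DERIV_imp_deriv[OF dJ1[OF smooth_on_lie[OF N(1) smooth_E f] z]] deriv_cong_ev by metis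
    have "eventually (\<lambda>s. (fst z, s) \<in> D) (nhds (snd z))"
    proof (rule eventually_nhds_in_open[of "{s. \<bar>s\<bar> < e 3}", THEN eventually_mono])
      show "open {s. \<bar>s\<bar> < e 3}" by (intro open_Collect_less continuous_intros)
    qed (use z in \<open>auto simp: D_def\<close>)
    then have "eventually (\<lambda>s. deriv (\<lambda>r. J f (fst z, r)) s = J (lie (E 3) f) (fst z, s)) (nhds (snd z))"
      by (rule eventually_mono) (use dJ2[OF f] in \<open>auto intro!: DERIV_imp_deriv\<close>)
    then have 2: "deriv (\<lambda>s. deriv (\<lambda>r. J f (fst z, r)) s) (snd z) = J (lie (E 3) (lie (E 3) f)) z"
      using DERIV_imp_deriv[OF dJ2[OF smooth_on_lie[OF N(1) smooth_E f] z]] deriv_cong_ev by metis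
    show ?thesis unfolding lap_def 1 2 by (simp add: J_def)
  qed
  have pde: "lap (J \<eta>) z = - (exp (- (2/3) * J k z) * sin (2 * J \<eta> z))"
    "lap (J k) z = 3 * exp (- (2/3) * J k z) * (2 * exp (2 * J k z) + cos (2 * J \<eta> z))" if z: "z \<in> D" for z
  proof -
    define y where "y = \<psi> (q + L z)"
    have y: "y \<in> N" unfolding y_def by (rule \<psi>N[OF JD[OF z]])
    have J: "J f z = f y" for f by (simp add: J_def y_def)
    let ?c = "exp (2 * \<kappa> y)"
    have L\<eta>: "lie (E 2) (lie (E 2) \<eta>) y + lie (E 3) (lie (E 3) \<eta>) y = ((F1 y)\<^sup>2 + (F2 y)\<^sup>2) *
        (lie V (lie V \<eta>) y + lie W (lie W \<eta>) y + conn_VW W y * lie V \<eta> y - conn_VW V y * lie W \<eta> y)"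
      by (rule laplacian_E[OF smooth_potentials(2) y]) (rule lie_T_potentials(2))
    have Lk: "lie (E 2) (lie (E 2) k) y + lie (E 3) (lie (E 3) k) y = ((F1 y)\<^sup>2 + (F2 y)\<^sup>2) *
        (lie V (lie V k) y + lie W (lie W k) y + conn_VW W y * lie V k y - conn_VW V y * lie W k y)"
      by (rule laplacian_E[OF smooth_k y]) (rule lie_T_k)
    \<comment> \<open>The factor exp (2 \<kappa>) of |F|^2 meets 2 \<alpha>23 and yields -2 sin
      \<eta> cos \<eta>.\<close>
    have "lap (J \<eta>) z = exp (- (2/3) * k y) * (2 * (?c * conn_TW V y))"
      unfolding lapJ[OF smooth_potentials(2) z] y_def[symmetric] L\<eta>
        laplace_operator_values[OF y] F_norm by simp
    then show "lap (J \<eta>) z = - (exp (- (2/3) * J k z) * sin (2 * J \<eta> z))"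
      unfolding val(3)[OF y] J by (simp add: sin_double)
    have ek: "exp (2 * k y) = ?c * (a y)\<^sup>2"
      using a_pos[OF NU[OF y]] by (simp add: k_def l_def exp_add exp_double algebra_simps)
    have ch: "(cosh (t y))\<^sup>2 = 1 + (sinh (t y))\<^sup>2" using cosh_square_eq[of "t y"] by simp
    have sn: "(sin (\<eta> y))\<^sup>2 = 1 - (cos (\<eta> y))\<^sup>2" by (simp add: sin_squared_eq)
    \<comment> \<open>The identity |cosh \<zeta>|^2 - |sinh \<zeta>|^2 = cos (2 \<eta>). The extra
      factor \<open>?c\<close> allows the known products of \<open>?c\<close> with the invariants to
      be substituted; it is cancelled at the end.\<close>
    have "?c * (?c * (1 - (conn_TV V y)\<^sup>2 - (conn_TW V y)\<^sup>2)) = ?c\<^sup>2 - (?c * conn_TV V y)\<^sup>2 - (?c * conn_TW V y)\<^sup>2"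
      by (simp add: power2_eq_square algebra_simps)
    also have "\<dots> = ?c\<^sup>2 - (sinh (t y))\<^sup>2 * (1 + (sinh (t y))\<^sup>2) - (1 - (cos (\<eta> y))\<^sup>2) * (cos (\<eta> y))\<^sup>2"
      unfolding val(2,3)[OF y] by (simp add: power_mult_distrib ch sn)
    also have "\<dots> = ?c * (2 * (cos (\<eta> y))\<^sup>2 - 1)"
      unfolding val(1)[OF y, symmetric] by (simp add: power2_eq_square algebra_simps)
    finally have c2: "?c * (1 - (conn_TV V y)\<^sup>2 - (conn_TW V y)\<^sup>2) = cos (2 * \<eta> y)"
      by (simp add: cos_double_cos)
    have "lap (J k) z = exp (- (2/3) * k y) * (3 * (?c * (1 - (conn_TV V y)\<^sup>2 - (conn_TW V y)\<^sup>2)) + 6 * (?c * (a y)\<^sup>2))"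
      unfolding lapJ[OF smooth_k z] y_def[symmetric] Lk
        laplace_operator_values[OF y] F_norm by (simp add: algebra_simps)
    then show "lap (J k) z = 3 * exp (- (2/3) * J k z) * (2 * exp (2 * J k z) + cos (2 * J \<eta> z))"
      unfolding c2 ek[symmetric] J by (simp add: algebra_simps)
  qed
  have vals: "conn_TV V (\<psi> x) = sinh (x $ 1) * cosh (x $ 1) / c \<and> conn_TW V (\<psi> x) = - (sin (J \<eta> z) * cos (J \<eta> z) / c)
      \<and> a (\<psi> x) = exp (J k z) / sqrt c"
    if x: "x \<in> \<Omega>" and z: "z = (x $ 2, x $ 3)" and c: "c = (cos (J \<eta> z))\<^sup>2 + (sinh (x $ 1))\<^sup>2" for x z c
  proof -
    note y = \<psi>N[OF x]
    have \<eta>: "\<eta> (\<psi> x) = J \<eta> z" and k: "k (\<psi> x) = J k z"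
      unfolding z by (rule Jconst[OF smooth_potentials(2) lie_T_potentials(2) x] Jconst[OF smooth_k lie_T_k x], assumption)+
    have ck: "c = exp (2 * \<kappa> (\<psi> x))" using val(1)[OF y] by (simp add: c \<eta> t\<psi>[OF x])
    have "sqrt c = exp (\<kappa> (\<psi> x))" unfolding ck by (simp add: exp_double)
    moreover have "exp (k (\<psi> x)) = a (\<psi> x) * exp (\<kappa> (\<psi> x))"
      using a_pos[OF NU[OF y]] by (simp add: k_def l_def exp_add)
    ultimately have "a (\<psi> x) = exp (J k z) / sqrt c" by (simp add: k)
    moreover have "conn_TV V (\<psi> x) = sinh (x $ 1) * cosh (x $ 1) / c" "conn_TW V (\<psi> x) = - (sin (J \<eta> z) * cos (J \<eta> z) / c)"
      using val(2,3)[OF y] unfolding ck[symmetric] \<eta> t\<psi>[OF x] by (simp_all add: ck field_simps)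
    ultimately show ?thesis by blast
  qed
  show ?thesis
    by (rule exI[of _ \<Omega>], rule exI[of _ N'], rule exI[of _ \<psi>], rule exI[of _ \<psi>i], rule exI[of _ D], rule exI[of _ "J \<eta>"], rule exI[of _ "J k"])
      (use \<Omega> N' N \<psi> sm\<psi> D smJ[OF smooth_potentials(2)] smJ[OF smooth_k] xD pde[OF xD] vals in \<open>simp add: \<Omega>_def[symmetric] Let_def; auto simp: \<Omega>_def\<close>)
qed

end

section \<open>Existence of the potentials\<close>

context S3_hypersphere begin

text \<open>The differential of \<zeta> times 1 - \<mu>^2 is that of \<mu>, so the Riccati and
  Cauchy-Riemann equations of \<mu> pass to \<zeta> after cancelling 1 - \<mu>^2, which vanishes
  nowhere. They pass on to S because its differential is \<mu> times that of \<zeta>.\<close>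

lemma exists_potentials:
  assumes p: "p \<in> U" and ne: "(conn_TV V p, conn_TW V p) \<noteq> (1, 0)" "(conn_TV V p, conn_TW V p) \<noteq> (- 1, 0)"
  obtains N t \<eta> \<kappa> \<theta> where "S3_potentials U \<phi> \<xi> \<Gamma> \<Gamma>h h T V W a N t \<eta> \<kappa> \<theta>" "p \<in> N"
    "\<And>x. x \<in> N \<Longrightarrow> (cos (\<eta> x))\<^sup>2 + (sinh (t x))\<^sup>2 = exp (2 * \<kappa> x)"
    "\<And>x. x \<in> N \<Longrightarrow> exp (2 * \<kappa> x) * conn_TV V x = sinh (t x) * cosh (t x)"
    "\<And>x. x \<in> N \<Longrightarrow> exp (2 * \<kappa> x) * conn_TW V x = - (sin (\<eta> x) * cos (\<eta> x))"
proof -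
  obtain N t \<eta> \<kappa> \<theta> where N: "open N" "p \<in> N" "N \<subseteq> U"
    and sm: "smooth_on N t" "smooth_on N \<eta>" "smooth_on N \<kappa>" "smooth_on N \<theta>"
    and val: "\<And>x. x \<in> N \<Longrightarrow> (cos (\<eta> x))\<^sup>2 + (sinh (t x))\<^sup>2 = exp (2 * \<kappa> x)"
      "\<And>x. x \<in> N \<Longrightarrow> exp (2 * \<kappa> x) * conn_TV V x = sinh (t x) * cosh (t x)"
      "\<And>x. x \<in> N \<Longrightarrow> exp (2 * \<kappa> x) * conn_TW V x = - (sin (\<eta> x) * cos (\<eta> x))"
    and nz: "\<And>x. x \<in> N \<Longrightarrow> 1 - (Complex (conn_TV V x) (conn_TW V x))\<^sup>2 \<noteq> 0"
    and d\<zeta>: "\<And>X x. x \<in> N \<Longrightarrow> Complex (lie X t x) (- lie X \<eta> x) * (1 - (Complex (conn_TV V x) (conn_TW V x))\<^sup>2) = Complex (lie X (conn_TV V) x) (lie X (conn_TW V) x)"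
    and dS: "\<And>X x. x \<in> N \<Longrightarrow> Complex (lie X \<kappa> x) (lie X \<theta> x) = Complex (conn_TV V x) (conn_TW V x) * Complex (lie X t x) (- lie X \<eta> x)"
    by (rule artanh_coordinates[OF U p smooth_coeffs(3,6) ne]) blast
  have T: "lie T t x = 1" "lie T \<eta> x = 0" "lie T \<kappa> x = conn_TV V x" "lie T \<theta> x = conn_TW V x" if x: "x \<in> N" for x
  proof -
    have "x \<in> U" using x N by blast
    note c = lie_T_coeffs[OF this]
    have "Complex (lie T t x) (- lie T \<eta> x) * (1 - (Complex (conn_TV V x) (conn_TW V x))\<^sup>2) = 1 * (1 - (Complex (conn_TV V x) (conn_TW V x))\<^sup>2)"
      unfolding d\<zeta>[OF x] c by (simp add: complex_eq_iff power2_eq_square)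
    then have 1: "Complex (lie T t x) (- lie T \<eta> x) = 1" using nz[OF x] mult_right_cancel by blast
    then show "lie T t x = 1" "lie T \<eta> x = 0" by (simp_all add: complex_eq_iff)
    show "lie T \<kappa> x = conn_TV V x" "lie T \<theta> x = conn_TW V x" using dS[OF x, of T] unfolding 1 by simp_all
  qed
  have W: "lie W t x = lie V \<eta> x" "lie W \<eta> x = - lie V t x" "lie W \<kappa> x = - lie V \<theta> x" "lie W \<theta> x = lie V \<kappa> x"
    if x: "x \<in> N" for x
  proof -
    have "x \<in> U" using x N by blast
    note c = codazzi_gauss_VW(3,4)[OF this]
    have "Complex (lie W t x) (- lie W \<eta> x) * (1 - (Complex (conn_TV V x) (conn_TW V x))\<^sup>2)
        = \<i> * (Complex (lie V t x) (- lie V \<eta> x) * (1 - (Complex (conn_TV V x) (conn_TW V x))\<^sup>2))"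
      unfolding d\<zeta>[OF x] c by (simp add: complex_eq_iff)
    also have "\<dots> = (\<i> * Complex (lie V t x) (- lie V \<eta> x)) * (1 - (Complex (conn_TV V x) (conn_TW V x))\<^sup>2)"
      by (simp only: mult.assoc)
    finally have 1: "Complex (lie W t x) (- lie W \<eta> x) = \<i> * Complex (lie V t x) (- lie V \<eta> x)"
      using nz[OF x] mult_right_cancel by blast
    then show "lie W t x = lie V \<eta> x" "lie W \<eta> x = - lie V t x" by (simp_all add: complex_eq_iff)
    have "Complex (lie W \<kappa> x) (lie W \<theta> x) = \<i> * Complex (lie V \<kappa> x) (lie V \<theta> x)"
      unfolding dS[OF x] 1 by (simp only: mult.left_commute)
    then show "lie W \<kappa> x = - lie V \<theta> x" "lie W \<theta> x = lie V \<kappa> x" by (simp_all add: complex_eq_iff)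
  qed
  have "S3_potentials U \<phi> \<xi> \<Gamma> \<Gamma>h h T V W a N t \<eta> \<kappa> \<theta>"
    by (unfold_locales; (fact N sm T W | rule T W; assumption))
  from that[OF this N(2) val] show thesis .
qed

end

theorem theorem7p27:
  fixes U :: "(real^3) set" and \<phi> \<xi> :: "real^3 \<Rightarrow> real^4"
    and \<Gamma> \<Gamma>h :: "real^3 \<Rightarrow> real^3 \<Rightarrow> real^3 \<Rightarrow> real^3"
    and h :: "real^3 \<Rightarrow> real^3 \<Rightarrow> real^3 \<Rightarrow> real"
    and T V W :: "real^3 \<Rightarrow> real^3" and a6 :: "real^3 \<Rightarrow> real"
  assumes "open U"
    and "smooth_on U \<phi>"
    and "\<forall>p\<in>U. inj (dphi \<phi> p)"
    and "blaschke_structure U \<phi> \<xi> \<Gamma> h"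
    and "hypersphere_H1 U \<phi> \<xi>"
    and "levi_civita U h \<Gamma>h"
    and "pointwise_S3_symmetric U h (Kdiff \<Gamma> \<Gamma>h)"
    and "S3_frame U h (Kdiff \<Gamma> \<Gamma>h) T V W a6"
    and "\<forall>p\<in>U. (alpha22 h \<Gamma>h T V p, alpha23 h \<Gamma>h T V W p) \<noteq> (1, 0)
              \<and> (alpha22 h \<Gamma>h T V p, alpha23 h \<Gamma>h T V W p) \<noteq> (-1, 0)"
  shows "\<forall>p\<in>U. \<exists>(\<Omega> :: (real^3) set) N (\<psi> :: real^3 \<Rightarrow> real^3) \<psi>i (D :: (real \<times> real) set)
              (\<eta> :: real \<times> real \<Rightarrow> real) (k :: real \<times> real \<Rightarrow> real).
     open \<Omega> \<and> open N \<and> p \<in> N \<and> N \<subseteq> U \<and> \<psi> ` \<Omega> = N \<and>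
     smooth_on \<Omega> \<psi> \<and> smooth_on N \<psi>i \<and> (\<forall>x\<in>\<Omega>. \<psi>i (\<psi> x) = x) \<and>
     open D \<and> smooth_on D \<eta> \<and> smooth_on D k \<and>
     (\<forall>x\<in>\<Omega>. (x$2, x$3) \<in> D \<and>
        (let t = x$1; z = (x$2, x$3); c = (cos (\<eta> z))\<^sup>2 + (sinh t)\<^sup>2 in
          alpha22 h \<Gamma>h T V (\<psi> x) = sinh t * cosh t / c \<and>
          alpha23 h \<Gamma>h T V W (\<psi> x) = - (sin (\<eta> z) * cos (\<eta> z) / c) \<and>
          a6 (\<psi> x) = exp (k z) / sqrt c \<and>
          lap \<eta> z = - (exp (- (2/3) * k z) * sin (2 * \<eta> z)) \<and>
          lap k z = 3 * exp (- (2/3) * k z) * (2 * exp (2 * k z) + cos (2 * \<eta> z))))"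
proof -
  interpret S3_hypersphere U \<phi> \<xi> \<Gamma> \<Gamma>h h T V W a6
    using assms by unfold_locales auto
  show ?thesis
  proof (rule ballI, goal_cases)
    case (1 p)
    have ne: "(conn_TV V p, conn_TW V p) \<noteq> (1, 0)" "(conn_TV V p, conn_TW V p) \<noteq> (- 1, 0)"
      using assms(9) 1 by (auto simp: alpha22_eq alpha23_eq)
    obtain N t \<eta> \<kappa> \<theta> where pot: "S3_potentials U \<phi> \<xi> \<Gamma> \<Gamma>h h T V W a6 N t \<eta> \<kappa> \<theta>" and "p \<in> N"
      and val: "\<And>x. x \<in> N \<Longrightarrow> (cos (\<eta> x))\<^sup>2 + (sinh (t x))\<^sup>2 = exp (2 * \<kappa> x)"
        "\<And>x. x \<in> N \<Longrightarrow> exp (2 * \<kappa> x) * conn_TV V x = sinh (t x) * cosh (t x)"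
        "\<And>x. x \<in> N \<Longrightarrow> exp (2 * \<kappa> x) * conn_TW V x = - (sin (\<eta> x) * cos (\<eta> x))"
      by (rule exists_potentials[OF 1 ne]) blast
    interpret P: S3_potentials U \<phi> \<xi> \<Gamma> \<Gamma>h h T V W a6 N t \<eta> \<kappa> \<theta>
      by (rule pot)
    show ?case
      using P.coordinates[OF \<open>p \<in> N\<close> val] unfolding alpha22_eq alpha23_eq .
  qed
qed

end
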